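(* Let $p\in\mathbb{R}^n$, $n\geq 2$, and let $L$ be an elliptic differential operator with real analytic coefficients defined on an open neighborhood $\Omega$ of $p$ in $\mathbb{R}^n$. Then there exists a germ $g$ at $p$ of a smooth complex-valued function, flat at $p$, such that there is no germ $u$ at $p$ of a smooth complex-valued function that is flat at $p$ and satisfies $Lu=g$ (as germs at $p$).
   Context: All functions are complex-valued. A smooth function $f$ defined near $p$ is flat at $p$ if all its partial derivatives of all orders (including order $0$) vanish at $p$. Germs at $p$: two functions defined near $p$ are identified if they agree on a neighborhood of $p$. For a multi-index $\alpha\in\mathbb{N}^n$, $D^\alpha=\partial_{x_1}^{\alpha_1}\cdots\partial_{x_n}^{\alpha_n}$ and $|\alpha|=\alpha_1+\dots+\alpha_n$. A differential operator of order $m$ with real analytic coefficients on $\Omega$ is $L=\sum_{|\alpha|\leq m}a_\alpha D^\alpha$ with each $a_\alpha$ a complex-valued real analytic function on $\Omega$. It is elliptic if $\sum_{|\alpha|=m}a_\alpha(x)\xi^\alpha\neq 0$ for all $x\in\Omega$ and all $\xi\in\mathbb{R}^n\setminus\{0\}$.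
   Formalization: The operator L is assumed to have order m ≥ 1; for order 0 the claim fails, since L is then multiplication by a nowhere vanishing analytic function a_0 and u = g/a_0 is always a flat solution. *)

theory Defs
  imports "HOL-Analysis.Analysis"
begin

text \<open>
  Functions are total functions on \<open>real ^ 'n\<close>; functions defined only on an open set are
  represented by arbitrary extensions, and every notion below at a point depends only on the
  values near that point.
\<close>

definition has_partial :: "'n \<Rightarrow> (real ^ 'n::finite \<Rightarrow> complex) \<Rightarrow> real ^ 'n \<Rightarrow> bool" where
  "has_partial i f x \<longleftrightarrow> (\<lambda>t::real. f (x + t *\<^sub>R axis i 1)) differentiable (at 0)"

definition partial :: "'n \<Rightarrow> (real ^ 'n::finite \<Rightarrow> complex) \<Rightarrow> real ^ 'n \<Rightarrow> complex" where
  "partial i f x = vector_derivative (\<lambda>t::real. f (x + t *\<^sub>R axis i 1)) (at 0)"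

primrec Ck_on :: "nat \<Rightarrow> (real ^ 'n::finite) set \<Rightarrow> (real ^ 'n \<Rightarrow> complex) \<Rightarrow> bool" where
  "Ck_on 0 U f \<longleftrightarrow> continuous_on U f"
| "Ck_on (Suc k) U f \<longleftrightarrow>
     continuous_on U f \<and> (\<forall>i. (\<forall>x\<in>U. has_partial i f x) \<and> Ck_on k U (partial i f))"

definition smooth_at :: "real ^ 'n::finite \<Rightarrow> (real ^ 'n \<Rightarrow> complex) \<Rightarrow> bool" where
  "smooth_at p f \<longleftrightarrow> (\<exists>U. open U \<and> p \<in> U \<and> (\<forall>k. Ck_on k U f))"

text \<open>Multi-indices are elements of \<open>nat ^ 'n\<close>.\<close>

definition mi_abs :: "nat ^ 'n::finite \<Rightarrow> nat" where
  "mi_abs \<alpha> = (\<Sum>i\<in>UNIV. \<alpha> $ i)"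

definition mi_power :: "real ^ 'n::finite \<Rightarrow> nat ^ 'n \<Rightarrow> real" where
  "mi_power \<xi> \<alpha> = (\<Prod>i\<in>UNIV. (\<xi> $ i) ^ (\<alpha> $ i))"

text \<open>
  A numbering \<open>x\<^sub>1, \<dots>, x\<^sub>n\<close> of the coordinates, which fixes the order of the partial
  derivatives in \<open>D\<^sup>\<alpha>\<close>. This order is irrelevant for smooth functions.
\<close>

definition axes :: "'n::finite list" where
  "axes = (SOME is. distinct is \<and> set is = UNIV)"

lemma distinct_axes: "distinct (axes :: 'n::finite list)"
  and set_axes: "set (axes :: 'n list) = UNIV"
proof -
  have "\<exists>is :: 'n list. distinct is \<and> set is = UNIV"
    using finite_distinct_list[OF finite] by blast
  from someI_ex[OF this]
  show "distinct (axes :: 'n::finite list)" "set (axes :: 'n list) = UNIV"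
    by (simp_all add: axes_def)
qed

definition mi_deriv ::
  "nat ^ 'n::finite \<Rightarrow> (real ^ 'n \<Rightarrow> complex) \<Rightarrow> real ^ 'n \<Rightarrow> complex" where
  "mi_deriv \<alpha> f = foldr (\<lambda>i. partial i ^^ (\<alpha> $ i)) axes f"

definition flat_at :: "real ^ 'n::finite \<Rightarrow> (real ^ 'n \<Rightarrow> complex) \<Rightarrow> bool" where
  "flat_at p f \<longleftrightarrow> (\<forall>\<alpha>. mi_deriv \<alpha> f p = 0)"

definition real_analytic_on :: "(real ^ 'n::finite \<Rightarrow> complex) \<Rightarrow> (real ^ 'n) set \<Rightarrow> bool" where
  "real_analytic_on f U \<longleftrightarrow>
     (\<forall>y\<in>U. \<exists>c r. r > 0 \<and>
        (\<forall>x\<in>ball y r. ((\<lambda>\<alpha>. c \<alpha> * complex_of_real (mi_power (x - y) \<alpha>)) has_sum f x) UNIV))"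

text \<open>
  A differential operator is given by its order bound \<open>m\<close> and its coefficient family; only the
  coefficients \<open>a \<alpha>\<close> with \<open>mi_abs \<alpha> \<le> m\<close> are relevant.
\<close>

definition diff_op ::
  "nat \<Rightarrow> (nat ^ 'n::finite \<Rightarrow> real ^ 'n \<Rightarrow> complex) \<Rightarrow> (real ^ 'n \<Rightarrow> complex)
    \<Rightarrow> real ^ 'n \<Rightarrow> complex" where
  "diff_op m a f x = (\<Sum>\<alpha> | mi_abs \<alpha> \<le> m. a \<alpha> x * mi_deriv \<alpha> f x)"

definition elliptic_on ::
  "(real ^ 'n::finite) set \<Rightarrow> nat \<Rightarrow> (nat ^ 'n \<Rightarrow> real ^ 'n \<Rightarrow> complex) \<Rightarrow> bool" where
  "elliptic_on \<Omega> m a \<longleftrightarrow>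
     (\<forall>x\<in>\<Omega>. \<forall>\<xi>. \<xi> \<noteq> 0 \<longrightarrow>
        (\<Sum>\<alpha> | mi_abs \<alpha> = m. a \<alpha> x * complex_of_real (mi_power \<xi> \<alpha>)) \<noteq> 0)"

definition germ_at :: "'a::topological_space \<Rightarrow> ('a \<Rightarrow> 'b) \<Rightarrow> ('a \<Rightarrow> 'b) set" where
  "germ_at p f = {h. \<forall>\<^sub>F x in nhds p. h x = f x}"

definition flat_smooth_germs ::
  "real ^ 'n::finite \<Rightarrow> (real ^ 'n \<Rightarrow> complex) set set" where
  "flat_smooth_germs p = germ_at p ` {f. smooth_at p f \<and> flat_at p f}"

text \<open>The action of an operator on germs; it is independent of the representative for
  differential operators, see \<open>germ_op_diff_op\<close>.\<close>

definition germ_op ::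
  "'a::topological_space \<Rightarrow> (('a \<Rightarrow> 'b) \<Rightarrow> 'a \<Rightarrow> 'c) \<Rightarrow> ('a \<Rightarrow> 'b) set \<Rightarrow> ('a \<Rightarrow> 'c) set" where
  "germ_op p T u = (\<Union>f\<in>u. germ_at p (T f))"

lemma finite_mi_abs_le: "finite {\<alpha>::nat ^ 'n::finite. mi_abs \<alpha> \<le> m}"
proof -
  have "{\<alpha>::nat ^ 'n. mi_abs \<alpha> \<le> m} \<subseteq> vec_lambda ` (UNIV \<rightarrow>\<^sub>E {..m})"
  proof
    fix \<alpha> :: "nat ^ 'n" assume "\<alpha> \<in> {\<alpha>. mi_abs \<alpha> \<le> m}"
    then have "\<alpha> $ i \<le> m" for i
      unfolding mi_abs_def using member_le_sum[of i UNIV "\<lambda>i. \<alpha> $ i"] by simp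
    then show "\<alpha> \<in> vec_lambda ` (UNIV \<rightarrow>\<^sub>E {..m})"
      by (intro image_eqI[of _ _ "vec_nth \<alpha>"]) auto
  qed
  moreover have "finite (UNIV \<rightarrow>\<^sub>E {..m} :: ('n \<Rightarrow> nat) set)"
    by (rule finite_PiE) auto
  ultimately show ?thesis by (meson finite_imageI finite_subset)
qed

lemma germ_at_eq_iff: "germ_at p f = germ_at p g \<longleftrightarrow> (\<forall>\<^sub>F x in nhds p. f x = g x)"
proof
  assume "germ_at p f = germ_at p g"
  moreover have "f \<in> germ_at p f" by (simp add: germ_at_def)
  ultimately show "\<forall>\<^sub>F x in nhds p. f x = g x" by (simp add: germ_at_def)
next
  assume *: "\<forall>\<^sub>F x in nhds p. f x = g x"
  show "germ_at p f = germ_at p g"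
    unfolding germ_at_def using * by (auto elim: eventually_elim2)
qed

lemma partial_eventually_cong:
  assumes "\<forall>\<^sub>F x in nhds p. f x = g x"
  shows "\<forall>\<^sub>F x in nhds p. partial i f x = partial i g x"
proof -
  have "\<forall>\<^sub>F x in nhds p. \<forall>\<^sub>F y in nhds x. f y = g y"
    using assms by (simp add: eventually_eventually)
  then show ?thesis
  proof eventually_elim
    case (elim x)
    have "((\<lambda>t::real. x + t *\<^sub>R axis i 1) \<longlongrightarrow> x + 0 *\<^sub>R axis i 1) (nhds 0)"
      by (intro tendsto_intros) (auto simp: filterlim_def)
    then have "\<forall>\<^sub>F t in nhds (0::real). f (x + t *\<^sub>R axis i 1) = g (x + t *\<^sub>R axis i 1)"
      using elim by (auto dest: eventually_compose_filterlim)
    then show "partial i f x = partial i g x"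
      unfolding partial_def by (intro vector_derivative_cong_eq) auto
  qed
qed

lemma mi_deriv_eventually_cong:
  assumes "\<forall>\<^sub>F x in nhds p. f x = g x"
  shows "\<forall>\<^sub>F x in nhds p. mi_deriv \<alpha> f x = mi_deriv \<alpha> g x"
proof -
  have pow: "\<forall>\<^sub>F x in nhds p. (partial i ^^ k) f x = (partial i ^^ k) g x"
    if "\<forall>\<^sub>F x in nhds p. f x = g x" for f g :: "real ^ 'a \<Rightarrow> complex" and i k
    using that by (induction k) (auto intro: partial_eventually_cong)
  have "\<forall>\<^sub>F x in nhds p. foldr (\<lambda>i. partial i ^^ (\<alpha> $ i)) is f x
          = foldr (\<lambda>i. partial i ^^ (\<alpha> $ i)) is g x" for "is"
    using assms by (induction "is") (auto intro: pow)
  then show ?thesis by (simp add: mi_deriv_def)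
qed

lemma germ_op_diff_op: "germ_op p (diff_op m a) (germ_at p f) = germ_at p (diff_op m a f)"
proof -
  have "germ_at p (diff_op m a h) = germ_at p (diff_op m a f)" if "h \<in> germ_at p f" for h
  proof -
    have "\<forall>\<^sub>F x in nhds p. h x = f x" using that by (simp add: germ_at_def)
    then have "\<forall>\<^sub>F x in nhds p. \<forall>\<alpha>\<in>{\<alpha>. mi_abs \<alpha> \<le> m}. mi_deriv \<alpha> h x = mi_deriv \<alpha> f x"
      by (intro eventually_ball_finite finite_mi_abs_le ballI mi_deriv_eventually_cong)
    then show ?thesis
      unfolding germ_at_eq_iff diff_op_def by eventually_elim (auto intro: sum.cong)
  qed
  moreover have "f \<in> germ_at p f" by (simp add: germ_at_def)
  ultimately show ?thesis unfolding germ_op_def by blast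
qed

end

theory Submission
  imports Defs "HOL-Probability.Probability"
begin

text \<open>
  Formal power series solutions of \<open>L v = 0\<close> at \<open>p\<close> may grow arbitrarily fast: if \<open>e \<noteq> i\<close> are two axes,
  then by ellipticity the coefficient of \<open>\<partial>\<^sub>e\<^sup>m\<close> does not vanish at \<open>p\<close>, so the Taylor coefficients
  \<open>\<partial>\<^sub>i\<^sup>k v(p)\<close> can be prescribed freely. By Borel's lemma such a series is the Taylor series of a smooth
  function \<open>v\<close>, and \<open>g = L v\<close> is flat. If \<open>L u = g\<close> with \<open>u\<close> flat, then \<open>v - u\<close> solves the homogeneous
  equation and has the Taylor coefficients of \<open>v\<close>. But for each radius \<open>r\<close> and each \<open>k\<close>, interior
  regularity bounds \<open>\<partial>\<^sub>i\<^sup>k (v - u)(p)\<close> by a constant \<open>K r k\<close> times the \<open>C\<^sup>m\<close> norm of a cutoff of \<open>v - u\<close>,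
  and coefficients growing faster than every \<open>K (1 / j) k\<close> contradict this.

  The interior estimate comes from a parametrix for the transposed operator. For each order \<open>k\<close> finitely
  many terms of the Taylor expansion of the coefficients of \<open>L\<close> at \<open>p\<close> suffice, because the remainder vanishes
  to high order at \<open>p\<close> and thus absorbs the singularity of the kernel of the parametrix.
\<close>

section \<open>Calculus of partial derivatives\<close>

text \<open>The neighbourhood and the size of a hypothetical solution u are unknown when v is
  chosen. The constant of the interior estimate may depend in any way on the radius and on k, but
  not on the function; countably many radii suffice and the size is a single number N, so a diagonal
  choice of Taylor coefficients outgrows \<open>K j k * N\<close> for every j and every N.

  The estimate is needed at the one point p only. This permits replacing the coefficients of L by
  Taylor polynomials centred at p: multiplication by x - p is differentiation on the frequency side,
  so the transposed operator acts on functions of \<xi> alone and symbols depending on x never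
  occur.

  The obstacle is that the symbols involved need not be integrable, so their kernels exist only as
  distributions. Each symbol is therefore multiplied by a Gaussian of parameter t. All integrals
  then converge absolutely, exchanging and differentiating them is elementary, and only bounds
  uniform in t are carried through the limit t -> 0, which recovers the derivative at p.\<close>

definition partial_eq :: "'n \<Rightarrow> (real ^ 'n::finite \<Rightarrow> complex) \<Rightarrow> real ^ 'n \<Rightarrow> complex \<Rightarrow> bool" where
  "partial_eq i f x D \<longleftrightarrow> ((\<lambda>t::real. f (x + t *\<^sub>R axis i 1)) has_vector_derivative D) (at 0)"

lemma partial_eq_imp_has_partial: "partial_eq i f x D \<Longrightarrow> has_partial i f x"
  unfolding partial_eq_def has_partial_def by (rule differentiableI_vector)

lemma partial_eq_imp_partial: "partial_eq i f x D \<Longrightarrow> partial i f x = D"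
  unfolding partial_eq_def partial_def by (rule vector_derivative_at)

lemma has_partial_imp_partial_eq: "has_partial i f x \<Longrightarrow> partial_eq i f x (partial i f x)"
  unfolding partial_eq_def partial_def has_partial_def by (rule iffD1[OF vector_derivative_works])

text \<open>Partial derivatives are defined by differentiating at parameter 0. Termwise
  differentiation and the mean value inequality need the derivative at every parameter of the axis
  line.\<close>

lemma partial_eq_shift:
  assumes "partial_eq i f (x + t *\<^sub>R axis i 1) D"
  shows "((\<lambda>t. f (x + t *\<^sub>R axis i 1)) has_vector_derivative D) (at t)"
proof -
  have "((\<lambda>s. f (x + t *\<^sub>R axis i 1 + s *\<^sub>R axis i 1)) has_vector_derivative D) (at (t - t))"
    using assms by (simp add: partial_eq_def)
  then have "((\<lambda>s. f (x + t *\<^sub>R axis i 1 + s *\<^sub>R axis i 1)) \<circ> (\<lambda>s. s - t) has_vector_derivative 1 *\<^sub>R D) (at t)"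
    by (intro vector_diff_chain_at) (auto intro!: derivative_eq_intros)
  moreover have "(\<lambda>s. f (x + t *\<^sub>R axis i 1 + s *\<^sub>R axis i 1)) \<circ> (\<lambda>s. s - t) = (\<lambda>t. f (x + t *\<^sub>R axis i 1))"
    by (auto simp: fun_eq_iff scaleR_left_diff_distrib add.assoc)
  ultimately show ?thesis by simp
qed

lemma partial_eq_const: "partial_eq i (\<lambda>x. c) x 0"
  by (simp add: partial_eq_def)

lemma partial_eq_coord:
  "partial_eq i (\<lambda>x. complex_of_real (x $ j)) x (if i = j then 1 else 0)"
  unfolding partial_eq_def
  by (auto intro!: derivative_eq_intros has_vector_derivative_of_real simp: axis_def)

lemma partial_eq_add:
  "partial_eq i f x D \<Longrightarrow> partial_eq i g x E \<Longrightarrow> partial_eq i (\<lambda>x. f x + g x) x (D + E)"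
  unfolding partial_eq_def by (rule has_vector_derivative_add)

lemma partial_eq_mult:
  "partial_eq i f x D \<Longrightarrow> partial_eq i g x E \<Longrightarrow>
    partial_eq i (\<lambda>x. f x * g x) x (D * g x + f x * E)"
  unfolding partial_eq_def
  by (drule (1) has_vector_derivative_mult) (simp add: add.commute)

lemma partial_eq_inverse:
  assumes "partial_eq i f x D" "f x \<noteq> 0"
  shows "partial_eq i (\<lambda>x. inverse (f x)) x (- D * inverse (f x) * inverse (f x))"
proof -
  have "(inverse has_field_derivative - (inverse (f x) * inverse (f x))) (at (f x))"
    using DERIV_inverse[of "f x" UNIV] assms(2) by (simp add: power2_eq_square)
  then have "(inverse \<circ> (\<lambda>t. f (x + t *\<^sub>R axis i 1)) has_vector_derivative
      D * - (inverse (f x) * inverse (f x))) (at 0)"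
    using assms(1) unfolding partial_eq_def by (intro field_vector_diff_chain_at) auto
  then show ?thesis by (simp add: partial_eq_def o_def mult.assoc)
qed

text \<open>The chain rule lives on real-valued functions, while the calculus here is
  complex-valued; the real inner derivative is recovered through \<open>Re\<close>.\<close>

lemma partial_eq_of_real_comp:
  assumes "partial_eq i (\<lambda>x. complex_of_real (h x)) x (complex_of_real D)"
    and "(\<phi> has_real_derivative E) (at (h x))"
  shows "partial_eq i (\<lambda>x. complex_of_real (\<phi> (h x))) x (complex_of_real (E * D))"
proof -
  have "((\<lambda>t. Re (complex_of_real (h (x + t *\<^sub>R axis i 1)))) has_vector_derivative Re (complex_of_real D)) (at 0)"
    using assms(1) unfolding partial_eq_def
    by (intro bounded_linear.has_vector_derivative[OF bounded_linear_Re])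
  then have "((\<lambda>t. h (x + t *\<^sub>R axis i 1)) has_real_derivative D) (at 0)"
    by (simp add: has_real_derivative_iff_has_vector_derivative)
  moreover have "(\<phi> has_real_derivative E) (at (h (x + 0 *\<^sub>R axis i 1)))"
    using assms(2) by simp
  ultimately have "(\<phi> \<circ> (\<lambda>t. h (x + t *\<^sub>R axis i 1)) has_real_derivative E * D) (at 0)"
    by (intro DERIV_chain)
  then show ?thesis
    unfolding partial_eq_def
    by (intro has_vector_derivative_of_real)
      (simp add: has_real_derivative_iff_has_vector_derivative o_def)
qed

lemma filterlim_axis_line: "((\<lambda>t::real. x + t *\<^sub>R axis i 1) \<longlongrightarrow> (x :: real ^ 'n::finite)) (nhds 0)"
proof -
  have "((\<lambda>t::real. x + t *\<^sub>R axis i 1) \<longlongrightarrow> x + 0 *\<^sub>R axis i 1) (nhds 0)"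
    by (intro tendsto_intros) (auto simp: filterlim_def)
  then show ?thesis by simp
qed

lemma partial_eq_cong:
  assumes "\<forall>\<^sub>F y in nhds x. f y = g y" and "partial_eq i f x D"
  shows "partial_eq i g x D"
proof -
  have *: "\<forall>\<^sub>F t in nhds (0::real). f (x + t *\<^sub>R axis i 1) = g (x + t *\<^sub>R axis i 1)"
    using filterlim_axis_line assms(1) by (auto dest: eventually_compose_filterlim)
  have "f x = g x" using assms(1) eventually_nhds_x_imp_x by fast
  then have "((\<lambda>t. f (x + t *\<^sub>R axis i 1)) has_vector_derivative D) (at 0) =
      ((\<lambda>t. g (x + t *\<^sub>R axis i 1)) has_vector_derivative D) (at 0)"
    using * by (intro has_vector_derivative_cong_ev) auto
  then show ?thesis using assms(2) unfolding partial_eq_def by simp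
qed

section \<open>Functions of class C^k on open sets\<close>

lemma Ck_on_imp_continuous_on: "Ck_on k U f \<Longrightarrow> continuous_on U f"
  by (cases k) auto

lemma Ck_on_SucD: "Ck_on (Suc k) U f \<Longrightarrow> Ck_on k U f"
proof (induction k arbitrary: f)
  case (Suc k)
  then show ?case by (metis Ck_on.simps(2))
qed simp

lemma Ck_on_subset: "Ck_on k U f \<Longrightarrow> V \<subseteq> U \<Longrightarrow> Ck_on k V f"
proof (induction k arbitrary: f)
  case (Suc k)
  then show ?case using continuous_on_subset[of U f V] by (auto simp: subset_iff)
qed (auto intro: continuous_on_subset)

lemma partial_cong_open:
  assumes "open U" "x \<in> U" "\<And>y. y \<in> U \<Longrightarrow> f y = g y"
  shows "partial i f x = partial i g x"
proof -
  have "\<forall>\<^sub>F y in nhds x. f y = g y" using assms by (auto simp: eventually_nhds)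
  from eventually_nhds_x_imp_x[OF partial_eventually_cong[OF this]] show ?thesis .
qed

lemma partial_eq_cong_open:
  assumes "open U" "x \<in> U" "\<And>y. y \<in> U \<Longrightarrow> f y = g y" "partial_eq i f x D"
  shows "partial_eq i g x D"
  by (rule partial_eq_cong[OF _ assms(4)]) (use assms(1-3) in \<open>auto simp: eventually_nhds\<close>)

lemma Ck_on_cong:
  assumes "open U" "Ck_on k U f" "\<And>x. x \<in> U \<Longrightarrow> f x = g x"
  shows "Ck_on k U g"
  using assms(2,3)
proof (induction k arbitrary: f g)
  case 0
  then have "continuous_on U f" by simp
  from continuous_on_eq[OF this 0(2)] show ?case by simp
next
  case (Suc k)
  have "has_partial i g x" if "x \<in> U" for i x
  proof (rule partial_eq_imp_has_partial, rule partial_eq_cong_open[OF assms(1) that])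
    show "partial_eq i f x (partial i f x)"
      using Suc.prems(1) that by (simp add: has_partial_imp_partial_eq)
  qed (rule Suc.prems(2))
  moreover have "Ck_on k U (partial i g)" for i
  proof (rule Suc.IH)
    show "Ck_on k U (partial i f)" using Suc.prems(1) by simp
    show "partial i f x = partial i g x" if "x \<in> U" for x
      using assms(1) that Suc.prems(2) by (rule partial_cong_open)
  qed
  moreover have "continuous_on U g"
    using Ck_on_imp_continuous_on[OF Suc.prems(1)] Suc.prems(2) by (rule continuous_on_eq)
  ultimately show ?case by simp
qed

text \<open>Lets an explicit formula \<open>f' i\<close> stand in for \<open>partial i f\<close>.
  Openness of U makes the two interchangeable in the higher derivatives.\<close>

lemma Ck_on_SucI:
  assumes "open U" "continuous_on U f"
    and "\<And>i x. x \<in> U \<Longrightarrow> partial_eq i f x (f' i x)" "\<And>i. Ck_on k U (f' i)"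
  shows "Ck_on (Suc k) U f"
proof -
  have "Ck_on k U (partial i f)" for i
    by (rule Ck_on_cong[OF assms(1,4)]) (use partial_eq_imp_partial[OF assms(3)] in simp)
  moreover have "has_partial i f x" if "x \<in> U" for i x
    using assms(3)[OF that] by (rule partial_eq_imp_has_partial)
  ultimately show ?thesis using assms(2) by simp
qed

lemma Ck_on_partial_eq: "Ck_on (Suc k) U f \<Longrightarrow> x \<in> U \<Longrightarrow> partial_eq i f x (partial i f x)"
  by (simp add: has_partial_imp_partial_eq)

lemma Ck_on_const: "open U \<Longrightarrow> Ck_on k U (\<lambda>x. c)"
proof (induction k arbitrary: c)
  case (Suc k)
  show ?case
    by (rule Ck_on_SucI[where f' = "\<lambda>i x. 0"]) (use Suc in \<open>simp_all add: partial_eq_const\<close>)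
qed simp

lemma Ck_on_coord: "open U \<Longrightarrow> Ck_on k U (\<lambda>x. complex_of_real (x $ j))"
proof (cases k)
  case (Suc l)
  assume "open U"
  then show ?thesis
    unfolding Suc
  proof (rule Ck_on_SucI[where f' = "\<lambda>i x. if i = j then 1 else 0"])
    show "continuous_on U (\<lambda>x. complex_of_real (x $ j))" by (intro continuous_intros)
    show "Ck_on l U (\<lambda>x. if i = j then 1 else 0)" for i
      using \<open>open U\<close> by (rule Ck_on_const)
  qed (simp_all only: partial_eq_coord \<open>open U\<close>)
qed (auto intro!: continuous_intros)

lemma Ck_on_add:
  assumes "open U"
  shows "Ck_on k U f \<Longrightarrow> Ck_on k U g \<Longrightarrow> Ck_on k U (\<lambda>x. f x + g x)"
proof (induction k arbitrary: f g)
  case (Suc k)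
  show ?case
  proof (rule Ck_on_SucI[OF assms, where f' = "\<lambda>i x. partial i f x + partial i g x"])
    show "continuous_on U (\<lambda>x. f x + g x)"
      by (intro continuous_intros Suc.prems[THEN Ck_on_imp_continuous_on])
    show "partial_eq i (\<lambda>x. f x + g x) x (partial i f x + partial i g x)" if "x \<in> U" for i x
      using Ck_on_partial_eq[OF Suc.prems(1) that] Ck_on_partial_eq[OF Suc.prems(2) that]
      by (rule partial_eq_add)
    show "Ck_on k U (\<lambda>x. partial i f x + partial i g x)" for i
      using Suc.prems by (intro Suc.IH) auto
  qed
qed (auto intro!: continuous_intros)

lemma Ck_on_mult:
  assumes "open U"
  shows "Ck_on k U f \<Longrightarrow> Ck_on k U g \<Longrightarrow> Ck_on k U (\<lambda>x. f x * g x)"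
proof (induction k arbitrary: f g)
  case (Suc k)
  show ?case
  proof (rule Ck_on_SucI[OF assms, where f' = "\<lambda>i x. partial i f x * g x + f x * partial i g x"])
    show "continuous_on U (\<lambda>x. f x * g x)"
      by (intro continuous_intros Suc.prems[THEN Ck_on_imp_continuous_on])
    show "partial_eq i (\<lambda>x. f x * g x) x (partial i f x * g x + f x * partial i g x)" if "x \<in> U" for i x
      using Ck_on_partial_eq[OF Suc.prems(1) that] Ck_on_partial_eq[OF Suc.prems(2) that]
      by (rule partial_eq_mult)
    show "Ck_on k U (\<lambda>x. partial i f x * g x + f x * partial i g x)" for i
      using Suc.prems Ck_on_SucD[of k U f] Ck_on_SucD[of k U g]
      by (intro Ck_on_add assms Suc.IH) auto
  qed
qed (auto intro!: continuous_intros)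

lemma Ck_on_inverse:
  assumes "open U" "\<And>x. x \<in> U \<Longrightarrow> f x \<noteq> 0"
  shows "Ck_on k U f \<Longrightarrow> Ck_on k U (\<lambda>x. inverse (f x))"
proof (induction k)
  case 0
  then show ?case using assms(2) by (auto intro!: continuous_intros)
next
  case (Suc k)
  show ?case
  proof (rule Ck_on_SucI[OF assms(1), where f' = "\<lambda>i x. - partial i f x * inverse (f x) * inverse (f x)"])
    show "continuous_on U (\<lambda>x. inverse (f x))"
      using assms(2) by (intro continuous_intros Ck_on_imp_continuous_on[OF Suc.prems]) auto
    show "partial_eq i (\<lambda>x. inverse (f x)) x (- partial i f x * inverse (f x) * inverse (f x))" if "x \<in> U" for i x
      using Ck_on_partial_eq[OF Suc.prems that] assms(2)[OF that] by (rule partial_eq_inverse)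
    have "Ck_on k U (\<lambda>x. (- 1) * partial i f x * inverse (f x) * inverse (f x))" for i
      using Suc.prems Ck_on_SucD[of k U f]
      by (intro Ck_on_mult assms Suc.IH Ck_on_const) auto
    then show "Ck_on k U (\<lambda>x. - partial i f x * inverse (f x) * inverse (f x))" for i by simp
  qed
qed

lemma Ck_on_sum:
  assumes "open U" "\<And>j. j \<in> A \<Longrightarrow> Ck_on k U (f j)"
  shows "Ck_on k U (\<lambda>x. \<Sum>j\<in>A. f j x)"
  using assms(2)
  by (induction A rule: infinite_finite_induct) (simp_all add: Ck_on_const Ck_on_add assms(1))

lemma Ck_on_Un:
  assumes "open U" "open V"
  shows "Ck_on k U f \<Longrightarrow> Ck_on k V f \<Longrightarrow> Ck_on k (U \<union> V) f"
proof (induction k arbitrary: f)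
  case 0
  then show ?case using continuous_on_open_Un[OF assms] by simp
next
  case (Suc k)
  have "Ck_on k (U \<union> V) (partial i f)" for i
    using Suc.prems by (intro Suc.IH) simp_all
  moreover have "continuous_on (U \<union> V) f"
    using Suc.prems by (intro continuous_on_open_Un assms Ck_on_imp_continuous_on)
  moreover have "has_partial i f x" if "x \<in> U \<union> V" for i x
    using Suc.prems that by auto
  ultimately show ?case by simp
qed

text \<open>The chain \<open>\<phi> j\<close> of successive derivatives is given as a whole, so that
  the induction on k can move from \<open>\<phi> j\<close> to \<open>\<phi> (Suc j)\<close>.\<close>

lemma Ck_on_of_real_comp:
  assumes "open U" and \<phi>: "\<And>j t. (\<phi> j has_real_derivative \<phi> (Suc j) t) (at t)"
    and h: "\<And>k. Ck_on k U (\<lambda>x. complex_of_real (h x))"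
    and h': "\<And>i x. x \<in> U \<Longrightarrow> partial_eq i (\<lambda>x. complex_of_real (h x)) x (complex_of_real (h' i x))"
  shows "Ck_on k U (\<lambda>x. complex_of_real (\<phi> j (h x)))"
proof -
  have cont: "continuous_on U (\<lambda>x. complex_of_real (\<phi> j (h x)))" for j
  proof -
    have "continuous_on UNIV (\<phi> j)"
      using DERIV_isCont[OF \<phi>] by (intro continuous_at_imp_continuous_on) blast
    moreover have "continuous_on U h"
      using continuous_on_Re[OF Ck_on_imp_continuous_on[OF h[of 0]]] by simp
    ultimately have "continuous_on U (\<lambda>x. \<phi> j (h x))"
      by (rule continuous_on_compose2) simp
    then show ?thesis by (rule continuous_on_of_real)
  qed
  have h'': "Ck_on k U (\<lambda>x. complex_of_real (h' i x))" for i k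
  proof -
    have "Ck_on k U (partial i (\<lambda>x. complex_of_real (h x)))"
      using h[of "Suc k"] by simp
    then show ?thesis
      by (rule Ck_on_cong[OF assms(1)]) (rule partial_eq_imp_partial[OF h'])
  qed
  show ?thesis
  proof (induction k arbitrary: j)
    case 0
    show ?case using cont by simp
  next
    case (Suc k)
    show ?case
    proof (rule Ck_on_SucI[OF assms(1) cont, where f' = "\<lambda>i x. complex_of_real (\<phi> (Suc j) (h x) * h' i x)"])
      show "partial_eq i (\<lambda>x. complex_of_real (\<phi> j (h x))) x
          (complex_of_real (\<phi> (Suc j) (h x) * h' i x))" if "x \<in> U" for i x
        using h'[OF that] \<phi> by (rule partial_eq_of_real_comp)
      show "Ck_on k U (\<lambda>x. complex_of_real (\<phi> (Suc j) (h x) * h' i x))" for i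
        unfolding of_real_mult by (rule Ck_on_mult[OF assms(1) Suc.IH h''])
    qed
  qed
qed

section \<open>Smooth functions and multi-index derivatives\<close>

definition smooth_on :: "(real ^ 'n::finite) set \<Rightarrow> (real ^ 'n \<Rightarrow> complex) \<Rightarrow> bool" where
  "smooth_on U f \<longleftrightarrow> (\<forall>k. Ck_on k U f)"

lemma smooth_at_iff: "smooth_at p f \<longleftrightarrow> (\<exists>U. open U \<and> p \<in> U \<and> smooth_on U f)"
  by (simp add: smooth_at_def smooth_on_def)

lemma smooth_on_imp_continuous_on: "smooth_on U f \<Longrightarrow> continuous_on U f"
  unfolding smooth_on_def by (rule Ck_on_imp_continuous_on[of 0]) simp

lemma smooth_on_subset: "smooth_on U f \<Longrightarrow> V \<subseteq> U \<Longrightarrow> smooth_on V f"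
  unfolding smooth_on_def using Ck_on_subset[of _ U f V] by simp

lemma smooth_on_cong:
  "open U \<Longrightarrow> smooth_on U f \<Longrightarrow> (\<And>x. x \<in> U \<Longrightarrow> f x = g x) \<Longrightarrow> smooth_on U g"
  unfolding smooth_on_def by (intro allI Ck_on_cong[of U _ f g]) simp_all

lemma smooth_on_partial: "smooth_on U f \<Longrightarrow> smooth_on U (partial i f)"
  unfolding smooth_on_def
proof
  fix k assume "\<forall>k. Ck_on k U f"
  then have "Ck_on (Suc k) U f" by blast
  then show "Ck_on k U (partial i f)" by simp
qed

lemma smooth_on_partial_eq: "smooth_on U f \<Longrightarrow> x \<in> U \<Longrightarrow> partial_eq i f x (partial i f x)"
  unfolding smooth_on_def by (rule Ck_on_partial_eq) simp_all

lemma smooth_on_const: "open U \<Longrightarrow> smooth_on U (\<lambda>x. c)"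
  by (simp add: smooth_on_def Ck_on_const)

lemma smooth_on_coord: "open U \<Longrightarrow> smooth_on U (\<lambda>x. complex_of_real (x $ j))"
  by (simp add: smooth_on_def Ck_on_coord)

lemma smooth_on_add: "open U \<Longrightarrow> smooth_on U f \<Longrightarrow> smooth_on U g \<Longrightarrow> smooth_on U (\<lambda>x. f x + g x)"
  by (simp add: smooth_on_def Ck_on_add)

lemma smooth_on_mult: "open U \<Longrightarrow> smooth_on U f \<Longrightarrow> smooth_on U g \<Longrightarrow> smooth_on U (\<lambda>x. f x * g x)"
  by (simp add: smooth_on_def Ck_on_mult)

lemma smooth_on_diff:
  assumes "open U" "smooth_on U f" "smooth_on U g"
  shows "smooth_on U (\<lambda>x. f x - g x)"
  using smooth_on_add[OF assms(1,2) smooth_on_mult[OF assms(1) smooth_on_const[OF assms(1), of "-1"] assms(3)]]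
  by simp

lemma smooth_on_sum:
  "open U \<Longrightarrow> (\<And>j. j \<in> A \<Longrightarrow> smooth_on U (f j)) \<Longrightarrow> smooth_on U (\<lambda>x. \<Sum>j\<in>A. f j x)"
  by (simp add: smooth_on_def Ck_on_sum)

lemma smooth_on_prod:
  assumes "open U" "\<And>j. j \<in> A \<Longrightarrow> smooth_on U (f j)"
  shows "smooth_on U (\<lambda>x. \<Prod>j\<in>A. f j x)"
  using assms(2)
  by (induction A rule: infinite_finite_induct) (simp_all add: smooth_on_const smooth_on_mult assms(1))

lemma smooth_on_power: "open U \<Longrightarrow> smooth_on U f \<Longrightarrow> smooth_on U (\<lambda>x. f x ^ k)"
  by (induction k) (simp_all add: smooth_on_const smooth_on_mult)

lemma smooth_on_Un: "open U \<Longrightarrow> open V \<Longrightarrow> smooth_on U f \<Longrightarrow> smooth_on V f \<Longrightarrow> smooth_on (U \<union> V) f"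
  by (simp add: smooth_on_def Ck_on_Un)

text \<open>A family of continuous functions that is closed under partial derivatives consists of
  smooth functions. It serves power series, dilations and function series, whose derivatives have
  the same shape as the function itself.\<close>

lemma smooth_on_coinduct:
  assumes "open U" "f \<in> F"
    and "\<And>f. f \<in> F \<Longrightarrow> continuous_on U f"
    and "\<And>f i. f \<in> F \<Longrightarrow> \<exists>f'\<in>F. \<forall>x\<in>U. partial_eq i f x (f' x)"
  shows "smooth_on U f"
proof -
  have "Ck_on k U f" for k
    using assms(2)
  proof (induction k arbitrary: f)
    case (Suc k)
    have "\<forall>i. \<exists>f'\<in>F. \<forall>x\<in>U. partial_eq i f x (f' x)"
      using assms(4)[OF Suc.prems] by blast
    then obtain f' where f': "\<forall>i. f' i \<in> F \<and> (\<forall>x\<in>U. partial_eq i f x (f' i x))"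
      by metis
    show ?case
    proof (rule Ck_on_SucI[where f' = f', OF assms(1) assms(3)[OF Suc.prems]])
      show "partial_eq i f x (f' i x)" if "x \<in> U" for i x using f' that by blast
      show "Ck_on k U (f' i)" for i using f' by (intro Suc.IH) blast
    qed
  next
    case 0
    show ?case using assms(3)[OF 0] by simp
  qed
  then show ?thesis by (simp add: smooth_on_def)
qed

text \<open>The relational form also covers statements about two or three functions, such as \<open>f = g + h\<close>.\<close>

lemma mi_deriv_rel:
  assumes "R f g h" "\<And>f g h i. R f g h \<Longrightarrow> R (partial i f) (partial i g) (partial i h)"
  shows "R (mi_deriv \<alpha> f) (mi_deriv \<alpha> g) (mi_deriv \<alpha> h)"
proof -
  have pow: "R ((partial i ^^ k) f) ((partial i ^^ k) g) ((partial i ^^ k) h)" if "R f g h" for f g h i k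
    using that by (induction k) (simp_all add: assms(2))
  have "R (foldr (\<lambda>i. partial i ^^ (\<alpha> $ i)) is f) (foldr (\<lambda>i. partial i ^^ (\<alpha> $ i)) is g)
      (foldr (\<lambda>i. partial i ^^ (\<alpha> $ i)) is h)" for "is"
    using assms(1) by (induction "is") (simp_all add: pow)
  then show ?thesis by (simp add: mi_deriv_def)
qed

lemma smooth_on_mi_deriv: "smooth_on U f \<Longrightarrow> smooth_on U (mi_deriv \<alpha> f)"
  by (rule mi_deriv_rel[where R = "\<lambda>f g h. smooth_on U f"]) (simp_all add: smooth_on_partial)

lemma mi_deriv_cong_open:
  assumes "open U" "x \<in> U" "\<And>y. y \<in> U \<Longrightarrow> f y = g y"
  shows "mi_deriv \<alpha> f x = mi_deriv \<alpha> g x"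
proof -
  let ?R = "\<lambda>f g h :: real ^ 'a \<Rightarrow> complex. \<forall>x\<in>U. f x = g x"
  have "?R (mi_deriv \<alpha> f) (mi_deriv \<alpha> g) (mi_deriv \<alpha> g)"
  proof (rule mi_deriv_rel[where R = ?R])
    show "\<forall>x\<in>U. f x = g x" using assms(3) by blast
    show "\<forall>x\<in>U. partial i f x = partial i g x" if "\<forall>x\<in>U. f x = g x" for f g i
      using that by (intro ballI partial_cong_open[OF assms(1)]) blast+
  qed
  then show ?thesis using assms(2) by blast
qed

lemma partial_add:
  "smooth_on U f \<Longrightarrow> smooth_on U g \<Longrightarrow> x \<in> U \<Longrightarrow>
    partial i (\<lambda>x. f x + g x) x = partial i f x + partial i g x"
  by (intro partial_eq_imp_partial partial_eq_add smooth_on_partial_eq)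

lemma partial_mult:
  "smooth_on U f \<Longrightarrow> smooth_on U g \<Longrightarrow> x \<in> U \<Longrightarrow>
    partial i (\<lambda>x. f x * g x) x = partial i f x * g x + f x * partial i g x"
  by (intro partial_eq_imp_partial partial_eq_mult smooth_on_partial_eq)

lemma partial_cmult:
  assumes "smooth_on U f" "x \<in> U"
  shows "partial i (\<lambda>x. c * f x) x = c * partial i f x"
  using partial_eq_mult[OF partial_eq_const smooth_on_partial_eq[OF assms], of i c]
  by (simp add: partial_eq_imp_partial)

lemma mi_deriv_add:
  assumes "open U" "smooth_on U f" "smooth_on U g" "x \<in> U"
  shows "mi_deriv \<alpha> (\<lambda>x. f x + g x) x = mi_deriv \<alpha> f x + mi_deriv \<alpha> g x"
proof -
  let ?R = "\<lambda>f g h. smooth_on U f \<and> smooth_on U g \<and> (\<forall>x\<in>U. h x = f x + g x)"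
  have "?R (mi_deriv \<alpha> f) (mi_deriv \<alpha> g) (mi_deriv \<alpha> (\<lambda>x. f x + g x))"
  proof (rule mi_deriv_rel[where R = ?R])
    fix f g h i assume *: "?R f g h"
    have "partial i h x = partial i f x + partial i g x" if "x \<in> U" for x
    proof -
      have "partial i h x = partial i (\<lambda>x. f x + g x) x"
        using * by (intro partial_cong_open[OF assms(1) that]) simp
      also have "\<dots> = partial i f x + partial i g x"
        using * that by (intro partial_add) simp_all
      finally show ?thesis .
    qed
    with * show "?R (partial i f) (partial i g) (partial i h)"
      by (simp add: smooth_on_partial)
  qed (use assms in simp)
  then show ?thesis using assms(4) by blast
qed

lemma mi_deriv_cmult:
  assumes "open U" "smooth_on U f" "x \<in> U"
  shows "mi_deriv \<alpha> (\<lambda>x. c * f x) x = c * mi_deriv \<alpha> f x"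
proof -
  let ?R = "\<lambda>f g h. smooth_on U f \<and> (\<forall>x\<in>U. h x = c * f x)"
  have "?R (mi_deriv \<alpha> f) (mi_deriv \<alpha> f) (mi_deriv \<alpha> (\<lambda>x. c * f x))"
  proof (rule mi_deriv_rel[where R = ?R])
    fix f g h :: "real ^ 'a \<Rightarrow> complex" and i assume *: "?R f g h"
    have "partial i h x = c * partial i f x" if "x \<in> U" for x
    proof -
      have "partial i h x = partial i (\<lambda>x. c * f x) x"
        using * by (intro partial_cong_open[OF assms(1) that]) simp
      also have "\<dots> = c * partial i f x"
        using * that by (intro partial_cmult) simp_all
      finally show ?thesis .
    qed
    with * show "?R (partial i f) (partial i g) (partial i h)"
      by (simp add: smooth_on_partial)
  qed (use assms in simp)
  then show ?thesis using assms(3) by blast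
qed

lemma mi_deriv_diff:
  assumes "open U" "smooth_on U f" "smooth_on U g" "x \<in> U"
  shows "mi_deriv \<alpha> (\<lambda>x. f x - g x) x = mi_deriv \<alpha> f x - mi_deriv \<alpha> g x"
  using mi_deriv_add[OF assms(1,2) smooth_on_mult[OF assms(1) smooth_on_const[OF assms(1), of "-1"] assms(3)] assms(4), of \<alpha>]
    mi_deriv_cmult[OF assms(1,3,4), of \<alpha> "-1"]
  by simp

lemma mi_deriv_sum:
  assumes "open U" "\<And>j. j \<in> A \<Longrightarrow> smooth_on U (f j)" "x \<in> U" "finite A"
  shows "mi_deriv \<alpha> (\<lambda>x. \<Sum>j\<in>A. f j x) x = (\<Sum>j\<in>A. mi_deriv \<alpha> (f j) x)"
  using assms(4,2)
proof (induction A rule: finite_induct)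
  case empty
  have "smooth_on U (\<lambda>x. 0 :: complex)" using assms(1) by (rule smooth_on_const)
  from mi_deriv_cmult[OF assms(1) this assms(3), of \<alpha> 0] show ?case by simp
next
  case (insert j A)
  have "mi_deriv \<alpha> (\<lambda>x. f j x + (\<Sum>j\<in>A. f j x)) x = mi_deriv \<alpha> (f j) x + mi_deriv \<alpha> (\<lambda>x. \<Sum>j\<in>A. f j x) x"
    using insert.prems by (intro mi_deriv_add[OF assms(1)] smooth_on_sum assms(1,3)) simp_all
  then show ?case using insert by simp
qed

lemma mi_deriv_axis: "mi_deriv (axis i k) f = (partial i ^^ k) f"
proof -
  have "foldr (\<lambda>j. partial j ^^ (axis i k $ j)) is f = (if i \<in> set is then (partial i ^^ k) f else f)"
    if "distinct is" for "is"
    using that by (induction "is") (auto simp: axis_def)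
  from this[OF distinct_axes] show ?thesis by (simp add: mi_deriv_def set_axes)
qed

section \<open>Vanishing to finite order at a point\<close>

primrec vanishes_to :: "nat \<Rightarrow> real ^ 'n::finite \<Rightarrow> (real ^ 'n \<Rightarrow> complex) \<Rightarrow> bool" where
  "vanishes_to 0 p f \<longleftrightarrow> True"
| "vanishes_to (Suc k) p f \<longleftrightarrow> f p = 0 \<and> (\<forall>i. vanishes_to k p (partial i f))"

lemma vanishes_to_SucD: "vanishes_to (Suc k) p f \<Longrightarrow> vanishes_to k p f"
proof (induction k arbitrary: f)
  case (Suc k)
  then show ?case by (metis vanishes_to.simps(2))
qed simp

lemma vanishes_to_le: "vanishes_to k p f \<Longrightarrow> j \<le> k \<Longrightarrow> vanishes_to j p f"
proof (induction k)
  case (Suc k)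
  show ?case
  proof (cases "j = Suc k")
    case False
    then show ?thesis using Suc.IH[OF vanishes_to_SucD[OF Suc.prems(1)]] Suc.prems(2) by simp
  qed (use Suc.prems in simp)
qed simp

lemma vanishes_to_cong:
  assumes "open U" "p \<in> U"
  shows "vanishes_to k p f \<Longrightarrow> (\<And>y. y \<in> U \<Longrightarrow> f y = g y) \<Longrightarrow> vanishes_to k p g"
proof (induction k arbitrary: f g)
  case (Suc k)
  have "vanishes_to k p (partial i g)" for i
  proof (rule Suc.IH)
    show "vanishes_to k p (partial i f)" using Suc.prems(1) by simp
    show "partial i f y = partial i g y" if "y \<in> U" for y
      using assms(1) that Suc.prems(2) by (rule partial_cong_open)
  qed
  moreover have "g p = 0" using Suc.prems(1) Suc.prems(2)[OF assms(2)] by simp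
  ultimately show ?case by simp
qed simp

lemma vanishes_to_add:
  assumes "open U" "p \<in> U"
  shows "smooth_on U f \<Longrightarrow> smooth_on U g \<Longrightarrow> vanishes_to k p f \<Longrightarrow> vanishes_to k p g \<Longrightarrow>
    vanishes_to k p (\<lambda>x. f x + g x)"
proof (induction k arbitrary: f g)
  case (Suc k)
  have "vanishes_to k p (partial i (\<lambda>x. f x + g x))" for i
  proof (rule vanishes_to_cong[OF assms])
    show "vanishes_to k p (\<lambda>x. partial i f x + partial i g x)"
      using Suc.prems by (intro Suc.IH smooth_on_partial) simp_all
    show "partial i f y + partial i g y = partial i (\<lambda>x. f x + g x) y" if "y \<in> U" for y
      using partial_add[OF Suc.prems(1,2) that] by simp
  qed
  then show ?case using Suc.prems by simp
qed simp

text \<open>In the product rule the term with \<open>partial i f\<close> still contains g, and the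
  other contains \<open>partial i g\<close>, so the order of vanishing of one factor is
  enough.\<close>

lemma vanishes_to_mult:
  assumes "open U" "p \<in> U"
  shows "smooth_on U f \<Longrightarrow> smooth_on U g \<Longrightarrow> vanishes_to k p g \<Longrightarrow>
    vanishes_to k p (\<lambda>x. f x * g x)"
proof (induction k arbitrary: f g)
  case (Suc k)
  have "vanishes_to k p (partial i (\<lambda>x. f x * g x))" for i
  proof (rule vanishes_to_cong[OF assms])
    show "vanishes_to k p (\<lambda>x. partial i f x * g x + f x * partial i g x)"
      using Suc.prems vanishes_to_SucD[OF Suc.prems(3)]
      by (intro vanishes_to_add[OF assms] Suc.IH smooth_on_mult smooth_on_partial assms(1)) simp_all
    show "partial i f y * g y + f y * partial i g y = partial i (\<lambda>x. f x * g x) y" if "y \<in> U" for y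
      using partial_mult[OF Suc.prems(1,2) that] by simp
  qed
  then show ?case using Suc.prems by simp
qed simp

lemma vanishes_to_zero: "vanishes_to k p (\<lambda>x. 0)"
proof (induction k)
  case (Suc k)
  have "partial i (\<lambda>x. 0 :: complex) = (\<lambda>x :: real ^ 'a. 0)" for i
    using partial_eq_imp_partial[OF partial_eq_const] by blast
  then show ?case using Suc by simp
qed simp

lemma vanishes_to_sum:
  assumes "open U" "p \<in> U" "\<And>j. j \<in> A \<Longrightarrow> smooth_on U (f j)" "\<And>j. j \<in> A \<Longrightarrow> vanishes_to k p (f j)"
  shows "vanishes_to k p (\<lambda>x. \<Sum>j\<in>A. f j x)"
  using assms(3,4)
proof (induction A rule: infinite_finite_induct)
  case (insert j A)
  have "vanishes_to k p (\<lambda>x. f j x + (\<Sum>j\<in>A. f j x))"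
    using insert by (intro vanishes_to_add[OF assms(1,2)] smooth_on_sum assms(1)) simp_all
  then show ?case using insert by simp
qed (simp_all add: vanishes_to_zero)

lemma mi_abs_axes: "mi_abs \<alpha> = sum_list (map (\<lambda>i. \<alpha> $ i) axes)"
  by (simp add: mi_abs_def sum_list_distinct_conv_sum_set distinct_axes set_axes)

lemma vanishes_to_mi_deriv: "vanishes_to (k + mi_abs \<alpha>) p f \<Longrightarrow> vanishes_to k p (mi_deriv \<alpha> f)"
proof -
  have pow: "vanishes_to k p ((partial i ^^ l) f)" if "vanishes_to (k + l) p f" for k l i and f :: "real ^ 'a \<Rightarrow> complex"
    using that by (induction l arbitrary: k f) (simp_all add: funpow_swap1 del: funpow.simps(2) add: funpow_Suc_right)
  have "vanishes_to k p (foldr (\<lambda>i. partial i ^^ (\<alpha> $ i)) is f)"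
    if "vanishes_to (k + sum_list (map (\<lambda>i. \<alpha> $ i) is)) p f" for k f "is"
    using that by (induction "is" arbitrary: k) (simp_all add: pow add.assoc[symmetric])
  then show "vanishes_to (k + mi_abs \<alpha>) p f \<Longrightarrow> vanishes_to k p (mi_deriv \<alpha> f)"
    by (simp add: mi_abs_axes mi_deriv_def)
qed

text \<open>\<open>vanishes_to k\<close> covers iterated partial derivatives of order below k in
  every succession of the axes, so it includes the fixed succession used by \<open>mi_deriv\<close>.
  The recursive form is the one that sums, products and series respect.\<close>

lemma flat_atI:
  assumes "\<And>k. vanishes_to k p f"
  shows "flat_at p f"
  unfolding flat_at_def
proof
  fix \<alpha>
  have "vanishes_to (Suc 0) p (mi_deriv \<alpha> f)" by (rule vanishes_to_mi_deriv) (rule assms)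
  then show "mi_deriv \<alpha> f p = 0" by simp
qed

section \<open>Cutoff functions\<close>

text \<open>The classical function exp (-1/t), extended by 0. The polynomial factor in 1/t makes the
  family closed under differentiation.\<close>

definition exp_recip :: "real poly \<Rightarrow> real \<Rightarrow> real" where
  "exp_recip q t = (if t > 0 then poly q (1 / t) * exp (- (1 / t)) else 0)"

lemma poly_mult_exp_minus_tendsto_0: "((\<lambda>s. poly q s * exp (- s)) \<longlongrightarrow> (0::real)) at_top"
proof -
  have "((\<lambda>s. \<Sum>i\<le>degree q. coeff q i * (s ^ i / exp s)) \<longlongrightarrow> (\<Sum>i\<le>degree q. coeff q i * 0)) at_top"
    by (intro tendsto_intros tendsto_power_div_exp_0)
  then show ?thesis by (simp add: poly_altdef sum_distrib_right exp_minus divide_inverse mult.assoc)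
qed

text \<open>For t > 0 this is the product rule; the factor 1/t^2 is the polynomial
  \<open>[:0, 0, 1:]\<close> in 1/t. At t = 0 the difference quotient is again a polynomial in 1/t
  times the exponential and tends to 0.\<close>

lemma exp_recip_deriv:
  "(exp_recip q has_real_derivative exp_recip ([:0, 0, 1:] * (q - pderiv q)) t) (at t)"
proof -
  consider "t > 0" | "t < 0" | "t = 0" by linarith
  then show ?thesis
  proof cases
    case 1
    have "((\<lambda>t. poly q (1 / t) * exp (- (1 / t))) has_real_derivative
        exp_recip ([:0, 0, 1:] * (q - pderiv q)) t) (at t)"
      using 1 by (auto intro!: derivative_eq_intros poly_DERIV[THEN DERIV_chain2]
          simp: exp_recip_def field_simps power2_eq_square)
    then show ?thesis
      by (rule has_field_derivative_transform_within_open[where S = "{0<..}"])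
        (use 1 in \<open>auto simp: exp_recip_def\<close>)
  next
    case 2
    have "((\<lambda>t. 0) has_real_derivative exp_recip ([:0, 0, 1:] * (q - pderiv q)) t) (at t)"
      using 2 by (simp add: exp_recip_def)
    then show ?thesis
      by (rule has_field_derivative_transform_within_open[where S = "{..<0}"])
        (use 2 in \<open>auto simp: exp_recip_def\<close>)
  next
    case 3
    have "((\<lambda>h. exp_recip q h / h) \<longlongrightarrow> 0) (at_right 0)"
    proof -
      have "((\<lambda>h. poly (q * [:0, 1:]) (inverse h) * exp (- inverse h)) \<longlongrightarrow> 0) (at_right 0)"
        by (rule filterlim_compose[OF poly_mult_exp_minus_tendsto_0 filterlim_inverse_at_top_right])
      moreover have "\<forall>\<^sub>F h in at_right (0::real). h > 0" by (simp add: eventually_at_right_less)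
      then have "\<forall>\<^sub>F h in at_right 0. poly (q * [:0, 1:]) (inverse h) * exp (- inverse h) = exp_recip q h / h"
        by eventually_elim (simp add: exp_recip_def field_simps)
      ultimately show ?thesis by (rule Lim_transform_eventually)
    qed
    moreover have "((\<lambda>h. exp_recip q h / h) \<longlongrightarrow> 0) (at_left 0)"
    proof -
      have "\<forall>\<^sub>F h in at_left (0::real). h < 0" by (simp add: eventually_at_filter)
      then have "\<forall>\<^sub>F h in at_left 0. 0 = exp_recip q h / h"
        by eventually_elim (simp add: exp_recip_def)
      then show ?thesis by (rule Lim_transform_eventually[OF tendsto_const])
    qed
    ultimately have "((\<lambda>h. exp_recip q h / h) \<longlongrightarrow> 0) (at 0)"
      by (simp add: filterlim_split_at)
    then show ?thesis using 3 by (simp add: DERIV_def exp_recip_def)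
  qed
qed

lemma partial_eq_norm_square:
  "partial_eq i (\<lambda>x. complex_of_real (a + b * (norm (x - p))\<^sup>2)) x (complex_of_real (2 * b * (x $ i - p $ i)))"
proof -
  have "(norm (x + t *\<^sub>R axis i 1 - p))\<^sup>2 = (norm (x - p))\<^sup>2 + 2 * t * (x $ i - p $ i) + t\<^sup>2" for t
  proof -
    have "x + t *\<^sub>R axis i 1 - p = (x - p) + t *\<^sub>R axis i 1" by simp
    then show ?thesis
      by (simp only: power2_norm_eq_inner inner_add_left inner_add_right)
        (simp add: inner_axis inner_axis' inner_commute power2_eq_square algebra_simps)
  qed
  then have "(\<lambda>t. a + b * (norm (x + t *\<^sub>R axis i 1 - p))\<^sup>2) =
      (\<lambda>t. a + b * ((norm (x - p))\<^sup>2 + 2 * t * (x $ i - p $ i) + t\<^sup>2))" by presburger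
  moreover have "((\<lambda>t. a + b * ((norm (x - p))\<^sup>2 + 2 * t * (x $ i - p $ i) + t\<^sup>2))
      has_real_derivative 2 * b * (x $ i - p $ i)) (at 0)"
    by (auto intro!: derivative_eq_intros)
  ultimately show ?thesis
    unfolding partial_eq_def
    by (intro has_vector_derivative_of_real) (simp add: has_real_derivative_iff_has_vector_derivative)
qed

lemma smooth_on_norm_square: "smooth_on UNIV (\<lambda>x. complex_of_real (a + b * (norm (x - p))\<^sup>2))"
proof -
  have "complex_of_real (a + b * (norm (x - p))\<^sup>2) =
      complex_of_real a + complex_of_real b * (\<Sum>i\<in>UNIV. (complex_of_real (x $ i) - complex_of_real (p $ i)) ^ 2)" for x
    by (simp add: norm_vec_def L2_set_def sum_nonneg power2_eq_square)
  moreover have "smooth_on UNIV (\<lambda>x. complex_of_real a + complex_of_real b * (\<Sum>i\<in>UNIV. (complex_of_real (x $ i) - complex_of_real (p $ i)) ^ 2))"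
    by (intro smooth_on_add smooth_on_mult smooth_on_sum smooth_on_power smooth_on_diff smooth_on_coord
        smooth_on_const open_UNIV)
  ultimately show ?thesis by presburger
qed

lemma smooth_on_exp_recip_norm: "smooth_on UNIV (\<lambda>x. complex_of_real (exp_recip 1 (a + b * (norm (x - p))\<^sup>2)))"
proof -
  \<comment> \<open>\<open>Q j\<close> is the polynomial that belongs to the j-th derivative of
    \<open>exp_recip 1\<close>.\<close>
  define Q where "Q = (\<lambda>j. ((\<lambda>q. [:0, 0, 1:] * (q - pderiv q)) ^^ j) (1 :: real poly))"
  have "Ck_on k UNIV (\<lambda>x. complex_of_real (exp_recip (Q 0) (a + b * (norm (x - p))\<^sup>2)))" for k
  proof (rule Ck_on_of_real_comp[where \<phi> = "\<lambda>j. exp_recip (Q j)" and j = 0, OF open_UNIV])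
    show "(exp_recip (Q j) has_real_derivative exp_recip (Q (Suc j)) t) (at t)" for j t
      unfolding Q_def funpow.simps o_apply by (rule exp_recip_deriv)
    show "Ck_on k UNIV (\<lambda>x. complex_of_real (a + b * (norm (x - p))\<^sup>2))" for k
      using smooth_on_norm_square[of a b p] unfolding smooth_on_def by (rule spec)
  qed (rule partial_eq_norm_square)
  then show ?thesis by (simp add: smooth_on_def Q_def)
qed

lemma exists_cutoff:
  fixes p :: "real ^ 'n::finite"
  assumes "r > 0"
  obtains h where "smooth_on UNIV h" "\<And>x. norm (x - p) \<le> r / 2 \<Longrightarrow> h x = 1"
    "\<And>x. norm (x - p) \<ge> r \<Longrightarrow> h x = 0"
proof
  \<comment> \<open>f is positive exactly for |x - p| < r, and g exactly for |x - p| > r/2. The two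
    regions cover the space, so f + g > 0, and the quotient f / (f + g) is 1 where g vanishes and 0
    where f vanishes.\<close>
  define f where "f = (\<lambda>x. exp_recip 1 (1 + (- 1 / r\<^sup>2) * (norm (x - p))\<^sup>2))"
  define g where "g = (\<lambda>x. exp_recip 1 (- 1 / 4 + (1 / r\<^sup>2) * (norm (x - p))\<^sup>2))"
  define h where "h x = complex_of_real (f x) * inverse (complex_of_real (f x) + complex_of_real (g x))" for x
  have nonneg: "exp_recip 1 t \<ge> 0" and pos: "t > 0 \<Longrightarrow> exp_recip 1 t > 0" and zero: "t \<le> 0 \<Longrightarrow> exp_recip 1 t = 0" for t
    by (simp_all add: exp_recip_def)
  have sum: "f x + g x > 0" for x
  proof (cases "1 + (- 1 / r\<^sup>2) * (norm (x - p))\<^sup>2 > 0")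
    case True
    then show ?thesis using pos[OF True] nonneg unfolding f_def g_def by (meson add_pos_nonneg)
  next
    case False
    then have "(1 / r\<^sup>2) * (norm (x - p))\<^sup>2 \<ge> 1" by simp
    then have "- 1 / 4 + (1 / r\<^sup>2) * (norm (x - p))\<^sup>2 > 0" by linarith
    then show ?thesis using pos nonneg unfolding f_def g_def by (meson add_nonneg_pos)
  qed
  have nz: "complex_of_real (f x) + complex_of_real (g x) \<noteq> 0" for x
    using sum[of x] by (metis of_real_add of_real_eq_0_iff less_irrefl)
  have "smooth_on UNIV (\<lambda>x. inverse (complex_of_real (f x) + complex_of_real (g x)))"
    unfolding smooth_on_def
  proof
    fix k show "Ck_on k UNIV (\<lambda>x. inverse (complex_of_real (f x) + complex_of_real (g x)))"
    proof (rule Ck_on_inverse[OF open_UNIV nz])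
      have "smooth_on UNIV (\<lambda>x. complex_of_real (f x) + complex_of_real (g x))"
        unfolding f_def g_def by (intro smooth_on_add smooth_on_exp_recip_norm open_UNIV)
      then show "Ck_on k UNIV (\<lambda>x. complex_of_real (f x) + complex_of_real (g x))"
        by (simp add: smooth_on_def)
    qed
  qed
  then show "smooth_on UNIV h"
    unfolding h_def f_def by (intro smooth_on_mult open_UNIV smooth_on_exp_recip_norm)
  show "h x = 1" if "norm (x - p) \<le> r / 2" for x
  proof -
    have "(norm (x - p))\<^sup>2 \<le> (r / 2)\<^sup>2" using that by (intro power_mono) simp_all
    then have "g x = 0" using assms unfolding g_def by (intro zero) (simp add: field_simps)
    then show ?thesis using nz[of x] by (simp add: h_def)
  qed
  show "h x = 0" if "norm (x - p) \<ge> r" for x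
  proof -
    have "(norm (x - p))\<^sup>2 \<ge> r\<^sup>2" using that assms by (intro power_mono) simp_all
    then have "f x = 0" using assms unfolding f_def by (intro zero) (simp add: field_simps)
    then show ?thesis by (simp add: h_def)
  qed
qed

text \<open>U and the complement of K are open and cover the space, and f is smooth on each of
  them.\<close>

lemma smooth_on_extend_by_zero:
  assumes "open U" "smooth_on U f" "closed K" "K \<subseteq> U" "\<And>x. x \<notin> K \<Longrightarrow> f x = 0"
  shows "smooth_on UNIV f"
proof -
  have "open (- K)" using assms(3) by (rule open_Compl)
  then have "smooth_on (- K) f"
    using assms(5) by (intro smooth_on_cong[OF _ smooth_on_const[of "- K" 0]]) simp_all
  then have "smooth_on (U \<union> - K) f" by (rule smooth_on_Un[OF assms(1) \<open>open (- K)\<close> assms(2)])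
  moreover have "U \<union> - K = UNIV" using assms(4) by blast
  ultimately show ?thesis by simp
qed

section \<open>Termwise differentiation of function series\<close>

lemma continuous_on_suminf:
  fixes f :: "nat \<Rightarrow> 'a::metric_space \<Rightarrow> 'b::banach"
  assumes "\<And>n. continuous_on U (f n)" "\<And>n x. x \<in> U \<Longrightarrow> norm (f n x) \<le> M n" "summable M"
  shows "continuous_on U (\<lambda>x. \<Sum>n. f n x)"
proof (rule uniform_limit_theorem)
  show "uniform_limit U (\<lambda>n x. \<Sum>i<n. f i x) (\<lambda>x. \<Sum>n. f n x) sequentially"
    using assms(2,3) by (rule Weierstrass_m_test)
  show "\<forall>\<^sub>F n in sequentially. continuous_on U (\<lambda>x. \<Sum>i<n. f i x)"
    by (intro always_eventually allI continuous_on_sum assms(1))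
qed simp

text \<open>Only a short segment of the axis line through x is involved. On it the one-dimensional
  theorem on differentiating series applies, with uniform convergence of the derivatives from the
  Weierstrass test.\<close>

lemma partial_eq_suminf:
  assumes "open U" "x \<in> U"
    and f': "\<And>n y. y \<in> U \<Longrightarrow> partial_eq i (f n) y (f' n y)"
    and M: "\<And>n y. y \<in> U \<Longrightarrow> norm (f n y) \<le> M n" "summable M"
    and M': "\<And>n y. y \<in> U \<Longrightarrow> norm (f' n y) \<le> M' n" "summable M'"
  shows "partial_eq i (\<lambda>y. \<Sum>n. f n y) x (\<Sum>n. f' n x)"
proof -
  have "\<forall>\<^sub>F t in nhds (0::real). x + t *\<^sub>R axis i 1 \<in> U"
    using filterlim_axis_line[of x i] assms(1,2) by (rule topological_tendstoD)
  then obtain d where d: "d > 0" "\<And>t. dist t 0 < d \<Longrightarrow> x + t *\<^sub>R axis i 1 \<in> U"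
    unfolding eventually_nhds_metric by blast
  let ?S = "ball (0::real) d"
  let ?l = "\<lambda>t. x + t *\<^sub>R axis i 1"
  have S: "?l t \<in> U" if "t \<in> ?S" for t using d(2)[of t] that by (simp add: dist_commute)
  have ul: "uniform_limit ?S (\<lambda>n t. \<Sum>k<n. f' k (?l t)) (\<lambda>t. \<Sum>n. f' n (?l t)) sequentially"
    using S M' by (intro Weierstrass_m_test[of _ _ M']) auto
  have "\<exists>g. \<forall>t\<in>?S. (\<lambda>n. f n (?l t)) sums (g t) \<and>
      (g has_derivative (\<lambda>h. h *\<^sub>R (\<Sum>n. f' n (?l t)))) (at t within ?S)"
  proof (rule has_derivative_series)
    show "((\<lambda>t. f n (?l t)) has_derivative (\<lambda>h. h *\<^sub>R f' n (?l t))) (at t within ?S)" if "t \<in> ?S" for n t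
      using partial_eq_shift[OF f'[OF S[OF that]], THEN has_vector_derivative_at_within]
      by (simp add: has_vector_derivative_def)
    show "\<forall>\<^sub>F n in sequentially. \<forall>t\<in>?S. \<forall>h. norm ((\<Sum>k<n. h *\<^sub>R f' k (?l t)) - h *\<^sub>R (\<Sum>n. f' n (?l t))) \<le> e * norm h"
      if "e > 0" for e
      using uniform_limitD[OF ul that]
    proof eventually_elim
      case (elim n)
      have "norm ((\<Sum>k<n. h *\<^sub>R f' k (?l t)) - h *\<^sub>R (\<Sum>n. f' n (?l t))) \<le> e * norm h" if "t \<in> ?S" for t h
      proof -
        have "(\<Sum>k<n. h *\<^sub>R f' k (?l t)) - h *\<^sub>R (\<Sum>n. f' n (?l t)) = h *\<^sub>R ((\<Sum>k<n. f' k (?l t)) - (\<Sum>n. f' n (?l t)))"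
          by (simp add: scaleR_sum_right scaleR_right_diff_distrib)
        moreover have "norm ((\<Sum>k<n. f' k (?l t)) - (\<Sum>n. f' n (?l t))) \<le> e"
          using elim that by (force simp: dist_norm)
        ultimately show ?thesis by (simp add: mult.commute[of e] mult_left_mono)
      qed
      then show ?case by blast
    qed
    show "(0::real) \<in> ?S" using d(1) by simp
    show "(\<lambda>n. f n (?l 0)) sums (\<Sum>n. f n (?l 0))"
      using M(1)[OF S[of 0]] d(1) by (intro summable_sums summable_comparison_test'[OF M(2)]) auto
  qed simp
  then obtain g where g: "\<And>t. t \<in> ?S \<Longrightarrow> (\<lambda>n. f n (?l t)) sums (g t)"
    "\<And>t. t \<in> ?S \<Longrightarrow> (g has_derivative (\<lambda>h. h *\<^sub>R (\<Sum>n. f' n (?l t)))) (at t within ?S)" by blast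
  have "(g has_vector_derivative (\<Sum>n. f' n x)) (at 0)"
    using g(2)[of 0] d(1) at_within_open[of 0 ?S] by (simp add: has_vector_derivative_def)
  then show ?thesis
    unfolding partial_eq_def
    by (rule has_vector_derivative_transform_within_open[where S = ?S]) (use d(1) g(1) in \<open>auto simp: sums_iff\<close>)
qed

section \<open>Multivariate power series\<close>

definition mon :: "real ^ 'n::finite \<Rightarrow> nat ^ 'n \<Rightarrow> real ^ 'n \<Rightarrow> complex" where
  "mon p \<gamma> x = complex_of_real (mi_power (x - p) \<gamma>)"

definition ps :: "real ^ 'n::finite \<Rightarrow> (nat ^ 'n \<Rightarrow> complex) \<Rightarrow> real ^ 'n \<Rightarrow> complex" where
  "ps p c x = (\<Sum>\<^sub>\<infinity>\<gamma>. c \<gamma> * mon p \<gamma> x)"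

text \<open>Absolute convergence on all smaller cubes, stated through the coefficients alone. On
  \<open>cube p s\<close> every monomial is at most s^|\<gamma>|, which is why cubes and not balls
  are the domains here.\<close>

definition ps_conv :: "real \<Rightarrow> (nat ^ 'n::finite \<Rightarrow> complex) \<Rightarrow> bool" where
  "ps_conv r c \<longleftrightarrow> (\<forall>s. 0 < s \<and> s < r \<longrightarrow> (\<lambda>\<gamma>. norm (c \<gamma>) * s ^ mi_abs \<gamma>) summable_on UNIV)"

definition cube :: "real ^ 'n::finite \<Rightarrow> real \<Rightarrow> (real ^ 'n) set" where
  "cube p r = {x. \<forall>i. \<bar>x $ i - p $ i\<bar> < r}"

lemma open_cube: "open (cube p r)"
proof -
  have "cube p r = (\<Inter>i\<in>UNIV. {x. \<bar>x $ i - p $ i\<bar> < r})" by (auto simp: cube_def)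
  moreover have "open {x. \<bar>x $ i - p $ i\<bar> < r}" for i
    by (intro open_Collect_less continuous_intros)
  ultimately show ?thesis by (auto intro: open_INT)
qed

lemma center_in_cube: "r > 0 \<Longrightarrow> p \<in> cube p r"
  by (simp add: cube_def)

lemma ball_subset_cube: "ball p r \<subseteq> cube p r"
proof
  fix x assume "x \<in> ball p r"
  then have "norm (x - p) < r" by (simp add: dist_norm norm_minus_commute)
  then show "x \<in> cube p r"
    unfolding cube_def using component_le_norm_cart[of "x - p"] by (auto intro: le_less_trans)
qed

lemma cube_mono: "r \<le> s \<Longrightarrow> cube p r \<subseteq> cube p s"
  by (auto simp: cube_def intro: less_le_trans)

lemma in_smaller_cube:
  assumes "x \<in> cube p r"
  obtains s where "0 < s" "s < r" "x \<in> cube p s"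
proof -
  define m where "m = Max (range (\<lambda>i. \<bar>x $ i - p $ i\<bar>))"
  have le: "\<bar>x $ i - p $ i\<bar> \<le> m" for i unfolding m_def by (intro Max_ge) auto
  have "m \<in> range (\<lambda>i. \<bar>x $ i - p $ i\<bar>)" unfolding m_def by (intro Max_in) auto
  then have "m < r" "0 \<le> m" using assms by (auto simp: cube_def)
  show ?thesis
  proof (rule that[of "(m + r) / 2"])
    have "\<bar>x $ i - p $ i\<bar> < (m + r) / 2" for i
      by (rule le_less_trans[OF le]) (use \<open>m < r\<close> in simp)
    then show "x \<in> cube p ((m + r) / 2)" by (simp add: cube_def)
  qed (use \<open>m < r\<close> \<open>0 \<le> m\<close> in auto)
qed

lemma norm_mon_le:
  assumes "\<And>i. \<bar>x $ i - p $ i\<bar> \<le> s"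
  shows "norm (mon p \<gamma> x) \<le> s ^ mi_abs \<gamma>"
proof -
  have "norm (mon p \<gamma> x) = \<bar>mi_power (x - p) \<gamma>\<bar>" unfolding mon_def by (rule norm_of_real)
  also have "\<dots> = (\<Prod>i\<in>UNIV. \<bar>x $ i - p $ i\<bar> ^ (\<gamma> $ i))"
    by (simp add: mi_power_def abs_prod power_abs)
  also have "\<dots> \<le> (\<Prod>i\<in>UNIV. s ^ (\<gamma> $ i))"
    by (intro prod_mono conjI power_mono assms) simp_all
  also have "\<dots> = s ^ mi_abs \<gamma>" by (simp add: mi_abs_def power_sum)
  finally show ?thesis .
qed

lemma norm_mon_le_norm: "norm (mon p \<gamma> x) \<le> norm (x - p) ^ mi_abs \<gamma>"
  using component_le_norm_cart[of "x - p"] by (intro norm_mon_le) simp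

text \<open>If \<open>\<gamma> $ i = 0\<close>, the truncated difference
  \<open>\<gamma> - axis i 1\<close> is \<gamma> itself, but its factor is then 0.\<close>

lemma partial_eq_mon:
  "partial_eq i (mon p \<gamma>) x (of_nat (\<gamma> $ i) * mon p (\<gamma> - axis i 1) x)"
proof -
  let ?P = "\<Prod>j\<in>UNIV - {i}. (x $ j - p $ j) ^ (\<gamma> $ j)"
  have "mi_power (x + t *\<^sub>R axis i 1 - p) \<gamma> = (x $ i - p $ i + t) ^ (\<gamma> $ i) * ?P" for t
  proof -
    have "(\<Prod>j\<in>UNIV - {i}. ((x + t *\<^sub>R axis i 1 - p) $ j) ^ (\<gamma> $ j)) = ?P"
      by (intro prod.cong) (auto simp: axis_def)
    then show ?thesis
      unfolding mi_power_def by (subst prod.remove[of UNIV i]) (simp_all add: algebra_simps)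
  qed
  moreover have "mi_power (x - p) (\<gamma> - axis i 1) = (x $ i - p $ i) ^ (\<gamma> $ i - 1) * ?P"
  proof -
    have "(\<Prod>j\<in>UNIV - {i}. ((x - p) $ j) ^ ((\<gamma> - axis i 1) $ j)) = ?P"
      by (intro prod.cong) (auto simp: axis_def)
    then show ?thesis
      unfolding mi_power_def by (subst prod.remove[of UNIV i]) simp_all
  qed
  moreover have "((\<lambda>t. (x $ i - p $ i + t) ^ (\<gamma> $ i) * ?P) has_real_derivative
      real (\<gamma> $ i) * ((x $ i - p $ i) ^ (\<gamma> $ i - 1) * ?P)) (at 0)"
    by (auto intro!: derivative_eq_intros)
  ultimately have "((\<lambda>t. mi_power (x + t *\<^sub>R axis i 1 - p) \<gamma>) has_real_derivative
      real (\<gamma> $ i) * mi_power (x - p) (\<gamma> - axis i 1)) (at 0)"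
    by presburger
  from has_vector_derivative_of_real[OF this] show ?thesis
    by (simp add: partial_eq_def mon_def)
qed

lemma smooth_on_mon: "open U \<Longrightarrow> smooth_on U (mon p \<gamma>)"
proof -
  assume "open U"
  then have "smooth_on U (\<lambda>x. \<Prod>i\<in>UNIV. (complex_of_real (x $ i) - complex_of_real (p $ i)) ^ (\<gamma> $ i))"
    by (intro smooth_on_prod smooth_on_power smooth_on_diff smooth_on_coord smooth_on_const)
  then show ?thesis by (simp add: mon_def[abs_def] mi_power_def)
qed

lemma mi_abs_add: "mi_abs (\<alpha> + \<beta>) = mi_abs \<alpha> + mi_abs \<beta>"
  by (simp add: mi_abs_def sum.distrib)

lemma mi_abs_axis: "mi_abs (axis i k) = k"
  by (simp add: mi_abs_def axis_def)

lemma component_le_mi_abs: "\<gamma> $ i \<le> mi_abs \<gamma>"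
  unfolding mi_abs_def by (rule member_le_sum) simp_all

lemma mon_add: "mon p (\<alpha> + \<beta>) x = mon p \<alpha> x * mon p \<beta> x"
  by (simp add: mon_def mi_power_def power_add prod.distrib)

lemma ps_conv_mono: "ps_conv r c \<Longrightarrow> s \<le> r \<Longrightarrow> ps_conv s c"
  by (simp add: ps_conv_def)

lemma abs_summable_ps:
  assumes "ps_conv r c" "x \<in> cube p r"
  shows "(\<lambda>\<gamma>. norm (c \<gamma> * mon p \<gamma> x)) summable_on UNIV"
proof -
  obtain s where s: "0 < s" "s < r" "x \<in> cube p s" using in_smaller_cube[OF assms(2)] .
  show ?thesis
  proof (rule summable_on_comparison_test)
    show "(\<lambda>\<gamma>. norm (c \<gamma>) * s ^ mi_abs \<gamma>) summable_on UNIV"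
      using assms(1) s(1,2) unfolding ps_conv_def by blast
    have "norm (mon p \<gamma> x) \<le> s ^ mi_abs \<gamma>" for \<gamma>
      using s(3) by (intro norm_mon_le) (auto simp: cube_def intro: less_imp_le)
    then show "norm (c \<gamma> * mon p \<gamma> x) \<le> norm (c \<gamma>) * s ^ mi_abs \<gamma>" for \<gamma>
      by (simp add: norm_mult mult_left_mono)
  qed simp
qed

lemma summable_ps: "ps_conv r c \<Longrightarrow> x \<in> cube p r \<Longrightarrow> (\<lambda>\<gamma>. c \<gamma> * mon p \<gamma> x) summable_on UNIV"
  by (rule abs_summable_summable) (rule abs_summable_ps)

text \<open>At the diagonal point p + (s, ..., s) every monomial equals the positive number
  s^|\<gamma>|. Unconditional convergence of a complex family is absolute, so this one point
  controls all coefficients.\<close>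

lemma has_sum_imp_ps_conv:
  assumes "r > 0" "\<And>x. x \<in> ball p r \<Longrightarrow> ((\<lambda>\<gamma>. c \<gamma> * mon p \<gamma> x) has_sum f x) UNIV"
  obtains r' where "r' > 0" "ps_conv r' c" "cube p r' \<subseteq> ball p r"
proof -
  let ?n = "real CARD('a)"
  \<comment> \<open>A point of \<open>cube p r'\<close> has distance at most n r' from p, by the l1
    bound for the norm, and n r' < r.\<close>
  define r' where "r' = r / (?n + 1)"
  have r': "0 < r'" "?n * r' < r" using assms(1) by (simp_all add: r'_def field_simps)
  have sub: "cube p r' \<subseteq> ball p r"
  proof
    fix x assume "x \<in> cube p r'"
    then have "(\<Sum>i\<in>UNIV. \<bar>(x - p) $ i\<bar>) \<le> (\<Sum>i::'a\<in>UNIV. r')"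
      by (intro sum_mono) (auto simp: cube_def intro: less_imp_le)
    then have "norm (x - p) < r" using norm_le_l1_cart[of "x - p"] r'(2) by simp
    then show "x \<in> ball p r" by (simp add: dist_norm norm_minus_commute)
  qed
  have "ps_conv r' c"
    unfolding ps_conv_def
  proof (intro allI impI)
    fix s assume s: "0 < s \<and> s < r'"
    define x where "x = p + (\<chi> i. s)"
    have "x \<in> cube p r'" using s by (simp add: x_def cube_def)
    then have "(\<lambda>\<gamma>. c \<gamma> * mon p \<gamma> x) summable_on UNIV"
      using sub assms(2) summable_on_def by blast
    then have "(\<lambda>\<gamma>. norm (c \<gamma> * mon p \<gamma> x)) summable_on UNIV"
      by (simp only: summable_on_iff_abs_summable_on_complex)
    moreover have "mon p \<gamma> x = complex_of_real (s ^ mi_abs \<gamma>)" for \<gamma>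
      by (simp add: mon_def mi_power_def x_def mi_abs_def power_sum)
    ultimately show "(\<lambda>\<gamma>. norm (c \<gamma>) * s ^ mi_abs \<gamma>) summable_on UNIV"
      using s by (simp add: norm_mult norm_power)
  qed
  with r' sub show ?thesis by (intro that) auto
qed

lemma real_analytic_on_ps:
  assumes "real_analytic_on f U" "p \<in> U"
  obtains c r where "r > 0" "ps_conv r c" "\<And>x. x \<in> cube p r \<Longrightarrow> f x = ps p c x"
proof -
  from bspec[OF assms(1)[unfolded real_analytic_on_def] assms(2)]
  obtain c r where r: "r > 0"
    and hs: "\<And>x. x \<in> ball p r \<Longrightarrow> ((\<lambda>\<gamma>. c \<gamma> * mon p \<gamma> x) has_sum f x) UNIV"
    unfolding mon_def by blast
  obtain r' where r': "r' > 0" "ps_conv r' c" "cube p r' \<subseteq> ball p r"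
    using has_sum_imp_ps_conv[OF r hs] .
  have "f x = ps p c x" if "x \<in> cube p r'" for x
    using infsumI[OF hs[of x]] that r'(3) by (auto simp: ps_def)
  with r' that show ?thesis by blast
qed

text \<open>Differentiation costs a factor k, which is absorbed by any increase of the radius: k
  (s/t)^k tends to 0 and hence is bounded. The case k = 0 is trivial despite the truncated
  exponent.\<close>

lemma power_deriv_bound:
  fixes s t :: real
  assumes "0 < s" "s < t"
  obtains K where "K > 0" "\<And>k. real k * s ^ (k - 1) \<le> K * t ^ k"
proof -
  have "(\<lambda>k. real k * (s / t) ^ k) \<longlonglongrightarrow> 0"
    using assms by (intro powser_times_n_limit_0) simp
  then have "Bseq (\<lambda>k. real k * (s / t) ^ k)"
    by (intro convergent_imp_Bseq convergentI)
  then obtain K where K: "K > 0" "\<And>k. norm (real k * (s / t) ^ k) \<le> K" unfolding Bseq_def by blast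
  show ?thesis
  proof (rule that[of "K / s"])
    show "K / s > 0" using K(1) assms(1) by simp
    show "real k * s ^ (k - 1) \<le> K / s * t ^ k" for k
    proof (cases k)
      case (Suc j)
      have "real k * (s / t) ^ k \<le> K" using K(2)[of k] assms by simp
      then have "real k * s ^ k \<le> K * t ^ k" using assms by (simp add: power_divide field_simps)
      then show ?thesis using assms Suc by (simp add: field_simps)
    qed (use K(1) assms in simp)
  qed
qed

section \<open>Differentiation of power series\<close>

definition ps_deriv :: "'n \<Rightarrow> (nat ^ 'n::finite \<Rightarrow> complex) \<Rightarrow> nat ^ 'n \<Rightarrow> complex" where
  "ps_deriv i c \<gamma> = of_nat (\<gamma> $ i + 1) * c (\<gamma> + axis i 1)"

lemma summable_ps_deriv_terms:
  assumes "ps_conv r c" "0 < s" "s < r"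
  shows "(\<lambda>\<gamma>. norm (c \<gamma>) * (real (\<gamma> $ i) * s ^ (mi_abs \<gamma> - 1))) summable_on UNIV"
proof -
  define t where "t = (s + r) / 2"
  have t: "s < t" "t < r" "0 < t" using assms by (auto simp: t_def)
  obtain K where K: "K > 0" "\<And>k. real k * s ^ (k - 1) \<le> K * t ^ k"
    using power_deriv_bound[OF assms(2) t(1)] by blast
  have "(\<lambda>\<gamma>. K * (norm (c \<gamma>) * t ^ mi_abs \<gamma>)) summable_on UNIV"
    using assms(1) t by (intro summable_on_cmult_right) (simp add: ps_conv_def)
  then show ?thesis
  proof (rule summable_on_comparison_test)
    fix \<gamma> :: "nat ^ 'a"
    have "real (\<gamma> $ i) * s ^ (mi_abs \<gamma> - 1) \<le> real (mi_abs \<gamma>) * s ^ (mi_abs \<gamma> - 1)"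
      using component_le_mi_abs[of \<gamma> i] assms(2) by (intro mult_right_mono) simp_all
    also have "\<dots> \<le> K * t ^ mi_abs \<gamma>" by (rule K(2))
    finally have "norm (c \<gamma>) * (real (\<gamma> $ i) * s ^ (mi_abs \<gamma> - 1)) \<le> norm (c \<gamma>) * (K * t ^ mi_abs \<gamma>)"
      by (rule mult_left_mono) simp
    then show "norm (c \<gamma>) * (real (\<gamma> $ i) * s ^ (mi_abs \<gamma> - 1)) \<le> K * (norm (c \<gamma>) * t ^ mi_abs \<gamma>)"
      by (simp add: mult.left_commute)
    show "0 \<le> norm (c \<gamma>) * (real (\<gamma> $ i) * s ^ (mi_abs \<gamma> - 1))" using assms(2) by simp
  qed
qed

lemma inj_add_axis: "inj (\<lambda>\<gamma> :: nat ^ 'n::finite. \<gamma> + axis i 1)"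
  by (rule injI) simp

lemma range_add_axis: "range (\<lambda>\<gamma> :: nat ^ 'n::finite. \<gamma> + axis i 1) = {\<gamma>. \<gamma> $ i \<noteq> 0}"
proof (intro equalityI subsetI)
  fix \<gamma> :: "nat ^ 'n" assume "\<gamma> \<in> {\<gamma>. \<gamma> $ i \<noteq> 0}"
  then have "\<gamma> = (\<gamma> - axis i 1) + axis i 1" by (simp add: vec_eq_iff axis_def)
  then show "\<gamma> \<in> range (\<lambda>\<gamma>. \<gamma> + axis i 1)" by blast
qed (auto simp: axis_def)

lemma ps_conv_deriv:
  assumes "ps_conv r c"
  shows "ps_conv r (ps_deriv i c)"
  unfolding ps_conv_def
proof (intro allI impI)
  fix s assume s: "0 < s \<and> s < r"
  let ?g = "\<lambda>\<gamma>. norm (c \<gamma>) * (real (\<gamma> $ i) * s ^ (mi_abs \<gamma> - 1))"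
  have "?g summable_on range (\<lambda>\<gamma>. \<gamma> + axis i 1)"
    using summable_on_subset_banach[OF summable_ps_deriv_terms[OF assms, of s i]] s by blast
  then have "(?g \<circ> (\<lambda>\<gamma>. \<gamma> + axis i 1)) summable_on UNIV"
    using summable_on_reindex[OF inj_add_axis] by blast
  moreover have "?g \<circ> (\<lambda>\<gamma>. \<gamma> + axis i 1) = (\<lambda>\<gamma>. norm (ps_deriv i c \<gamma>) * s ^ mi_abs \<gamma>)"
    by (rule ext) (simp add: ps_deriv_def mi_abs_add mi_abs_axis norm_mult del: of_nat_Suc of_nat_add)
  ultimately show "(\<lambda>\<gamma>. norm (ps_deriv i c \<gamma>) * s ^ mi_abs \<gamma>) summable_on UNIV" by simp
qed

text \<open>The theorems on series of functions concern the index set \<open>nat\<close>. Absolute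
  convergence allows a sum over multi-indices to be enumerated by any bijection.\<close>

lemma infsum_eq_suminf_enum:
  fixes f :: "'a \<Rightarrow> complex" and b :: "nat \<Rightarrow> 'a"
  assumes "bij b" "(\<lambda>x. norm (f x)) summable_on UNIV"
  shows "(\<Sum>\<^sub>\<infinity>x. f x) = (\<Sum>n. f (b n))"
proof -
  have "(f has_sum (\<Sum>\<^sub>\<infinity>x. f x)) UNIV"
    using abs_summable_summable[OF assms(2)] by simp
  then have "((\<lambda>n. f (b n)) has_sum (\<Sum>\<^sub>\<infinity>x. f x)) UNIV"
    using has_sum_reindex_bij_betw[of b UNIV UNIV f] assms(1) by simp
  from sums_unique[OF has_sum_imp_sums[OF this]] show ?thesis .
qed

lemma summable_enum:
  fixes f :: "'a \<Rightarrow> real" and b :: "nat \<Rightarrow> 'a"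
  assumes "bij b" "f summable_on UNIV"
  shows "summable (\<lambda>n. f (b n))"
  using summable_on_reindex_bij_betw[of b UNIV UNIV f] assms by (intro summable_on_imp_summable) simp

lemma exists_enum_multi_index: "\<exists>b :: nat \<Rightarrow> nat ^ 'n::finite. bij b"
proof -
  have "inj (\<lambda>k. axis (undefined :: 'n) k :: nat ^ 'n)"
    by (rule injI) (metis axis_nth)
  then have "infinite (UNIV :: (nat ^ 'n) set)"
    using infinite_iff_countable_subset by blast
  then show ?thesis
    using bij_betw_from_nat_into[of "UNIV :: (nat ^ 'n) set"] by auto
qed

lemma partial_eq_ps:
  assumes "ps_conv r c" "x \<in> cube p r"
  shows "partial_eq i (ps p c) x (ps p (ps_deriv i c) x)"
proof -
  obtain s where s: "0 < s" "s < r" "x \<in> cube p s" using in_smaller_cube[OF assms(2)] .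
  obtain b :: "nat \<Rightarrow> nat ^ 'a" where b: "bij b" using exists_enum_multi_index by blast
  let ?d = "\<lambda>\<gamma> y. c \<gamma> * (of_nat (\<gamma> $ i) * mon p (\<gamma> - axis i 1) y)"
  have le: "norm (mon p \<gamma> y) \<le> s ^ mi_abs \<gamma>" if "y \<in> cube p s" for \<gamma> y
    using that by (intro norm_mon_le) (auto simp: cube_def intro: less_imp_le)
  have bound: "norm (?d \<gamma> y) \<le> norm (c \<gamma>) * (real (\<gamma> $ i) * s ^ (mi_abs \<gamma> - 1))" if "y \<in> cube p s" for \<gamma> y
  proof (cases "\<gamma> $ i = 0")
    case False
    then have "\<gamma> = (\<gamma> - axis i 1) + axis i 1" by (simp add: vec_eq_iff axis_def)
    then have "mi_abs \<gamma> = mi_abs (\<gamma> - axis i 1) + 1" by (metis mi_abs_add mi_abs_axis)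
    then show ?thesis using le[OF that, of "\<gamma> - axis i 1"] by (simp add: norm_mult mult_left_mono)
  qed simp
  have "partial_eq i (\<lambda>y. \<Sum>n. c (b n) * mon p (b n) y) x (\<Sum>n. ?d (b n) x)"
  proof (rule partial_eq_suminf[OF open_cube s(3)])
    show "partial_eq i (\<lambda>y. c (b n) * mon p (b n) y) y (?d (b n) y)" for n y
      using partial_eq_mult[OF partial_eq_const[of i "c (b n)" y] partial_eq_mon[of i p "b n" y]] by simp
    show "norm (c (b n) * mon p (b n) y) \<le> norm (c (b n)) * s ^ mi_abs (b n)" if "y \<in> cube p s" for n y
      using le[OF that] by (simp add: norm_mult mult_left_mono)
    show "summable (\<lambda>n. norm (c (b n)) * s ^ mi_abs (b n))"
      using assms(1) s by (intro summable_enum[OF b]) (simp add: ps_conv_def)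
    show "norm (?d (b n) y) \<le> norm (c (b n)) * (real (b n $ i) * s ^ (mi_abs (b n) - 1))" if "y \<in> cube p s" for n y
      using that by (rule bound)
    show "summable (\<lambda>n. norm (c (b n)) * (real (b n $ i) * s ^ (mi_abs (b n) - 1)))"
      by (rule summable_enum[OF b summable_ps_deriv_terms[OF assms(1) s(1,2)]])
  qed
  moreover have "(\<Sum>n. ?d (b n) x) = ps p (ps_deriv i c) x"
  proof -
    have "(\<lambda>\<gamma>. norm (?d \<gamma> x)) summable_on UNIV"
      by (rule summable_on_comparison_test[OF summable_ps_deriv_terms[OF assms(1) s(1,2)] bound[OF s(3)]]) simp
    then have "(\<Sum>n. ?d (b n) x) = (\<Sum>\<^sub>\<infinity>\<gamma>. ?d \<gamma> x)" by (rule infsum_eq_suminf_enum[OF b, symmetric])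
    \<comment> \<open>Terms with \<open>\<gamma> $ i = 0\<close> carry the factor 0; the others are
      indexed by \<gamma> + e_i.\<close>
    also have "\<dots> = (\<Sum>\<^sub>\<infinity>\<gamma>\<in>range (\<lambda>\<gamma>. \<gamma> + axis i 1). ?d \<gamma> x)"
      unfolding range_add_axis by (rule infsum_cong_neutral) auto
    also have "\<dots> = (\<Sum>\<^sub>\<infinity>\<gamma>. ?d (\<gamma> + axis i 1) x)"
      by (subst infsum_reindex[OF inj_add_axis]) (simp only: o_def)
    also have "\<dots> = ps p (ps_deriv i c) x"
      unfolding ps_def by (rule infsum_cong) (simp add: ps_deriv_def mult.assoc mult.left_commute)
    finally show ?thesis .
  qed
  moreover have "partial_eq i (ps p c) x D" if "partial_eq i (\<lambda>y. \<Sum>n. c (b n) * mon p (b n) y) x D" for D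
  proof (rule partial_eq_cong_open[OF open_cube s(3) _ that])
    show "(\<Sum>n. c (b n) * mon p (b n) y) = ps p c y" if "y \<in> cube p s" for y
      unfolding ps_def
      by (rule infsum_eq_suminf_enum[OF b abs_summable_ps[OF assms(1)], symmetric])
        (use that cube_mono[of s r p] s(2) in auto)
  qed
  ultimately show ?thesis by simp
qed

lemma continuous_on_ps:
  assumes "ps_conv r c"
  shows "continuous_on (cube p r) (ps p c)"
proof (rule continuous_at_imp_continuous_on, rule ballI)
  fix x assume x: "x \<in> cube p r"
  obtain s where s: "0 < s" "s < r" "x \<in> cube p s" using in_smaller_cube[OF x] .
  obtain b :: "nat \<Rightarrow> nat ^ 'a" where b: "bij b" using exists_enum_multi_index by blast
  have le: "norm (mon p \<gamma> y) \<le> s ^ mi_abs \<gamma>" if "y \<in> cube p s" for \<gamma> y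
    using that by (intro norm_mon_le) (auto simp: cube_def intro: less_imp_le)
  have "continuous_on (cube p s) (\<lambda>y. \<Sum>n. c (b n) * mon p (b n) y)"
  proof (rule continuous_on_suminf)
    show "continuous_on (cube p s) (\<lambda>y. c (b n) * mon p (b n) y)" for n
      by (intro continuous_intros smooth_on_imp_continuous_on smooth_on_mon open_cube)
    show "norm (c (b n) * mon p (b n) y) \<le> norm (c (b n)) * s ^ mi_abs (b n)" if "y \<in> cube p s" for n y
      using le[OF that] by (simp add: norm_mult mult_left_mono)
    show "summable (\<lambda>n. norm (c (b n)) * s ^ mi_abs (b n))"
      using assms(1) s by (intro summable_enum[OF b]) (simp add: ps_conv_def)
  qed
  moreover have "(\<Sum>n. c (b n) * mon p (b n) y) = ps p c y" if "y \<in> cube p s" for y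
    unfolding ps_def
    by (rule infsum_eq_suminf_enum[OF b abs_summable_ps[OF assms(1)], symmetric])
      (use that cube_mono[of s r p] s(2) in auto)
  ultimately have "continuous_on (cube p s) (ps p c)" by (rule continuous_on_eq)
  then show "isCont (ps p c) x" using open_cube s(3) continuous_on_eq_continuous_at by blast
qed

lemma smooth_on_ps:
  assumes "ps_conv r c"
  shows "smooth_on (cube p r) (ps p c)"
proof (rule smooth_on_coinduct[OF open_cube, where F = "ps p ` {c. ps_conv r c}"])
  show "ps p c \<in> ps p ` {c. ps_conv r c}" using assms by simp
  show "continuous_on (cube p r) f" if "f \<in> ps p ` {c. ps_conv r c}" for f
    using that continuous_on_ps by auto
  show "\<exists>f'\<in>ps p ` {c. ps_conv r c}. \<forall>x\<in>cube p r. partial_eq i f x (f' x)"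
    if "f \<in> ps p ` {c. ps_conv r c}" for f i
  proof -
    from that obtain c where c: "ps_conv r c" "f = ps p c" by auto
    then show ?thesis
      using ps_conv_deriv[OF c(1)] partial_eq_ps[OF c(1)] by (intro bexI[of _ "ps p (ps_deriv i c)"]) auto
  qed
qed

lemma ps_at_center: "ps p c p = c 0"
proof -
  have "c \<gamma> * mon p \<gamma> p = 0" if "\<gamma> \<noteq> 0" for \<gamma>
    using that by (auto simp: mon_def mi_power_def vec_eq_iff)
  then have "ps p c p = (\<Sum>\<^sub>\<infinity>\<gamma>\<in>{0}. c \<gamma> * mon p \<gamma> p)"
    unfolding ps_def by (intro infsum_cong_neutral) auto
  then show ?thesis by (simp add: mon_def mi_power_def)
qed

lemma vanishes_to_ps:
  assumes "r > 0" "ps_conv r c" "\<And>\<gamma>. mi_abs \<gamma> < k \<Longrightarrow> c \<gamma> = 0"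
  shows "vanishes_to k p (ps p c)"
  using assms(2,3)
proof (induction k arbitrary: c)
  case (Suc k)
  have "vanishes_to k p (partial i (ps p c))" for i
  proof (rule vanishes_to_cong[OF open_cube center_in_cube[OF assms(1)]])
    show "vanishes_to k p (ps p (ps_deriv i c))"
      using Suc.prems by (intro Suc.IH ps_conv_deriv) (simp_all add: ps_deriv_def mi_abs_add mi_abs_axis)
    show "ps p (ps_deriv i c) y = partial i (ps p c) y" if "y \<in> cube p r" for y
      using partial_eq_imp_partial[OF partial_eq_ps[OF Suc.prems(1) that]] by simp
  qed
  moreover have "c 0 = 0" using Suc.prems(2)[of 0] by (simp add: mi_abs_def)
  ultimately show ?case by (simp add: ps_at_center)
qed simp

lemma has_sum_sum:
  fixes f :: "'j \<Rightarrow> 'a \<Rightarrow> 'b::topological_comm_monoid_add"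
  assumes "finite A" "\<And>j. j \<in> A \<Longrightarrow> (f j has_sum s j) X"
  shows "((\<lambda>x. \<Sum>j\<in>A. f j x) has_sum (\<Sum>j\<in>A. s j)) X"
  using assms by (induction A rule: finite_induct) (simp_all add: has_sum_add has_sum_0)

lemma ps_lincomb:
  assumes "finite A" "\<And>j. j \<in> A \<Longrightarrow> ps_conv r (c j)"
  shows "ps_conv r (\<lambda>\<gamma>. \<Sum>j\<in>A. k j * c j \<gamma>)"
    and "x \<in> cube p r \<Longrightarrow> ps p (\<lambda>\<gamma>. \<Sum>j\<in>A. k j * c j \<gamma>) x = (\<Sum>j\<in>A. k j * ps p (c j) x)"
proof -
  show "ps_conv r (\<lambda>\<gamma>. \<Sum>j\<in>A. k j * c j \<gamma>)"
    unfolding ps_conv_def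
  proof (intro allI impI)
    fix s assume s: "0 < s \<and> s < r"
    have "(\<lambda>\<gamma>. norm (k j) * (norm (c j \<gamma>) * s ^ mi_abs \<gamma>)) summable_on UNIV" if "j \<in> A" for j
      using assms(2)[OF that] s by (intro summable_on_cmult_right) (simp add: ps_conv_def)
    then have "((\<lambda>\<gamma>. norm (k j) * (norm (c j \<gamma>) * s ^ mi_abs \<gamma>)) has_sum
        (\<Sum>\<^sub>\<infinity>\<gamma>. norm (k j) * (norm (c j \<gamma>) * s ^ mi_abs \<gamma>))) UNIV" if "j \<in> A" for j
      using that by simp
    from has_sum_sum[OF assms(1), of "\<lambda>j \<gamma>. norm (k j) * (norm (c j \<gamma>) * s ^ mi_abs \<gamma>)", OF this]
    have "(\<lambda>\<gamma>. \<Sum>j\<in>A. norm (k j) * (norm (c j \<gamma>) * s ^ mi_abs \<gamma>)) summable_on UNIV"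
      by (auto simp: summable_on_def)
    then show "(\<lambda>\<gamma>. norm (\<Sum>j\<in>A. k j * c j \<gamma>) * s ^ mi_abs \<gamma>) summable_on UNIV"
    proof (rule summable_on_comparison_test)
      show "norm (\<Sum>j\<in>A. k j * c j \<gamma>) * s ^ mi_abs \<gamma> \<le> (\<Sum>j\<in>A. norm (k j) * (norm (c j \<gamma>) * s ^ mi_abs \<gamma>))" for \<gamma> :: "nat ^ 'b"
      proof -
        have "norm (\<Sum>j\<in>A. k j * c j \<gamma>) \<le> (\<Sum>j\<in>A. norm (k j) * norm (c j \<gamma>))"
          by (rule order_trans[OF norm_sum]) (simp add: norm_mult)
        then have "norm (\<Sum>j\<in>A. k j * c j \<gamma>) * s ^ mi_abs \<gamma> \<le> (\<Sum>j\<in>A. norm (k j) * norm (c j \<gamma>)) * s ^ mi_abs \<gamma>"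
          using s by (intro mult_right_mono) simp_all
        then show ?thesis by (simp add: sum_distrib_right mult.assoc)
      qed
    qed (use s in simp)
  qed
  show "ps p (\<lambda>\<gamma>. \<Sum>j\<in>A. k j * c j \<gamma>) x = (\<Sum>j\<in>A. k j * ps p (c j) x)" if x: "x \<in> cube p r"
  proof -
    have "((\<lambda>\<gamma>. k j * (c j \<gamma> * mon p \<gamma> x)) has_sum (k j * ps p (c j) x)) UNIV" if "j \<in> A" for j
      unfolding ps_def using summable_ps[OF assms(2)[OF that] x] by (intro has_sum_cmult_right) simp
    from infsumI[OF has_sum_sum[OF assms(1) this]] show ?thesis
      by (simp add: ps_def sum_distrib_right mult.assoc)
  qed
qed

text \<open>The coefficients of the product of the series c with (x - p)^\<delta>.\<close>

definition ps_shift :: "nat ^ 'n::finite \<Rightarrow> (nat ^ 'n \<Rightarrow> complex) \<Rightarrow> nat ^ 'n \<Rightarrow> complex" where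
  "ps_shift \<delta> c \<beta> = (if \<delta> \<le> \<beta> then c (\<beta> - \<delta>) else 0)"

lemma range_add_multi_index: "range (\<lambda>\<gamma> :: nat ^ 'n::finite. \<gamma> + \<delta>) = {\<beta>. \<delta> \<le> \<beta>}"
proof (intro equalityI subsetI)
  fix \<beta> :: "nat ^ 'n" assume "\<beta> \<in> {\<beta>. \<delta> \<le> \<beta>}"
  then have "\<beta> = (\<beta> - \<delta>) + \<delta>" by (simp add: vec_eq_iff less_eq_vec_def)
  then show "\<beta> \<in> range (\<lambda>\<gamma>. \<gamma> + \<delta>)" by blast
qed (auto simp: less_eq_vec_def)

text \<open>The function g is kept general so that the same reindexing serves both the values of the
  series and the norms in \<open>ps_conv\<close>.\<close>

lemma infsum_ps_shift:
  fixes g :: "complex \<Rightarrow> nat ^ 'n::finite \<Rightarrow> 'b::banach"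
  assumes "\<And>\<beta>. g 0 \<beta> = 0"
  shows "(\<lambda>\<beta>. g (ps_shift \<delta> c \<beta>) \<beta>) summable_on UNIV \<longleftrightarrow> (\<lambda>\<gamma>. g (c \<gamma>) (\<gamma> + \<delta>)) summable_on UNIV"
    and "(\<Sum>\<^sub>\<infinity>\<beta>. g (ps_shift \<delta> c \<beta>) \<beta>) = (\<Sum>\<^sub>\<infinity>\<gamma>. g (c \<gamma>) (\<gamma> + \<delta>))"
proof -
  have inj: "inj (\<lambda>\<gamma> :: nat ^ 'n. \<gamma> + \<delta>)" by (rule injI) simp
  have eq: "(\<lambda>\<beta>. g (ps_shift \<delta> c \<beta>) \<beta>) \<circ> (\<lambda>\<gamma>. \<gamma> + \<delta>) = (\<lambda>\<gamma>. g (c \<gamma>) (\<gamma> + \<delta>))"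
    by (auto simp: fun_eq_iff ps_shift_def less_eq_vec_def)
  have 0: "g (ps_shift \<delta> c \<beta>) \<beta> = 0" if "\<beta> \<notin> range (\<lambda>\<gamma>. \<gamma> + \<delta>)" for \<beta>
    using that assms by (simp add: range_add_multi_index ps_shift_def)
  have "(\<lambda>\<beta>. g (ps_shift \<delta> c \<beta>) \<beta>) summable_on UNIV \<longleftrightarrow>
      (\<lambda>\<beta>. g (ps_shift \<delta> c \<beta>) \<beta>) summable_on range (\<lambda>\<gamma>. \<gamma> + \<delta>)"
    using 0 by (intro summable_on_cong_neutral) auto
  then show "(\<lambda>\<beta>. g (ps_shift \<delta> c \<beta>) \<beta>) summable_on UNIV \<longleftrightarrow> (\<lambda>\<gamma>. g (c \<gamma>) (\<gamma> + \<delta>)) summable_on UNIV"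
    by (simp only: summable_on_reindex[OF inj] eq)
  have "(\<Sum>\<^sub>\<infinity>\<beta>. g (ps_shift \<delta> c \<beta>) \<beta>) = (\<Sum>\<^sub>\<infinity>\<beta>\<in>range (\<lambda>\<gamma>. \<gamma> + \<delta>). g (ps_shift \<delta> c \<beta>) \<beta>)"
    using 0 by (intro infsum_cong_neutral) auto
  then show "(\<Sum>\<^sub>\<infinity>\<beta>. g (ps_shift \<delta> c \<beta>) \<beta>) = (\<Sum>\<^sub>\<infinity>\<gamma>. g (c \<gamma>) (\<gamma> + \<delta>))"
    by (simp only: infsum_reindex[OF inj] eq)
qed

lemma ps_conv_shift: "ps_conv r c \<Longrightarrow> ps_conv r (ps_shift \<delta> c)"
  unfolding ps_conv_def
proof (intro allI impI)
  fix s assume c: "\<forall>s. 0 < s \<and> s < r \<longrightarrow> (\<lambda>\<gamma>. norm (c \<gamma>) * s ^ mi_abs \<gamma>) summable_on UNIV"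
    and s: "0 < s \<and> s < r"
  have "(\<lambda>\<gamma>. norm (c \<gamma>) * s ^ mi_abs \<gamma> * s ^ mi_abs \<delta>) summable_on UNIV"
    using c s by (intro summable_on_cmult_left) simp
  then show "(\<lambda>\<gamma>. norm (ps_shift \<delta> c \<gamma>) * s ^ mi_abs \<gamma>) summable_on UNIV"
    by (subst infsum_ps_shift(1)[where g = "\<lambda>z \<beta>. norm z * s ^ mi_abs \<beta>"])
      (simp_all add: mi_abs_add power_add mult.assoc)
qed

lemma ps_shift_eq:
  assumes "ps_conv r c" "x \<in> cube p r"
  shows "ps p (ps_shift \<delta> c) x = ps p c x * mon p \<delta> x"
proof -
  have "ps p (ps_shift \<delta> c) x = (\<Sum>\<^sub>\<infinity>\<gamma>. c \<gamma> * mon p \<gamma> x * mon p \<delta> x)"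
    unfolding ps_def
    by (subst infsum_ps_shift(2)[where g = "\<lambda>z \<beta>. z * mon p \<beta> x"]) (simp_all add: mon_add mult.assoc)
  also have "\<dots> = ps p c x * mon p \<delta> x"
    unfolding ps_def using summable_ps[OF assms] by (intro infsum_cmult_left)
  finally show ?thesis .
qed

text \<open>With q = |x - p| / s at most 1, a monomial of degree d is bounded by s^d q^d, and for d
  at least M by s^d q^M. The factor q^M leaves the sum and what remains converges.\<close>

lemma ps_remainder:
  assumes "ps_conv r c" "0 < s" "s < r"
  obtains K where "K \<ge> 0" "\<And>x. norm (x - p) \<le> s \<Longrightarrow>
    norm (ps p c x - (\<Sum>\<gamma> | mi_abs \<gamma> < M. c \<gamma> * mon p \<gamma> x)) \<le> K * norm (x - p) ^ M"
proof -
  let ?B = "{\<gamma> :: nat ^ 'a. mi_abs \<gamma> < M}"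
  have fin: "finite ?B" by (rule finite_subset[OF _ finite_mi_abs_le[of M]]) auto
  have sum: "(\<lambda>\<gamma>. norm (c \<gamma>) * s ^ mi_abs \<gamma>) summable_on A" for A
    using assms summable_on_subset_banach[of _ UNIV A] by (auto simp: ps_conv_def)
  define K where "K = (\<Sum>\<^sub>\<infinity>\<gamma>\<in>-?B. norm (c \<gamma>) * s ^ mi_abs \<gamma>) / s ^ M"
  show ?thesis
  proof (rule that[of K])
    show "K \<ge> 0" unfolding K_def using assms(2) by (intro divide_nonneg_nonneg infsum_nonneg) simp_all
    fix x assume x: "norm (x - p) \<le> s"
    have "x \<in> cube p r"
      using x assms(3) ball_subset_cube[of p r] by (auto simp: dist_norm norm_minus_commute)
    note summ = summable_ps[OF assms(1) this]
    have "ps p c x = (\<Sum>\<gamma>\<in>?B. c \<gamma> * mon p \<gamma> x) + (\<Sum>\<^sub>\<infinity>\<gamma>\<in>-?B. c \<gamma> * mon p \<gamma> x)"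
      unfolding ps_def infsum_finite[OF fin, symmetric]
      by (subst infsum_Un_disjoint[symmetric]) (auto intro: summable_on_subset_banach[OF summ])
    then have "norm (ps p c x - (\<Sum>\<gamma>\<in>?B. c \<gamma> * mon p \<gamma> x)) = norm (\<Sum>\<^sub>\<infinity>\<gamma>\<in>-?B. c \<gamma> * mon p \<gamma> x)" by simp
    also have "\<dots> \<le> (\<Sum>\<^sub>\<infinity>\<gamma>\<in>-?B. norm (c \<gamma>) * s ^ mi_abs \<gamma> * (norm (x - p) / s) ^ M)"
    proof (rule norm_infsum_le)
      show "((\<lambda>\<gamma>. c \<gamma> * mon p \<gamma> x) has_sum (\<Sum>\<^sub>\<infinity>\<gamma>\<in>-?B. c \<gamma> * mon p \<gamma> x)) (- ?B)"
        using summable_on_subset_banach[OF summ] by simp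
      show "((\<lambda>\<gamma>. norm (c \<gamma>) * s ^ mi_abs \<gamma> * (norm (x - p) / s) ^ M) has_sum
          (\<Sum>\<^sub>\<infinity>\<gamma>\<in>-?B. norm (c \<gamma>) * s ^ mi_abs \<gamma> * (norm (x - p) / s) ^ M)) (- ?B)"
        using summable_on_cmult_left[OF sum] by simp
      fix \<gamma> assume "\<gamma> \<in> - ?B"
      then have M: "M \<le> mi_abs \<gamma>" by simp
      have "norm (mon p \<gamma> x) \<le> (s * (norm (x - p) / s)) ^ mi_abs \<gamma>"
        using norm_mon_le_norm[of p \<gamma> x] assms(2) by simp
      also have "\<dots> = s ^ mi_abs \<gamma> * (norm (x - p) / s) ^ mi_abs \<gamma>" by (rule power_mult_distrib)
      also have "\<dots> \<le> s ^ mi_abs \<gamma> * (norm (x - p) / s) ^ M"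
        using x assms(2) M by (intro mult_left_mono power_decreasing) simp_all
      finally show "norm (c \<gamma> * mon p \<gamma> x) \<le> norm (c \<gamma>) * s ^ mi_abs \<gamma> * (norm (x - p) / s) ^ M"
        by (simp add: norm_mult mult.assoc mult_left_mono)
    qed
    also have "\<dots> = (\<Sum>\<^sub>\<infinity>\<gamma>\<in>-?B. norm (c \<gamma>) * s ^ mi_abs \<gamma>) * (norm (x - p) / s) ^ M"
      by (rule infsum_cmult_left) (rule sum)
    also have "\<dots> = K * norm (x - p) ^ M" by (simp add: K_def power_divide)
    finally show "norm (ps p c x - (\<Sum>\<gamma>\<in>?B. c \<gamma> * mon p \<gamma> x)) \<le> K * norm (x - p) ^ M" .
  qed
qed

section \<open>The Fourier transform\<close>

text \<open>Lebesgue measure on \<open>real ^ 'n\<close> is the image of the product measure over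
  \<open>Basis\<close>, whose elements are the unit vectors; \<open>ix\<close> recovers the
  coordinate from the unit vector.\<close>

lemma integral_prod_cart:
  fixes f :: "'n::finite \<Rightarrow> real \<Rightarrow> 'b::{real_normed_field,banach,second_countable_topology}"
  assumes "\<And>i. integrable lborel (f i)"
  shows "integrable lborel (\<lambda>x :: real ^ 'n. \<Prod>i\<in>UNIV. f i (x $ i))"
    and "(LINT x|lborel. (\<Prod>i\<in>UNIV. f i (x $ i :: real))) = (\<Prod>i\<in>UNIV. LINT s|lborel. f i s)"
proof -
  interpret product_sigma_finite "\<lambda>_ :: real ^ 'n. lborel :: real measure" ..
  define ix :: "real ^ 'n \<Rightarrow> 'n" where "ix = inv (\<lambda>i. axis i 1)"
  have inj: "inj (\<lambda>i. axis i 1 :: real ^ 'n)" by (rule injI) (simp add: axis_eq_axis)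
  have ix: "ix (axis i 1) = i" for i unfolding ix_def using inv_f_f[OF inj] by simp
  have basis: "(Basis :: (real ^ 'n) set) = range (\<lambda>i. axis i 1)" by (auto simp: Basis_vec_def)
  let ?e = "\<lambda>g :: real ^ 'n \<Rightarrow> real. \<Sum>b\<in>Basis. g b *\<^sub>R b"
  have comp: "?e g $ i = g (axis i 1)" for g i
    unfolding basis sum.reindex[OF inj] o_def by (simp add: axis_def if_distrib cong: if_cong)
  have prod_eq: "(\<Prod>i\<in>UNIV. f i (?e g $ i)) = (\<Prod>b\<in>Basis. f (ix b) (g b))" for g
  proof -
    have "(\<Prod>i\<in>UNIV. f i (?e g $ i)) = (\<Prod>i\<in>UNIV. f i (g (axis i 1)))" by (simp only: comp)
    also have "\<dots> = (\<Prod>b\<in>Basis. f (ix b) (g b))"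
      unfolding basis prod.reindex[OF inj] o_def ix ..
    finally show ?thesis .
  qed
  have f[measurable]: "f i \<in> borel_measurable borel" for i
    using assms[of i] by (simp add: borel_measurable_integrable)
  have meas: "(\<lambda>x :: real ^ 'n. \<Prod>i\<in>UNIV. f i (x $ i)) \<in> borel_measurable borel"
    by measurable
  have e: "?e \<in> measurable (Pi\<^sub>M Basis (\<lambda>_. lborel)) borel" by measurable
  have "integrable (Pi\<^sub>M Basis (\<lambda>_. lborel)) (\<lambda>g. \<Prod>i\<in>UNIV. f i (?e g $ i))"
    unfolding prod_eq by (rule product_integrable_prod) (simp_all add: assms)
  then have "integrable (distr (Pi\<^sub>M Basis (\<lambda>_. lborel)) borel ?e) (\<lambda>x :: real ^ 'n. \<Prod>i\<in>UNIV. f i (x $ i))"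
    by (subst integrable_distr_eq[OF e meas])
  then show "integrable lborel (\<lambda>x :: real ^ 'n. \<Prod>i\<in>UNIV. f i (x $ i))"
    by (subst lborel_eq)
  have "(LINT x|lborel. (\<Prod>i\<in>UNIV. f i ((x :: real ^ 'n) $ i))) =
      (LINT g|(Pi\<^sub>M Basis (\<lambda>_. lborel)). (\<Prod>i\<in>UNIV. f i (?e g $ i)))"
    by (subst lborel_eq) (rule integral_distr[OF e meas])
  also have "\<dots> = (\<Prod>b\<in>Basis. LINT s|lborel. f (ix b) s)"
    unfolding prod_eq by (rule product_integral_prod) (simp_all add: assms)
  also have "\<dots> = (\<Prod>i\<in>UNIV. LINT s|lborel. f i s)"
    unfolding basis prod.reindex[OF inj] o_def ix ..
  finally show "(LINT x|lborel. (\<Prod>i\<in>UNIV. f i (x $ i :: real))) = (\<Prod>i\<in>UNIV. LINT s|lborel. f i s)" .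
qed

text \<open>An integrable weight that dominates in space and in frequency. The exponent 2n comes
  from comparing (1 + |x|)^2 with 1 + x_i^2 for each of the n coordinates, whose reciprocals have an
  integrable product.\<close>

definition wt :: "real ^ 'n::finite \<Rightarrow> real" where
  "wt x = inverse ((1 + norm x) ^ (2 * CARD('n)))"

lemma wt_pos: "wt x > 0"
  by (simp add: wt_def add_pos_nonneg)

lemma continuous_on_wt: "continuous_on U wt"
proof -
  have "1 + norm x \<noteq> 0" for x :: "real ^ 'a" using norm_ge_zero[of x] by linarith
  then show ?thesis unfolding wt_def by (intro continuous_intros ballI) simp
qed

lemma borel_measurable_wt[measurable]: "wt \<in> borel_measurable borel"
  using continuous_on_wt by (rule borel_measurable_continuous_onI)

lemma integrable_wt: "integrable lborel (wt :: real ^ 'n::finite \<Rightarrow> real)"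
proof (rule Bochner_Integration.integrable_bound)
  show "integrable lborel (\<lambda>x :: real ^ 'n. \<Prod>i\<in>UNIV. inverse (1 + (x $ i)\<^sup>2))"
    using integrable_inverse_1_plus_square
    by (intro integral_prod_cart) (simp add: set_integrable_def einterval_eq_UNIV)
  have "wt x \<le> (\<Prod>i\<in>UNIV. inverse (1 + (x $ i)\<^sup>2))" for x :: "real ^ 'n"
  proof -
    have "1 + (x $ i)\<^sup>2 \<le> (1 + norm x)\<^sup>2" for i
    proof -
      have "\<bar>x $ i\<bar>\<^sup>2 \<le> (norm x)\<^sup>2" by (intro power_mono component_le_norm_cart) simp
      moreover have "(1 + norm x)\<^sup>2 = 1 + 2 * norm x + (norm x)\<^sup>2" by (simp add: power2_sum)
      ultimately show ?thesis using norm_ge_zero[of x] unfolding power2_abs by linarith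
    qed
    then have "(\<Prod>i\<in>UNIV. 1 + (x $ i)\<^sup>2) \<le> (\<Prod>i::'n\<in>UNIV. (1 + norm x)\<^sup>2)"
      by (intro prod_mono) simp
    also have "\<dots> = (1 + norm x) ^ (2 * CARD('n))" by (simp add: power_mult)
    finally have "inverse ((1 + norm x) ^ (2 * CARD('n))) \<le> inverse (\<Prod>i\<in>UNIV. 1 + (x $ i)\<^sup>2)"
      by (intro le_imp_inverse_le prod_pos) (simp_all add: add_pos_nonneg)
    then show ?thesis by (simp only: wt_def prod_inversef[unfolded o_def])
  qed
  note le = this
  show "AE x in lborel. norm (wt (x :: real ^ 'n)) \<le> norm (\<Prod>i\<in>UNIV. inverse (1 + (x $ i :: real)\<^sup>2))"
  proof (rule AE_I2)
    fix x :: "real ^ 'n"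
    have "norm (wt x) = wt x" using wt_pos[of x] by simp
    with le[of x]
    show "norm (wt x) \<le> norm (\<Prod>i\<in>UNIV. inverse (1 + (x $ i :: real)\<^sup>2))"
      by (simp only: real_norm_def)
  qed
qed simp

lemma le_inverse_mult: "0 < a \<Longrightarrow> 0 < b \<Longrightarrow> a \<le> c * b \<Longrightarrow> inverse b \<le> c * inverse (a :: real)"
  by (simp add: field_simps)

text \<open>Moving the argument by at most 1 at most doubles 1 + |x|. This dominates the difference
  quotients when differentiation and integration are compared.\<close>

lemma wt_shift_le:
  assumes "\<bar>s\<bar> \<le> 1"
  shows "wt ((x :: real ^ 'n::finite) + s *\<^sub>R axis i 1) \<le> 2 ^ (2 * CARD('n)) * wt x"
proof -
  let ?y = "x + s *\<^sub>R axis i 1"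
  have "norm x \<le> norm ?y + norm (s *\<^sub>R axis i 1 :: real ^ 'n)"
    using norm_triangle_ineq4[of ?y "s *\<^sub>R axis i 1"] by simp
  moreover have "norm (s *\<^sub>R axis i 1 :: real ^ 'n) \<le> 1" using assms by simp
  ultimately have "1 + norm x \<le> 2 * (1 + norm ?y)" using norm_ge_zero[of ?y] by argo
  then have "(1 + norm x) ^ (2 * CARD('n)) \<le> (2 * (1 + norm ?y)) ^ (2 * CARD('n))"
    by (intro power_mono) simp_all
  then have "(1 + norm x) ^ (2 * CARD('n)) \<le> 2 ^ (2 * CARD('n)) * (1 + norm ?y) ^ (2 * CARD('n))"
    unfolding power_mult_distrib[of 2 "1 + norm ?y"] .
  then show ?thesis
    unfolding wt_def by (intro le_inverse_mult zero_less_power add_pos_nonneg) simp_all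
qed

text \<open>Plays the part of a Schwartz class: just enough decay for absolute convergence of
  Fourier integrals and for Fubini.\<close>

definition wt_bounded :: "(real ^ 'n::finite \<Rightarrow> complex) \<Rightarrow> bool" where
  "wt_bounded f \<longleftrightarrow> continuous_on UNIV f \<and> (\<exists>K. \<forall>x. norm (f x) \<le> K * wt x)"

lemma wt_bounded_measurable: "wt_bounded f \<Longrightarrow> f \<in> borel_measurable borel"
  by (rule borel_measurable_continuous_onI) (simp add: wt_bounded_def)

lemma wt_boundedI: "continuous_on UNIV f \<Longrightarrow> (\<And>x. norm (f x) \<le> K * wt x) \<Longrightarrow> wt_bounded f"
  unfolding wt_bounded_def by blast

lemma wt_boundedE:
  fixes f :: "real ^ 'n::finite \<Rightarrow> complex"
  assumes "wt_bounded f"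
  obtains K where "K \<ge> 0" "\<And>x. norm (f x) \<le> K * wt x"
proof -
  from assms obtain K where K: "\<And>x. norm (f x) \<le> K * wt x" unfolding wt_bounded_def by blast
  have "0 \<le> K * wt (0 :: real ^ 'n)" using order_trans[OF norm_ge_zero K[of 0]] .
  then have "K \<ge> 0" using wt_pos[of "0 :: real ^ 'n"] by (simp add: zero_le_mult_iff not_le[symmetric])
  then show ?thesis using K by (rule that)
qed

lemma integrable_wt_dominated:
  fixes f :: "real ^ 'n::finite \<Rightarrow> complex"
  assumes "f \<in> borel_measurable borel" "\<And>x. norm (f x) \<le> K * wt x"
  shows "integrable lborel f"
proof (rule Bochner_Integration.integrable_bound)
  show "integrable lborel (\<lambda>x :: real ^ 'n. K * wt x)" by (simp add: integrable_wt)
  show "AE x in lborel. norm (f x) \<le> norm (K * wt x)"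
    using order_trans[OF assms(2) abs_ge_self] by (intro AE_I2) simp
qed (use assms(1) in simp)

lemma wt_bounded_integrable: "wt_bounded f \<Longrightarrow> integrable lborel f"
  by (metis integrable_wt_dominated wt_boundedE wt_bounded_measurable)

text \<open>Translation invariance makes the integral of each difference quotient 0. The mean value
  inequality and \<open>wt_shift_le\<close> bound the quotients by a fixed integrable function, so
  the limit may be taken under the integral.\<close>

lemma integral_partial_eq_0:
  fixes f :: "real ^ 'n::finite \<Rightarrow> complex"
  assumes f: "wt_bounded f" and f': "\<And>x. partial_eq i f x (f' x)" "wt_bounded f'"
  shows "(LINT x|lborel. f' x) = 0"
proof -
  obtain K where K: "K \<ge> 0" "\<And>x. norm (f' x) \<le> K * wt x" using wt_boundedE[OF f'(2)] by blast
  define t where "t k = inverse (real (Suc k))" for k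
  have t: "0 < t k" "t k \<le> 1" for k by (simp_all add: t_def inverse_le_1_iff)
  let ?d = "\<lambda>k x. (1 / t k) *\<^sub>R (f (x + t k *\<^sub>R axis i 1) - f x)"
  have fm[measurable]: "f \<in> borel_measurable borel" using f by (rule wt_bounded_measurable)
  have int0: "(LINT x|lborel. ?d k x) = 0" for k
  proof -
    have *: "lborel = distr lborel borel (\<lambda>x :: real ^ 'n. t k *\<^sub>R axis i 1 + x)"
      using lborel_distr_plus[of "t k *\<^sub>R axis i 1 :: real ^ 'n"] by simp
    have "(LINT x|lborel. f x) = (LINT x|lborel. f (t k *\<^sub>R axis i 1 + x))"
      by (subst *, subst integral_distr) simp_all
    moreover have "integrable lborel (\<lambda>x. f (t k *\<^sub>R axis i 1 + x))"
    proof -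
      have "integrable (distr lborel borel (\<lambda>x :: real ^ 'n. t k *\<^sub>R axis i 1 + x)) f"
        using wt_bounded_integrable[OF f] * by simp
      then show ?thesis by (subst (asm) integrable_distr_eq) simp_all
    qed
    ultimately show ?thesis
      using wt_bounded_integrable[OF f] by (simp add: add.commute)
  qed
  have "(\<lambda>k. LINT x|lborel. ?d k x) \<longlonglongrightarrow> (LINT x|lborel. f' x)"
  proof (rule integral_dominated_convergence)
    show "f' \<in> borel_measurable lborel" using wt_bounded_measurable[OF f'(2)] by simp
    show "integrable lborel (\<lambda>x :: real ^ 'n. K * (2 ^ (2 * CARD('n)) * wt x))"
      by (simp add: integrable_wt)
    show "AE x in lborel. (\<lambda>k. ?d k x) \<longlonglongrightarrow> f' x"
    proof (rule AE_I2)
      fix x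
      have "((\<lambda>s. (f (x + s *\<^sub>R axis i 1) - f x) /\<^sub>R s) \<longlongrightarrow> f' x) (at 0)"
      proof -
        have "((\<lambda>s. norm (f (x + s *\<^sub>R axis i 1) - f x - s *\<^sub>R f' x) / norm s) \<longlongrightarrow> 0) (at 0)"
          using f'(1)[of x] unfolding partial_eq_def has_vector_derivative_def has_derivative_at by simp
        moreover have "\<forall>\<^sub>F s in at (0::real). norm (f (x + s *\<^sub>R axis i 1) - f x - s *\<^sub>R f' x) / norm s =
            norm ((f (x + s *\<^sub>R axis i 1) - f x) /\<^sub>R s - f' x)"
        proof (rule eventually_mono[OF eventually_neq_at_within[of 0]])
          fix s :: real assume "s \<noteq> 0"
          then have "(f (x + s *\<^sub>R axis i 1) - f x) /\<^sub>R s - f' x =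
              (f (x + s *\<^sub>R axis i 1) - f x - s *\<^sub>R f' x) /\<^sub>R s"
            by (simp add: scaleR_right_diff_distrib)
          then show "norm (f (x + s *\<^sub>R axis i 1) - f x - s *\<^sub>R f' x) / norm s =
              norm ((f (x + s *\<^sub>R axis i 1) - f x) /\<^sub>R s - f' x)"
            by (simp add: divide_inverse mult.commute)
        qed
        ultimately have "((\<lambda>s. norm ((f (x + s *\<^sub>R axis i 1) - f x) /\<^sub>R s - f' x)) \<longlongrightarrow> 0) (at 0)"
          by (rule Lim_transform_eventually)
        then show ?thesis by (simp only: tendsto_norm_zero_iff LIM_zero_iff)
      qed
      moreover have "filterlim t (at 0) sequentially"
      proof -
        have "t = (\<lambda>k. inverse (real (Suc k)))" by (simp add: t_def fun_eq_iff)
        then have "t \<longlonglongrightarrow> 0" using LIMSEQ_inverse_real_of_nat by simp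
        moreover have "t k \<noteq> 0" for k using t(1)[of k] by simp
        ultimately show ?thesis unfolding filterlim_at by simp
      qed
      ultimately show "(\<lambda>k. ?d k x) \<longlonglongrightarrow> f' x"
        by (auto dest: filterlim_compose simp: divide_inverse)
    qed
    show "AE x in lborel. norm (?d k x) \<le> K * (2 ^ (2 * CARD('n)) * wt x)" for k
    proof (rule AE_I2)
      fix x :: "real ^ 'n"
      have "norm (f (x + t k *\<^sub>R axis i 1) - f (x + 0 *\<^sub>R axis i 1)) \<le>
          K * (2 ^ (2 * CARD('n)) * wt x) * norm (t k - 0)"
      proof (rule differentiable_bound[where S = "{0..1}" and f' = "\<lambda>s h. h *\<^sub>R f' (x + s *\<^sub>R axis i 1)"])
        fix s :: real assume s: "s \<in> {0..1}"
        show "((\<lambda>s. f (x + s *\<^sub>R axis i 1)) has_derivative (\<lambda>h. h *\<^sub>R f' (x + s *\<^sub>R axis i 1))) (at s within {0..1})"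
          using partial_eq_shift[OF f'(1), of x s] has_derivative_at_withinI
          unfolding has_vector_derivative_def by blast
        have "norm (f' (x + s *\<^sub>R axis i 1)) \<le> K * wt (x + s *\<^sub>R axis i 1)" by (rule K)
        also have "\<dots> \<le> K * (2 ^ (2 * CARD('n)) * wt x)"
          using s K(1) by (intro mult_left_mono wt_shift_le) auto
        finally show "onorm (\<lambda>h. h *\<^sub>R f' (x + s *\<^sub>R axis i 1)) \<le> K * (2 ^ (2 * CARD('n)) * wt x)"
          by (intro onorm_le) (simp add: mult.commute mult_left_mono)
      qed (use t[of k] in auto)
      then have "norm (f (x + t k *\<^sub>R axis i 1) - f x) \<le> K * (2 ^ (2 * CARD('n)) * wt x) * t k"
        using t[of k] by simp
      moreover have "norm (?d k x) = norm (f (x + t k *\<^sub>R axis i 1) - f x) / t k"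
        unfolding norm_scaleR using t(1)[of k] by simp
      ultimately show "norm (?d k x) \<le> K * (2 ^ (2 * CARD('n)) * wt x)"
        using t(1)[of k] by (simp only: pos_divide_le_eq)
    qed
  qed simp
  then show ?thesis by (simp only: int0 LIMSEQ_const_iff)
qed

text \<open>The Fourier kernel centred at p, so that differentiating in \<xi> produces x - p and not
  x.\<close>

definition wave :: "real ^ 'n::finite \<Rightarrow> real ^ 'n \<Rightarrow> real ^ 'n \<Rightarrow> complex" where
  "wave p \<xi> x = cis (- (\<xi> \<bullet> (x - p)))"

lemma norm_wave: "norm (wave p \<xi> x) = 1"
  by (simp add: wave_def)

lemma partial_eq_wave_space: "partial_eq i (wave p \<xi>) x (- \<i> * of_real (\<xi> $ i) * wave p \<xi> x)"
proof -
  have "((\<lambda>t. cis (- (\<xi> \<bullet> (x - p) + t * (\<xi> $ i)))) has_vector_derivative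
      (- (\<xi> $ i)) *\<^sub>R (\<i> * cis (- (\<xi> \<bullet> (x - p) + 0 * (\<xi> $ i))))) (at 0)"
  proof (rule vector_diff_chain_at[unfolded o_def, where f = "\<lambda>t. - (\<xi> \<bullet> (x - p) + t * (\<xi> $ i))"])
    show "((\<lambda>t. - (\<xi> \<bullet> (x - p) + t * (\<xi> $ i))) has_vector_derivative - (\<xi> $ i)) (at 0)"
      unfolding has_real_derivative_iff_has_vector_derivative[symmetric] by (auto intro!: derivative_eq_intros)
    have "((\<lambda>z. exp (\<i> * z)) has_field_derivative \<i> * exp (\<i> * of_real s)) (at (of_real s))" for s
      by (auto intro!: derivative_eq_intros)
    from has_vector_derivative_real_field[OF this]
    show "(cis has_vector_derivative \<i> * cis s) (at s)" for s
      by (simp add: cis_conv_exp[abs_def])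
  qed
  moreover have "\<xi> \<bullet> (x + t *\<^sub>R axis i 1 - p) = \<xi> \<bullet> (x - p) + t * (\<xi> $ i)" for t
    by (simp add: inner_diff_right inner_add_right inner_axis)
  ultimately show ?thesis
    unfolding partial_eq_def wave_def by (simp add: scaleR_conv_of_real mult.assoc mult.left_commute)
qed

lemma partial_eq_wave_freq: "partial_eq i (\<lambda>\<xi>. wave p \<xi> x) \<xi> (- \<i> * of_real (x $ i - p $ i) * wave p \<xi> x)"
proof -
  have "wave p \<xi> x = wave 0 (x - p) \<xi>" for \<xi>
    by (simp add: wave_def inner_commute)
  with partial_eq_wave_space[of i 0 "x - p" \<xi>] show ?thesis by simp
qed

lemma continuous_on_wave: "continuous_on UNIV (wave p \<xi>)" "continuous_on UNIV (\<lambda>\<xi>. wave p \<xi> x)"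
  unfolding wave_def by (intro continuous_intros)+

lemma wave_measurable[measurable]:
  "(\<lambda>z. wave p (fst z) (snd z)) \<in> borel_measurable (borel \<Otimes>\<^sub>M borel)"
  "(\<lambda>z. wave p (snd z) (fst z)) \<in> borel_measurable (borel \<Otimes>\<^sub>M borel)"
  unfolding borel_prod wave_def by (intro borel_measurable_continuous_onI continuous_intros)+

definition FT :: "real ^ 'n::finite \<Rightarrow> (real ^ 'n \<Rightarrow> complex) \<Rightarrow> real ^ 'n \<Rightarrow> complex" where
  "FT p b x = (LINT \<xi>|lborel. b \<xi> * wave p \<xi> x)"

lemma wt_bounded_mult:
  assumes "wt_bounded b" "continuous_on UNIV h" "\<And>x. norm (h x) \<le> C"
  shows "wt_bounded (\<lambda>x. b x * h x)"
proof -
  obtain K where K: "K \<ge> 0" "\<And>x. norm (b x) \<le> K * wt x" using wt_boundedE[OF assms(1)] by blast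
  show ?thesis
  proof (rule wt_boundedI)
    show "continuous_on UNIV (\<lambda>x. b x * h x)"
      using assms unfolding wt_bounded_def by (intro continuous_intros) auto
    show "norm (b x * h x) \<le> (K * C) * wt x" for x
    proof -
      have "norm (b x) * norm (h x) \<le> (K * wt x) * C"
        using K(1) wt_pos[of x] by (intro mult_mono K assms(3)) simp_all
      then show ?thesis by (simp add: norm_mult mult_ac)
    qed
  qed
qed

lemma wt_bounded_add:
  assumes "wt_bounded b" "wt_bounded c"
  shows "wt_bounded (\<lambda>x. b x + c x)"
proof -
  obtain K where K: "\<And>x. norm (b x) \<le> K * wt x" using wt_boundedE[OF assms(1)] by blast
  obtain L where L: "\<And>x. norm (c x) \<le> L * wt x" using wt_boundedE[OF assms(2)] by blast
  show ?thesis
  proof (rule wt_boundedI)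
    show "continuous_on UNIV (\<lambda>x. b x + c x)"
      using assms unfolding wt_bounded_def by (intro continuous_on_add) simp_all
    show "norm (b x + c x) \<le> (K + L) * wt x" for x
      unfolding distrib_right by (rule norm_triangle_le[OF add_mono[OF K L]])
  qed
qed

lemma wt_bounded_wave: "wt_bounded b \<Longrightarrow> wt_bounded (\<lambda>\<xi>. b \<xi> * wave p \<xi> x)"
  by (rule wt_bounded_mult[where C = 1]) (simp_all add: continuous_on_wave norm_wave)

lemma FT_bound:
  fixes b :: "real ^ 'n::finite \<Rightarrow> complex"
  assumes "wt_bounded b" "\<And>\<xi>. norm (b \<xi>) \<le> K * wt \<xi>"
  shows "norm (FT p b x) \<le> K * (LINT \<xi>|lborel. wt (\<xi> :: real ^ 'n))"
proof -
  have "norm (FT p b x) \<le> (LINT \<xi>|lborel. norm (b \<xi> * wave p \<xi> x))"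
    unfolding FT_def by (rule integral_norm_bound)
  also have "\<dots> \<le> (LINT \<xi>|lborel. K * wt (\<xi> :: real ^ 'n))"
  proof (rule Bochner_Integration.integral_mono)
    show "integrable lborel (\<lambda>\<xi>. norm (b \<xi> * wave p \<xi> x))"
      by (rule integrable_norm[OF wt_bounded_integrable[OF wt_bounded_wave[OF assms(1)]]])
    show "integrable lborel (\<lambda>\<xi> :: real ^ 'n. K * wt \<xi>)" by (simp add: integrable_wt)
  qed (simp add: norm_mult norm_wave assms(2))
  finally show ?thesis by simp
qed

text \<open>Integration by parts in frequency: the \<xi>_i-derivative of
  \<open>b \<xi> * wave p \<xi> x\<close> has integral 0, and the derivative of the wave is -\<i>
  (x_i - p_i) times the wave.\<close>

lemma FT_coord:
  assumes "wt_bounded b" "wt_bounded b'" "\<And>\<xi>. partial_eq i b \<xi> (b' \<xi>)"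
  shows "of_real (x $ i - p $ i) * FT p b x = FT p (\<lambda>\<xi>. - \<i> * b' \<xi>) x"
proof -
  let ?c = "- \<i> * of_real (x $ i - p $ i) :: complex"
  note int = wt_bounded_integrable[OF wt_bounded_wave[OF assms(1)]] wt_bounded_integrable[OF wt_bounded_wave[OF assms(2)]]
  have "(LINT \<xi>|lborel. b' \<xi> * wave p \<xi> x + b \<xi> * wave p \<xi> x * ?c) = 0"
  proof (rule integral_partial_eq_0[OF wt_bounded_wave[OF assms(1)]])
    show "partial_eq i (\<lambda>\<xi>. b \<xi> * wave p \<xi> x) \<xi> (b' \<xi> * wave p \<xi> x + b \<xi> * wave p \<xi> x * ?c)" for \<xi>
      using partial_eq_mult[OF assms(3)[of \<xi>] partial_eq_wave_freq[of i p x \<xi>]] by (simp add: mult_ac)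
    show "wt_bounded (\<lambda>\<xi>. b' \<xi> * wave p \<xi> x + b \<xi> * wave p \<xi> x * ?c)"
      using assms(1,2) by (intro wt_bounded_add wt_bounded_wave wt_bounded_mult[where h = "\<lambda>_. ?c" and C = "norm ?c"])
        (simp_all add: continuous_on_const)
  qed
  then have eq1: "FT p b' x + FT p b x * ?c = 0"
    unfolding FT_def using int by (subst (asm) Bochner_Integration.integral_add) simp_all
  have eq2: "FT p (\<lambda>\<xi>. - \<i> * b' \<xi>) x = - \<i> * FT p b' x"
    unfolding FT_def mult.assoc by (rule integral_mult_right_zero)
  have "- \<i> * A = of_real r * B" if "A + B * (- \<i> * of_real r) = 0" for A B and r :: real
  proof -
    have "A = \<i> * of_real r * B" using that by (simp add: add_eq_0_iff mult_ac)
    then show ?thesis by (simp add: complex_eq_iff)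
  qed
  from this[OF eq1] show ?thesis unfolding eq2 by (rule sym)
qed

text \<open>The action of the kernel with symbol b on a test function f. It is bilinear, without
  conjugation, since it is the transpose of L that will act on the symbol.\<close>

definition pairing :: "real ^ 'n::finite \<Rightarrow> (real ^ 'n \<Rightarrow> complex) \<Rightarrow> (real ^ 'n \<Rightarrow> complex) \<Rightarrow> complex" where
  "pairing p b f = (LINT x|lborel. f x * FT p b x)"

lemma FT_measurable:
  assumes "wt_bounded b"
  shows "FT p b \<in> borel_measurable borel"
proof -
  have [measurable]: "b \<in> borel_measurable borel" using assms by (rule wt_bounded_measurable)
  have "(\<lambda>z. b (snd z) * wave p (snd z) (fst z)) \<in> borel_measurable (borel \<Otimes>\<^sub>M lborel)"
    by measurable
  then have "(\<lambda>x. LINT \<xi>|lborel. b \<xi> * wave p \<xi> x) \<in> borel_measurable borel"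
    by (intro lborel.borel_measurable_lebesgue_integral) (simp add: case_prod_unfold)
  then show ?thesis unfolding FT_def .
qed

text \<open>Fubini transfers the Fourier integral to f, so that integration by parts in x can be
  carried out without differentiating \<open>FT p b\<close>.\<close>

lemma pairing_swap:
  assumes "wt_bounded b" "wt_bounded f"
  shows "pairing p b f = (LINT \<xi>|lborel. b \<xi> * (LINT x|lborel. f x * wave p \<xi> x))"
proof -
  have [measurable]: "b \<in> borel_measurable borel" "f \<in> borel_measurable borel"
    using assms by (auto intro: wt_bounded_measurable)
  have "integrable (lborel \<Otimes>\<^sub>M lborel) (\<lambda>(x, \<xi>). f x * (b \<xi> * wave p \<xi> x))"
  proof (rule lborel_pair.Fubini_integrable)
    show "(\<lambda>(x, \<xi>). f x * (b \<xi> * wave p \<xi> x)) \<in> borel_measurable (lborel \<Otimes>\<^sub>M lborel)"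
      by (simp add: case_prod_unfold)
    show "integrable lborel (\<lambda>x. LINT \<xi>|lborel. norm (case (x, \<xi>) of (x, \<xi>) \<Rightarrow> f x * (b \<xi> * wave p \<xi> x)))"
      using wt_bounded_integrable[OF assms(2)] by (simp add: norm_mult norm_wave)
    show "AE x in lborel. integrable lborel (\<lambda>\<xi>. case (x, \<xi>) of (x, \<xi>) \<Rightarrow> f x * (b \<xi> * wave p \<xi> x))"
      using wt_bounded_integrable[OF wt_bounded_wave[OF assms(1)]] by (intro AE_I2) simp
  qed
  then have "(LINT x|lborel. LINT \<xi>|lborel. f x * (b \<xi> * wave p \<xi> x)) =
      (LINT \<xi>|lborel. LINT x|lborel. f x * (b \<xi> * wave p \<xi> x))"
    by (rule lborel_pair.Fubini_integral[symmetric])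
  moreover have "(LINT x|lborel. f x * (b \<xi> * wave p \<xi> x)) = b \<xi> * (LINT x|lborel. f x * wave p \<xi> x)" for \<xi>
  proof -
    have "(\<lambda>x. f x * (b \<xi> * wave p \<xi> x)) = (\<lambda>x. b \<xi> * (f x * wave p \<xi> x))" by (simp add: mult_ac)
    then show ?thesis by simp
  qed
  ultimately show ?thesis unfolding pairing_def FT_def by simp
qed

text \<open>Integrating by parts against the wave, whose x_i-derivative has the factor -\<i>
  \<xi>_i, replaces a derivative of f by the factor +\<i> \<xi>_i on the symbol.\<close>

lemma pairing_partial:
  assumes b: "wt_bounded b" "wt_bounded (\<lambda>\<xi>. \<i> * of_real (\<xi> $ i) * b \<xi>)"
    and f: "wt_bounded f" "wt_bounded f'" "\<And>x. partial_eq i f x (f' x)"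
  shows "pairing p b f' = pairing p (\<lambda>\<xi>. \<i> * of_real (\<xi> $ i) * b \<xi>) f"
proof -
  have fw: "wt_bounded (\<lambda>x. g x * wave p \<xi> x)" if "wt_bounded g" for g \<xi>
    using that by (rule wt_bounded_mult[where C = 1]) (simp_all add: continuous_on_wave norm_wave)
  have "(LINT x|lborel. f' x * wave p \<xi> x) = \<i> * of_real (\<xi> $ i) * (LINT x|lborel. f x * wave p \<xi> x)" for \<xi>
  proof -
    let ?c = "- \<i> * of_real (\<xi> $ i) :: complex"
    have "(LINT x|lborel. f' x * wave p \<xi> x + f x * wave p \<xi> x * ?c) = 0"
    proof (rule integral_partial_eq_0[OF fw[OF f(1)]])
      show "partial_eq i (\<lambda>x. f x * wave p \<xi> x) x (f' x * wave p \<xi> x + f x * wave p \<xi> x * ?c)" for x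
        using partial_eq_mult[OF f(3)[of x] partial_eq_wave_space[of i p \<xi> x]] by (simp add: mult_ac)
      show "wt_bounded (\<lambda>x. f' x * wave p \<xi> x + f x * wave p \<xi> x * ?c)"
        using f by (intro wt_bounded_add fw wt_bounded_mult[where h = "\<lambda>_. ?c" and C = "norm ?c"])
          (simp_all add: continuous_on_const)
    qed
    then have "(LINT x|lborel. f' x * wave p \<xi> x) + (LINT x|lborel. f x * wave p \<xi> x) * ?c = 0"
      using wt_bounded_integrable[OF fw[OF f(1)]] wt_bounded_integrable[OF fw[OF f(2)]]
      by (subst (asm) Bochner_Integration.integral_add) simp_all
    then show ?thesis by (simp add: add_eq_0_iff mult_ac)
  qed
  note eq = this
  show ?thesis
    unfolding pairing_swap[OF b(1) f(2)] pairing_swap[OF b(2) f(1)] eq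
    by (rule Bochner_Integration.integral_cong) simp_all
qed

section \<open>Gaussian approximation of the delta distribution\<close>

text \<open>A function of frequency: as t tends to 0 it tends to the constant symbol 1, whose kernel
  is (2 \<pi>)^n times the point mass at p.\<close>

definition gauss :: "real \<Rightarrow> real ^ 'n::finite \<Rightarrow> real" where
  "gauss t \<xi> = exp (- (t * norm \<xi>)\<^sup>2 / 2)"

lemma gauss_pos: "gauss t \<xi> > 0"
  by (simp add: gauss_def)

lemma continuous_on_gauss: "continuous_on U (gauss t)"
  unfolding gauss_def by (intro continuous_intros) simp

lemma gauss_prod: "gauss t \<xi> = (\<Prod>i\<in>UNIV. exp (- (t * \<xi> $ i)\<^sup>2 / 2))"
proof -
  have "(t * norm \<xi>)\<^sup>2 = (\<Sum>i\<in>UNIV. (t * \<xi> $ i)\<^sup>2)"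
    by (simp add: norm_vec_def L2_set_def power_mult_distrib sum_nonneg sum_distrib_left)
  then have "- (t * norm \<xi>)\<^sup>2 / 2 = (\<Sum>i\<in>UNIV. - (t * \<xi> $ i)\<^sup>2 / 2)"
    by (simp add: sum_negf sum_divide_distrib)
  then show ?thesis unfolding gauss_def by (simp add: exp_sum)
qed

lemma integrable_exp_minus_square: "integrable lborel (\<lambda>s::real. exp (- s\<^sup>2 / 2))"
proof -
  have "integrable lborel (\<lambda>s. sqrt (2 * pi) * std_normal_density s)"
    using integrable_std_normal_moment[of 0] by (intro integrable_mult_right) simp
  then show ?thesis by (simp add: std_normal_density_def)
qed

text \<open>The integral is the characteristic function of the standard normal distribution at -y,
  with the normalising factor sqrt (2 \<pi>) removed.\<close>

lemma fourier_exp_minus_square: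
  "(LINT s|lborel. complex_of_real (exp (- s\<^sup>2 / 2)) * cis (- (s * y))) =
    complex_of_real (sqrt (2 * pi) * exp (- y\<^sup>2 / 2))"
proof -
  have "char std_normal_distribution (- y) = (LINT s|lborel. std_normal_density s *\<^sub>R iexp (- y * s))"
    unfolding char_def by (rule integral_density) (simp_all add: normal_density_nonneg)
  then have "(LINT s|lborel. std_normal_density s *\<^sub>R iexp (- y * s)) = complex_of_real (exp (- y\<^sup>2 / 2))"
    by (simp add: char_std_normal_distribution)
  then have "(LINT s|lborel. complex_of_real (sqrt (2 * pi)) * (std_normal_density s *\<^sub>R iexp (- y * s))) =
      complex_of_real (sqrt (2 * pi) * exp (- y\<^sup>2 / 2))"
    by (simp only: integral_mult_right_zero of_real_mult)
  moreover have "complex_of_real (sqrt (2 * pi)) * (std_normal_density s *\<^sub>R iexp (- y * s)) =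
      complex_of_real (exp (- s\<^sup>2 / 2)) * cis (- (s * y))" for s
    by (simp add: std_normal_density_def scaleR_conv_of_real cis_conv_exp mult.commute)
  ultimately show ?thesis by simp
qed

lemma FT_gauss_1:
  "FT (0 :: real ^ 'n::finite) (\<lambda>\<xi>. complex_of_real (gauss 1 \<xi>)) y =
    complex_of_real (sqrt (2 * pi) ^ CARD('n) * gauss 1 y)"
proof -
  have "complex_of_real (gauss 1 \<xi>) * wave 0 \<xi> y =
      (\<Prod>i\<in>UNIV. complex_of_real (exp (- (\<xi> $ i)\<^sup>2 / 2)) * cis (- (\<xi> $ i * y $ i)))" for \<xi>
  proof -
    have "(\<Prod>i\<in>UNIV. cis (- (\<xi> $ i * y $ i))) = cis (- (\<xi> \<bullet> y))"
      by (simp add: cis_conv_exp exp_sum[symmetric] inner_vec_def sum_negf sum_distrib_left[symmetric])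
    then show ?thesis by (simp add: gauss_prod wave_def prod.distrib)
  qed
  then have "FT 0 (\<lambda>\<xi>. complex_of_real (gauss 1 \<xi>)) y =
      (\<Prod>i\<in>UNIV. LINT s|lborel. complex_of_real (exp (- s\<^sup>2 / 2)) * cis (- (s * y $ i)))"
    unfolding FT_def
  proof (simp only:, intro integral_prod_cart(2))
    fix i
    show "integrable lborel (\<lambda>s. complex_of_real (exp (- s\<^sup>2 / 2)) * cis (- (s * y $ i)))"
      by (rule Bochner_Integration.integrable_bound[OF integrable_exp_minus_square])
        (auto simp: norm_mult intro!: borel_measurable_continuous_onI continuous_intros)
  qed
  also have "\<dots> = complex_of_real (sqrt (2 * pi) ^ CARD('n) * gauss 1 y)"
    by (simp only: fourier_exp_minus_square) (simp add: gauss_prod prod.distrib)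
  finally show ?thesis .
qed

lemma integrable_gauss_1: "integrable lborel (gauss 1 :: real ^ 'n::finite \<Rightarrow> real)"
  and integral_gauss_1: "(LINT x|lborel. gauss 1 (x :: real ^ 'n::finite)) = sqrt (2 * pi) ^ CARD('n)"
proof -
  have eq: "gauss 1 = (\<lambda>x :: real ^ 'n. \<Prod>i\<in>UNIV. exp (- (x $ i)\<^sup>2 / 2))"
    by (simp add: fun_eq_iff gauss_prod)
  show "integrable lborel (gauss 1 :: real ^ 'n \<Rightarrow> real)"
    unfolding eq by (rule integral_prod_cart) (rule integrable_exp_minus_square)
  have "complex_of_real (LINT s|lborel. exp (- s\<^sup>2 / 2)) = complex_of_real (sqrt (2 * pi))"
    using fourier_exp_minus_square[of 0] by simp
  then have "(LINT s|lborel. exp (- s\<^sup>2 / 2)) = sqrt (2 * pi)" by (simp only: of_real_eq_iff)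
  then show "(LINT x|lborel. gauss 1 (x :: real ^ 'n::finite)) = sqrt (2 * pi) ^ CARD('n)"
    using integral_prod_cart(2)[where 'n = 'n and f = "\<lambda>i s. exp (- s\<^sup>2 / 2)", OF integrable_exp_minus_square]
    unfolding eq by simp
qed

lemma lborel_integral_affine:
  fixes f :: "real ^ 'n::finite \<Rightarrow> complex"
  assumes "f \<in> borel_measurable borel" "c > 0"
  shows "(LINT x|lborel. f x) = (c ^ CARD('n)) *\<^sub>R (LINT x|lborel. f (a + c *\<^sub>R x))"
proof -
  have m: "(\<lambda>x :: real ^ 'n. a + c *\<^sub>R x) \<in> measurable lborel borel" by simp
  have "(LINT x|lborel. f x) = integral\<^sup>L (density (distr lborel borel (\<lambda>x. a + c *\<^sub>R x)) (\<lambda>_. ennreal (\<bar>c\<bar> ^ DIM(real ^ 'n)))) f"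
    using lborel_affine[of c a] assms(2) by simp
  also have "\<dots> = integral\<^sup>L (distr lborel borel (\<lambda>x. a + c *\<^sub>R x)) (\<lambda>x. (\<bar>c\<bar> ^ DIM(real ^ 'n)) *\<^sub>R f x)"
    using assms by (intro integral_density) simp_all
  also have "\<dots> = (LINT x|lborel. (\<bar>c\<bar> ^ DIM(real ^ 'n)) *\<^sub>R f (a + c *\<^sub>R x))"
    using assms by (intro integral_distr m) simp
  finally show ?thesis using assms(2) by simp
qed

text \<open>The substitution of t \<xi> for \<xi> shows that the kernel of \<open>gauss t\<close> is
  the one of \<open>gauss 1\<close> concentrated at scale t around p.\<close>

lemma FT_gauss_scale:
  assumes "t > 0"
  shows "(t ^ CARD('n)) *\<^sub>R FT p (\<lambda>\<xi>. complex_of_real (gauss t \<xi>)) (p + t *\<^sub>R y) =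
    FT (0 :: real ^ 'n::finite) (\<lambda>\<xi>. complex_of_real (gauss 1 \<xi>)) y"
proof -
  have m: "(\<lambda>\<eta>. complex_of_real (gauss 1 \<eta>) * wave 0 \<eta> y) \<in> borel_measurable borel"
    by (intro borel_measurable_continuous_onI continuous_intros continuous_on_gauss continuous_on_wave)
  have "FT 0 (\<lambda>\<xi>. complex_of_real (gauss 1 \<xi>)) y =
      (t ^ CARD('n)) *\<^sub>R (LINT \<xi>|lborel. complex_of_real (gauss 1 (0 + t *\<^sub>R \<xi>)) * wave 0 (0 + t *\<^sub>R \<xi>) y)"
    unfolding FT_def by (rule lborel_integral_affine[OF m assms])
  moreover have "gauss 1 (0 + t *\<^sub>R \<xi>) = gauss t \<xi>" for \<xi> :: "real ^ 'n"
    using assms by (simp add: gauss_def)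
  moreover have "wave 0 (0 + t *\<^sub>R \<xi>) y = wave p \<xi> (p + t *\<^sub>R y)" for \<xi>
    by (simp add: wave_def)
  ultimately show ?thesis unfolding FT_def by simp
qed

text \<open>After the substitution x = p + t y the kernel no longer depends on t, and dominated
  convergence applies since h is bounded and continuous. The factor (2 \<pi>)^n collects sqrt (2
  \<pi>)^n twice: from the transform of the Gaussian and from its integral.\<close>

lemma pairing_gauss_tendsto:
  fixes h :: "real ^ 'n::finite \<Rightarrow> complex"
  assumes "wt_bounded h" and t: "\<And>k. t k > 0" "t \<longlonglongrightarrow> 0"
    and gauss: "\<And>k. wt_bounded (\<lambda>\<xi> :: real ^ 'n. complex_of_real (gauss (t k) \<xi>))"
  shows "(\<lambda>k. pairing p (\<lambda>\<xi>. complex_of_real (gauss (t k) \<xi>)) h) \<longlonglongrightarrow> complex_of_real ((2 * pi) ^ CARD('n)) * h p"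
proof -
  let ?c = "sqrt (2 * pi) ^ CARD('n)"
  have [measurable]: "h \<in> borel_measurable borel" using assms(1) by (rule wt_bounded_measurable)
  have gm[measurable]: "(gauss 1 :: real ^ 'n \<Rightarrow> real) \<in> borel_measurable borel"
    by (rule borel_measurable_continuous_onI) (rule continuous_on_gauss)
  have eq: "pairing p (\<lambda>\<xi>. complex_of_real (gauss (t k) \<xi>)) h =
      (LINT y|lborel. h (p + t k *\<^sub>R y) * complex_of_real (?c * gauss 1 y))" for k
  proof -
    have "(\<lambda>x. h x * FT p (\<lambda>\<xi>. complex_of_real (gauss (t k) \<xi>)) x) \<in> borel_measurable borel"
      using FT_measurable[OF gauss, of p k] by simp
    from lborel_integral_affine[OF this t(1)[of k], of p]
    have "pairing p (\<lambda>\<xi>. complex_of_real (gauss (t k) \<xi>)) h =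
        (LINT y|lborel. (t k ^ CARD('n)) *\<^sub>R (h (p + t k *\<^sub>R y) * FT p (\<lambda>\<xi>. complex_of_real (gauss (t k) \<xi>)) (p + t k *\<^sub>R y)))"
      by (simp add: pairing_def)
    also have "\<dots> = (LINT y|lborel. h (p + t k *\<^sub>R y) * FT 0 (\<lambda>\<xi>. complex_of_real (gauss 1 \<xi>)) y)"
      by (simp only: mult_scaleR_right[symmetric] FT_gauss_scale[OF t(1)])
    finally show ?thesis by (simp only: FT_gauss_1)
  qed
  obtain K where K: "K \<ge> 0" "\<And>x. norm (h x) \<le> K * wt x" using wt_boundedE[OF assms(1)] by blast
  have hK: "norm (h x) \<le> K" for x
  proof -
    have "wt x \<le> 1" by (simp add: wt_def inverse_le_1_iff one_le_power)
    then have "K * wt x \<le> K * 1" using K(1) by (rule mult_left_mono)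
    then show ?thesis using K(2)[of x] by simp
  qed
  have "(\<lambda>k. LINT y|lborel. h (p + t k *\<^sub>R y) * complex_of_real (?c * gauss 1 y)) \<longlonglongrightarrow>
      (LINT y|lborel. h p * complex_of_real (?c * gauss 1 (y :: real ^ 'n)))"
  proof (rule integral_dominated_convergence)
    show "integrable lborel (\<lambda>y :: real ^ 'n. K * (?c * gauss 1 y))"
      by (simp add: integrable_gauss_1)
    show "AE y in lborel. (\<lambda>k. h (p + t k *\<^sub>R y) * complex_of_real (?c * gauss 1 y)) \<longlonglongrightarrow> h p * complex_of_real (?c * gauss 1 y)"
    proof (rule AE_I2)
      fix y :: "real ^ 'n"
      have "isCont h p" using assms(1) by (simp add: wt_bounded_def continuous_on_eq_continuous_at)
      moreover have "(\<lambda>k. p + t k *\<^sub>R y) \<longlonglongrightarrow> p"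
        using tendsto_add[OF tendsto_const[of p] tendsto_scaleR[OF t(2) tendsto_const[of y]]] by simp
      ultimately have "(\<lambda>k. h (p + t k *\<^sub>R y)) \<longlonglongrightarrow> h p" by (rule isCont_tendsto_compose)
      then show "(\<lambda>k. h (p + t k *\<^sub>R y) * complex_of_real (?c * gauss 1 y)) \<longlonglongrightarrow> h p * complex_of_real (?c * gauss 1 y)"
        by (rule tendsto_mult[OF _ tendsto_const])
    qed
    show "AE y in lborel. norm (h (p + t k *\<^sub>R y) * complex_of_real (?c * gauss 1 y)) \<le> K * (?c * gauss 1 y)" for k
    proof (rule AE_I2)
      fix y :: "real ^ 'n"
      have "norm (complex_of_real (?c * gauss 1 y)) = ?c * gauss 1 y"
        unfolding norm_of_real using gauss_pos[of 1 y] by (simp add: abs_mult)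
      then show "norm (h (p + t k *\<^sub>R y) * complex_of_real (?c * gauss 1 y)) \<le> K * (?c * gauss 1 y)"
        unfolding norm_mult using gauss_pos[of 1 y] by (simp only:) (intro mult_right_mono hK, simp)
    qed
  qed simp_all
  moreover have "(LINT y|lborel. h p * complex_of_real (?c * gauss 1 (y :: real ^ 'n))) = complex_of_real ((2 * pi) ^ CARD('n)) * h p"
  proof -
    have "(LINT y|lborel. h p * complex_of_real (?c * gauss 1 (y :: real ^ 'n))) = h p * complex_of_real (LINT y|lborel. ?c * gauss 1 (y :: real ^ 'n))"
      by (simp only: integral_mult_right_zero integral_complex_of_real)
    also have "(LINT y|lborel. ?c * gauss 1 (y :: real ^ 'n)) = ?c * ?c"
      by (simp add: integral_gauss_1)
    also have "?c * ?c = (2 * pi) ^ CARD('n)" by (simp only: power_mult_distrib[symmetric] real_sqrt_mult_self) simp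
    finally show ?thesis by (simp only: mult.commute)
  qed
  ultimately show ?thesis by (simp only: eq)
qed

section \<open>Symbols and the parametrix\<close>

text \<open>
  Symbols of order \<open>s\<close>, generated by the base symbols in \<open>B\<close>. The parameter \<open>t \<in> (0, 1]\<close> is the width of the
  Gaussian regularisation \<open>gauss t\<close>, whose derivatives produce factors \<open>t\<^sup>2 \<xi>\<^sub>i\<close>. Since \<open>t\<^sup>2 gauss t \<xi>\<close> is bounded by
  a multiple of \<open>(1 + |\<xi>|)\<^sup>-\<^sup>2\<close> uniformly in \<open>t\<close>, the factor \<open>t\<^sup>2\<close> counts as a symbol of order \<open>-2\<close>; this makes
  differentiation lower the order by one even after regularisation.
\<close>

inductive symbol :: "(int \<times> (real ^ 'n::finite \<Rightarrow> complex)) set \<Rightarrow> int \<Rightarrow> (real \<Rightarrow> real ^ 'n \<Rightarrow> complex) \<Rightarrow> bool"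
  for B where
  base: "(s, f) \<in> B \<Longrightarrow> symbol B s (\<lambda>t. f)"
| zero: "symbol B s (\<lambda>t \<xi>. 0)"
| const: "symbol B 0 (\<lambda>t \<xi>. c)"
| coord: "symbol B 1 (\<lambda>t \<xi>. complex_of_real (\<xi> $ i))"
| square: "symbol B (- 2) (\<lambda>t \<xi>. complex_of_real (t\<^sup>2))"
| add: "symbol B s a \<Longrightarrow> symbol B s b \<Longrightarrow> symbol B s (\<lambda>t \<xi>. a t \<xi> + b t \<xi>)"
| mult: "symbol B r a \<Longrightarrow> symbol B s b \<Longrightarrow> symbol B (r + s) (\<lambda>t \<xi>. a t \<xi> * b t \<xi>)"
| weaken: "symbol B r a \<Longrightarrow> r \<le> s \<Longrightarrow> symbol B s a"

lemma symbol_mono: "symbol A s a \<Longrightarrow> A \<subseteq> B \<Longrightarrow> symbol B s a"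
  by (induction rule: symbol.induct) (auto intro: symbol.intros simp del: of_real_power)

lemma symbol_mult_le: "symbol B r a \<Longrightarrow> symbol B s b \<Longrightarrow> r + s \<le> q \<Longrightarrow> symbol B q (\<lambda>t \<xi>. a t \<xi> * b t \<xi>)"
  by (rule symbol.weaken[OF symbol.mult])

lemma symbol_cmult:
  assumes "symbol B s a"
  shows "symbol B s (\<lambda>t \<xi>. c * a t \<xi>)"
  using symbol.mult[OF symbol.const[of B c] assms] by simp

lemma symbol_sum: "(\<And>j. j \<in> A \<Longrightarrow> symbol B s (a j)) \<Longrightarrow> symbol B s (\<lambda>t \<xi>. \<Sum>j\<in>A. a j t \<xi>)"
  by (induction A rule: infinite_finite_induct) (simp_all add: symbol.zero symbol.add)

lemma symbol_power: "symbol B s a \<Longrightarrow> symbol B (int k * s) (\<lambda>t \<xi>. a t \<xi> ^ k)"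
proof (induction k)
  case (Suc k)
  from symbol.mult[OF Suc.prems Suc.IH[OF Suc.prems]] show ?case by (simp add: algebra_simps)
qed (simp add: symbol.const)

lemma symbol_prod:
  "finite A \<Longrightarrow> (\<And>j. j \<in> A \<Longrightarrow> symbol B (s j) (a j)) \<Longrightarrow> symbol B (\<Sum>j\<in>A. s j) (\<lambda>t \<xi>. \<Prod>j\<in>A. a j t \<xi>)"
  by (induction A rule: finite_induct) (simp_all add: symbol.const symbol.mult)

section \<open>Estimates for symbols\<close>

definition japanese :: "real ^ 'n::finite \<Rightarrow> real" where
  "japanese \<xi> = 1 + norm \<xi>"

lemma japanese_ge_1: "japanese \<xi> \<ge> 1"
  by (simp add: japanese_def)

lemma japanese_pos: "japanese \<xi> > 0"
  using japanese_ge_1[of \<xi>] by simp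

lemma wt_eq_japanese: "wt (\<xi> :: real ^ 'n::finite) = japanese \<xi> powi (- int (2 * CARD('n)))"
  by (simp only: wt_def japanese_def power_int_minus power_int_of_nat)

text \<open>The symbol estimates are demanded of the generators only. Their derivatives need only
  lie in the class generated by the same B, so a reciprocal, whose derivative involves its own
  square, can be a generator.\<close>

locale symbol_base =
  fixes B :: "(int \<times> (real ^ 'n::finite \<Rightarrow> complex)) set"
  assumes base_continuous: "(s, f) \<in> B \<Longrightarrow> continuous_on UNIV f"
    and base_bound: "(s, f) \<in> B \<Longrightarrow> \<exists>K. \<forall>\<xi>. norm (f \<xi>) \<le> K * japanese \<xi> powi s"
    and base_deriv: "(s, f) \<in> B \<Longrightarrow> \<exists>f'. symbol B (s - 1) (\<lambda>t. f') \<and> (\<forall>\<xi>. partial_eq i f \<xi> (f' \<xi>))"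

lemma (in symbol_base) symbol_continuous: "symbol B s a \<Longrightarrow> continuous_on UNIV (a t)"
  by (induction rule: symbol.induct) (auto intro!: continuous_intros dest: base_continuous)

lemma (in symbol_base) symbol_deriv: "symbol B s a \<Longrightarrow> \<exists>a'. symbol B (s - 1) a' \<and> (\<forall>t \<xi>. partial_eq i (a t) \<xi> (a' t \<xi>))"
proof (induction rule: symbol.induct)
  case (base s f)
  then show ?case using base_deriv[OF base, of i] by blast
next
  case (zero s)
  show ?case using symbol.zero partial_eq_const[of i 0] by blast
next
  case (const c)
  show ?case using symbol.zero partial_eq_const[of i c] by blast
next
  case (coord j)
  have "symbol B (1 - 1) (\<lambda>t \<xi>. if i = j then 1 else 0)" by (simp add: symbol.const)
  then show ?case using partial_eq_coord[of i j] by blast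
next
  case square
  show ?case using symbol.zero partial_eq_const by blast
next
  case (add s a b)
  then obtain a' b' where "symbol B (s - 1) a'" "symbol B (s - 1) b'"
    "\<And>t \<xi>. partial_eq i (a t) \<xi> (a' t \<xi>)" "\<And>t \<xi>. partial_eq i (b t) \<xi> (b' t \<xi>)" by blast
  then show ?case
    by (intro exI[of _ "\<lambda>t \<xi>. a' t \<xi> + b' t \<xi>"] conjI allI symbol.add partial_eq_add)
next
  case (mult r a s b)
  then obtain a' b' where *: "symbol B (r - 1) a'" "symbol B (s - 1) b'"
    "\<And>t \<xi>. partial_eq i (a t) \<xi> (a' t \<xi>)" "\<And>t \<xi>. partial_eq i (b t) \<xi> (b' t \<xi>)" by blast
  show ?case
  proof (intro exI conjI allI)
    show "partial_eq i (\<lambda>\<xi>. a t \<xi> * b t \<xi>) \<xi> (a' t \<xi> * b t \<xi> + a t \<xi> * b' t \<xi>)" for t \<xi>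
      by (intro partial_eq_mult *)
    show "symbol B (r + s - 1) (\<lambda>t \<xi>. a' t \<xi> * b t \<xi> + a t \<xi> * b' t \<xi>)"
      using symbol_mult_le[OF *(1) mult.hyps(2)] symbol_mult_le[OF mult.hyps(1) *(2)] by (intro symbol.add) simp_all
  qed
next
  case (weaken r a s)
  then obtain a' where *: "symbol B (r - 1) a'" "\<forall>t \<xi>. partial_eq i (a t) \<xi> (a' t \<xi>)" by blast
  then have "symbol B (s - 1) a'" using weaken.hyps(2) by (intro symbol.weaken[OF *(1)]) simp
  then show ?case using *(2) by blast
qed

lemma (in symbol_base) symbol_partial:
  assumes "symbol B s a"
  shows "symbol B (s - 1) (\<lambda>t. partial i (a t))" "partial_eq i (a t) \<xi> (partial i (a t) \<xi>)"
proof -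
  obtain a' where a': "symbol B (s - 1) a'" "\<And>t \<xi>. partial_eq i (a t) \<xi> (a' t \<xi>)"
    using symbol_deriv[OF assms] by blast
  have "(\<lambda>t. partial i (a t)) = a'" using partial_eq_imp_partial[OF a'(2)] by blast
  with a' show "symbol B (s - 1) (\<lambda>t. partial i (a t))" by simp
  show "partial_eq i (a t) \<xi> (partial i (a t) \<xi>)"
    using a'(2)[of t \<xi>] partial_eq_imp_partial[OF a'(2)] by simp
qed

text \<open>The powers of 1 + (t |\<xi>|)^2 pay for counting t^2 as order -2, because t^2 (1 +
  |\<xi>|)^2 is at most 2 (1 + (t |\<xi>|)^2). They depend on t |\<xi>| alone, and the Gaussian
  absorbs them uniformly in t.\<close>

lemma (in symbol_base) symbol_bound:
  "symbol B s a \<Longrightarrow> \<exists>K N. \<forall>t \<xi>. 0 < t \<and> t \<le> 1 \<longrightarrow>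
    norm (a t \<xi>) \<le> K * japanese \<xi> powi s * (1 + (t * norm \<xi>)\<^sup>2) ^ N \<and> 0 \<le> K"
proof (induction rule: symbol.induct)
  case (base s f)
  then obtain K where K: "\<And>\<xi>. norm (f \<xi>) \<le> K * japanese \<xi> powi s" using base_bound by blast
  have "0 \<le> K * japanese (0 :: real ^ 'n) powi s" using order_trans[OF norm_ge_zero K[of 0]] .
  then have "0 \<le> K" by (simp add: japanese_def)
  then show ?case using K by (intro exI[of _ K] exI[of _ 0]) simp
next
  case (zero s)
  show ?case by (intro exI[of _ 0]) simp
next
  case (const c)
  show ?case by (intro exI[of _ "norm c"] exI[of _ 0]) simp
next
  case (coord i)
  have "norm (complex_of_real (\<xi> $ i)) \<le> japanese \<xi>" for \<xi> :: "real ^ 'n"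
    using component_le_norm_cart[of \<xi> i] by (simp add: japanese_def)
  then show ?case by (intro exI[of _ 1] exI[of _ 0]) simp
next
  case square
  have "norm (complex_of_real (t\<^sup>2)) \<le> 2 * japanese \<xi> powi (- 2) * (1 + (t * norm \<xi>)\<^sup>2) ^ 1 \<and> (0::real) \<le> 2"
    if "0 < t \<and> t \<le> 1" for t and \<xi> :: "real ^ 'n"
  proof -
    have "(japanese \<xi>)\<^sup>2 \<le> 2 * (1 + (norm \<xi>)\<^sup>2)"
      using sum_squares_bound[of 1 "norm \<xi>"] by (simp add: japanese_def power2_sum)
    then have "t\<^sup>2 * (japanese \<xi>)\<^sup>2 \<le> t\<^sup>2 * (2 * (1 + (norm \<xi>)\<^sup>2))" by (rule mult_left_mono) simp
    also have "\<dots> = 2 * (t\<^sup>2 + (t * norm \<xi>)\<^sup>2)" by (simp add: power_mult_distrib algebra_simps)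
    also have "\<dots> \<le> 2 * (1 + (t * norm \<xi>)\<^sup>2)" using that by (simp add: power_le_one)
    finally have "t\<^sup>2 * (japanese \<xi>)\<^sup>2 \<le> 2 * (1 + (t * norm \<xi>)\<^sup>2)" .
    then have "t\<^sup>2 \<le> 2 * (1 + (t * norm \<xi>)\<^sup>2) / (japanese \<xi>)\<^sup>2"
      using japanese_pos[of \<xi>] by (simp add: pos_le_divide_eq)
    then show ?thesis by (simp add: power_int_minus divide_inverse norm_power algebra_simps)
  qed
  then show ?case by blast
next
  case (add s a b)
  then obtain K N L M where K: "\<And>t \<xi>. 0 < t \<and> t \<le> 1 \<Longrightarrow>
      norm (a t \<xi>) \<le> K * japanese \<xi> powi s * (1 + (t * norm \<xi>)\<^sup>2) ^ N \<and> 0 \<le> K"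
    and L: "\<And>t \<xi>. 0 < t \<and> t \<le> 1 \<Longrightarrow>
      norm (b t \<xi>) \<le> L * japanese \<xi> powi s * (1 + (t * norm \<xi>)\<^sup>2) ^ M \<and> 0 \<le> L" by blast
  have "norm (a t \<xi> + b t \<xi>) \<le> (K + L) * japanese \<xi> powi s * (1 + (t * norm \<xi>)\<^sup>2) ^ (N + M) \<and> 0 \<le> K + L"
    if t: "0 < t \<and> t \<le> 1" for t \<xi>
  proof -
    have pos: "japanese \<xi> powi s > 0" using japanese_pos by (rule zero_less_power_int)
    have KL: "0 \<le> K" "0 \<le> L" using K[OF t] L[OF t] by blast+
    have "K * japanese \<xi> powi s * (1 + (t * norm \<xi>)\<^sup>2) ^ N \<le> K * japanese \<xi> powi s * (1 + (t * norm \<xi>)\<^sup>2) ^ (N + M)"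
      "L * japanese \<xi> powi s * (1 + (t * norm \<xi>)\<^sup>2) ^ M \<le> L * japanese \<xi> powi s * (1 + (t * norm \<xi>)\<^sup>2) ^ (N + M)"
      using KL pos by (intro mult_left_mono power_increasing mult_nonneg_nonneg; simp)+
    then have "norm (a t \<xi>) + norm (b t \<xi>) \<le>
        K * japanese \<xi> powi s * (1 + (t * norm \<xi>)\<^sup>2) ^ (N + M) + L * japanese \<xi> powi s * (1 + (t * norm \<xi>)\<^sup>2) ^ (N + M)"
      using K[OF t] L[OF t] by (intro add_mono) (blast intro: order_trans)+
    then show ?thesis using KL norm_triangle_ineq[of "a t \<xi>" "b t \<xi>"] by (simp add: distrib_right)
  qed
  then show ?case by blast
next
  case (mult r a s b)
  then obtain K N L M where K: "\<And>t \<xi>. 0 < t \<and> t \<le> 1 \<Longrightarrow>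
      norm (a t \<xi>) \<le> K * japanese \<xi> powi r * (1 + (t * norm \<xi>)\<^sup>2) ^ N \<and> 0 \<le> K"
    and L: "\<And>t \<xi>. 0 < t \<and> t \<le> 1 \<Longrightarrow>
      norm (b t \<xi>) \<le> L * japanese \<xi> powi s * (1 + (t * norm \<xi>)\<^sup>2) ^ M \<and> 0 \<le> L" by blast
  have "norm (a t \<xi> * b t \<xi>) \<le> (K * L) * japanese \<xi> powi (r + s) * (1 + (t * norm \<xi>)\<^sup>2) ^ (N + M) \<and> 0 \<le> K * L"
    if t: "0 < t \<and> t \<le> 1" for t \<xi>
  proof -
    have KL: "0 \<le> K" "0 \<le> L" using K[OF t] L[OF t] by blast+
    have "japanese \<xi> powi (r + s) = japanese \<xi> powi r * japanese \<xi> powi s"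
      using japanese_pos[of \<xi>] by (intro power_int_add) simp
    moreover have "norm (a t \<xi>) * norm (b t \<xi>) \<le> (K * japanese \<xi> powi r * (1 + (t * norm \<xi>)\<^sup>2) ^ N) *
        (L * japanese \<xi> powi s * (1 + (t * norm \<xi>)\<^sup>2) ^ M)"
      using K[OF t, of \<xi>] L[OF t, of \<xi>] order_trans[OF norm_ge_zero conjunct1[OF K[OF t]]]
      by (intro mult_mono) simp_all
    ultimately show ?thesis using KL by (simp add: norm_mult power_add mult_ac)
  qed
  then show ?case by blast
next
  case (weaken r a s)
  then obtain K N where K: "\<And>t \<xi>. 0 < t \<and> t \<le> 1 \<Longrightarrow>
      norm (a t \<xi>) \<le> K * japanese \<xi> powi r * (1 + (t * norm \<xi>)\<^sup>2) ^ N \<and> 0 \<le> K" by blast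
  have "norm (a t \<xi>) \<le> K * japanese \<xi> powi s * (1 + (t * norm \<xi>)\<^sup>2) ^ N \<and> 0 \<le> K"
    if t: "0 < t \<and> t \<le> 1" for t \<xi>
  proof -
    have "japanese \<xi> powi r \<le> japanese \<xi> powi s"
      using weaken.hyps(2) japanese_ge_1 by (rule power_int_increasing)
    then have "K * japanese \<xi> powi r * (1 + (t * norm \<xi>)\<^sup>2) ^ N \<le> K * japanese \<xi> powi s * (1 + (t * norm \<xi>)\<^sup>2) ^ N"
      using K[OF t] by (intro mult_right_mono mult_left_mono) simp_all
    then show ?thesis using K[OF t, of \<xi>] by (blast intro: order_trans)
  qed
  then show ?case by blast
qed

text \<open>Since 1 + u is at most 2N (1 + (u/2)/N), its N-th power is bounded by (2N)^N exp
  (u/2).\<close>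

lemma power_mult_exp_bounded: "\<exists>C\<ge>0. \<forall>u\<ge>0. (1 + u) ^ N * exp (- u / 2) \<le> (C::real)"
proof (cases "N = 0")
  case False
  have "(1 + u) ^ N * exp (- u / 2) \<le> (2 * real N) ^ N" if "u \<ge> 0" for u :: real
  proof -
    have "1 + u \<le> 2 * real N * (1 + (u / 2) / real N)" using False that by (simp add: field_simps)
    then have "(1 + u) ^ N \<le> (2 * real N * (1 + (u / 2) / real N)) ^ N"
      using that by (intro power_mono) simp_all
    also have "\<dots> = (2 * real N) ^ N * (1 + (u / 2) / real N) ^ N" by (rule power_mult_distrib)
    also have "\<dots> \<le> (2 * real N) ^ N * exp (u / 2)"
    proof (intro mult_left_mono exp_ge_one_plus_x_over_n_power_n)
      show "- real N \<le> u / 2" using order_trans[of "- real N" 0 "u / 2"] that by simp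
    qed (use False in simp_all)
    finally show ?thesis by (simp add: exp_minus field_simps)
  qed
  then show ?thesis by (intro exI[of _ "(2 * real N) ^ N"]) simp
qed (intro exI[of _ 1], simp)

text \<open>Two statements in one. For every order and fixed t the smoothed symbol is dominated by
  \<open>wt\<close>, with a constant that may blow up as t tends to 0. For order at most -2n the
  exponent \<open>nat (s + 2n)\<close> is 0 and the bound is uniform in t.\<close>

lemma (in symbol_base) symbol_gauss_bound:
  assumes "symbol B s a"
  shows "\<exists>K\<ge>0. \<forall>t \<xi>. 0 < t \<and> t \<le> 1 \<longrightarrow>
    norm (a t \<xi> * complex_of_real (gauss t \<xi>)) \<le> K * (2 / t\<^sup>2) ^ nat (s + int (2 * CARD('n))) * wt \<xi>"
proof -
  define k where "k = nat (s + int (2 * CARD('n)))"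
  obtain K N where K: "\<And>t \<xi>. 0 < t \<and> t \<le> 1 \<Longrightarrow>
      norm (a t \<xi>) \<le> K * japanese \<xi> powi s * (1 + (t * norm \<xi>)\<^sup>2) ^ N \<and> 0 \<le> K"
    using symbol_bound[OF assms] by blast
  obtain C where C: "C \<ge> 0" "\<And>u. u \<ge> 0 \<Longrightarrow> (1 + u) ^ (N + k) * exp (- u / 2) \<le> (C::real)"
    using power_mult_exp_bounded by blast
  have K0: "K \<ge> 0" using K[of 1] by simp
  have "norm (a t \<xi> * complex_of_real (gauss t \<xi>)) \<le> K * C * (2 / t\<^sup>2) ^ k * wt \<xi>"
    if t: "0 < t \<and> t \<le> 1" for t \<xi>
  proof -
    let ?J = "japanese \<xi>" and ?u = "(t * norm \<xi>)\<^sup>2"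
    have "?J powi s \<le> ?J powi (- int (2 * CARD('n)) + int k)"
      using japanese_ge_1 by (intro power_int_increasing) (simp_all add: k_def)
    also have "\<dots> = wt \<xi> * ?J ^ k"
      using japanese_pos[of \<xi>] by (subst power_int_add) (simp_all add: wt_eq_japanese)
    also have "\<dots> \<le> wt \<xi> * ((2 / t\<^sup>2) ^ k * (1 + ?u) ^ k)"
    proof -
      have "t\<^sup>2 * ?J \<le> t\<^sup>2 * (2 * (1 + (norm \<xi>)\<^sup>2))"
      proof (rule mult_left_mono)
        show "?J \<le> 2 * (1 + (norm \<xi>)\<^sup>2)"
          using sum_squares_bound[of 1 "norm \<xi>"] zero_le_power2[of "norm \<xi>"] unfolding japanese_def power2_eq_square by argo
      qed simp
      also have "\<dots> = 2 * (t\<^sup>2 + ?u)" by (simp add: power_mult_distrib algebra_simps)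
      also have "\<dots> \<le> 2 * (1 + ?u)" using t by (simp add: power_le_one)
      finally have "?J \<le> 2 / t\<^sup>2 * (1 + ?u)" using t by (simp add: field_simps)
      then have "?J ^ k \<le> (2 / t\<^sup>2 * (1 + ?u)) ^ k"
        using japanese_pos[of \<xi>] by (intro power_mono) simp_all
      then show ?thesis unfolding power_mult_distrib using wt_pos[of \<xi>] by (intro mult_left_mono) simp_all
    qed
    finally have "K * ?J powi s * (1 + ?u) ^ N \<le> K * (wt \<xi> * ((2 / t\<^sup>2) ^ k * (1 + ?u) ^ k)) * (1 + ?u) ^ N"
      using K0 by (intro mult_right_mono mult_left_mono) simp_all
    then have "norm (a t \<xi>) \<le> K * (wt \<xi> * ((2 / t\<^sup>2) ^ k * (1 + ?u) ^ k)) * (1 + ?u) ^ N"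
      using K[OF t, of \<xi>] by (blast intro: order_trans)
    then have "norm (a t \<xi>) * gauss t \<xi> \<le> K * (wt \<xi> * ((2 / t\<^sup>2) ^ k * (1 + ?u) ^ k)) * (1 + ?u) ^ N * gauss t \<xi>"
      using gauss_pos[of t \<xi>] by (intro mult_right_mono) simp_all
    also have "\<dots> = K * (2 / t\<^sup>2) ^ k * wt \<xi> * ((1 + ?u) ^ (N + k) * exp (- ?u / 2))"
      by (simp add: gauss_def power_add mult_ac)
    also have "\<dots> \<le> K * (2 / t\<^sup>2) ^ k * wt \<xi> * C"
      using K0 wt_pos[of \<xi>] by (intro mult_left_mono C(2) mult_nonneg_nonneg) simp_all
    finally show ?thesis using gauss_pos[of t \<xi>] by (simp add: norm_mult mult_ac)
  qed
  then show ?thesis using K0 C(1) unfolding k_def[symmetric] by (intro exI[of _ "K * C"]) simp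
qed

definition (in symbol_base) smoothed :: "(real \<Rightarrow> real ^ 'n \<Rightarrow> complex) \<Rightarrow> real \<Rightarrow> real ^ 'n \<Rightarrow> complex" where
  "smoothed a t \<xi> = a t \<xi> * complex_of_real (gauss t \<xi>)"

lemma (in symbol_base) wt_bounded_smoothed:
  assumes "symbol B s a" "0 < t" "t \<le> 1"
  shows "wt_bounded (smoothed a t)"
proof -
  from symbol_gauss_bound[OF assms(1)] assms(2,3) obtain K
    where "\<And>\<xi>. norm (smoothed a t \<xi>) \<le> K * wt \<xi>" unfolding smoothed_def by blast
  moreover have "continuous_on UNIV (smoothed a t)"
    unfolding smoothed_def by (intro continuous_intros symbol_continuous[OF assms(1)] continuous_on_gauss)
  ultimately show ?thesis by (intro wt_boundedI)
qed

lemma (in symbol_base) smoothed_uniform_bound: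
  assumes "symbol B s a" "s \<le> - int (2 * CARD('n))"
  obtains K where "K \<ge> 0" "\<And>t \<xi>. 0 < t \<Longrightarrow> t \<le> 1 \<Longrightarrow> norm (smoothed a t \<xi>) \<le> K * wt \<xi>"
proof -
  have "nat (s + int (2 * CARD('n))) = 0" using assms(2) by simp
  with symbol_gauss_bound[OF assms(1)] that show ?thesis unfolding smoothed_def by fastforce
qed

text \<open>The symbol of \<open>- \<i> \<partial>\<^sub>i\<close> applied to \<open>smoothed a t\<close>, with the Gaussian factored out; on the space side it
  becomes multiplication by \<open>x\<^sub>i - p\<^sub>i\<close>.\<close>

definition (in symbol_base) twist :: "'n \<Rightarrow> (real \<Rightarrow> real ^ 'n \<Rightarrow> complex) \<Rightarrow> real \<Rightarrow> real ^ 'n \<Rightarrow> complex" where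
  "twist i a t \<xi> = - \<i> * (partial i (a t) \<xi> - complex_of_real (t\<^sup>2) * complex_of_real (\<xi> $ i) * a t \<xi>)"

text \<open>The derivative of the Gaussian contributes t^2 \<xi>_i a, of order -2 + 1 + s = s - 1,
  the same order as the derivative of a.\<close>

lemma (in symbol_base) symbol_twist:
  assumes "symbol B s a"
  shows "symbol B (s - 1) (twist i a)"
proof -
  have "symbol B (s - 1) (\<lambda>t \<xi>. complex_of_real (t\<^sup>2) * complex_of_real (\<xi> $ i) * a t \<xi>)"
    by (rule symbol_mult_le[OF symbol.mult[OF symbol.square symbol.coord] assms]) simp
  from symbol_cmult[OF symbol.add[OF symbol_partial(1)[OF assms, of i] symbol_cmult[OF this, of "- 1"]], of "- \<i>"]
  show ?thesis unfolding twist_def by simp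
qed

lemma partial_eq_gauss:
  "partial_eq i (\<lambda>\<xi>. complex_of_real (gauss t \<xi>)) \<xi> (- complex_of_real (t\<^sup>2) * complex_of_real (\<xi> $ i) * complex_of_real (gauss t \<xi>))"
proof -
  have "(\<lambda>\<xi> :: real ^ 'n. complex_of_real (gauss t \<xi>)) = (\<lambda>\<xi>. complex_of_real (exp (0 + (- t\<^sup>2 / 2) * (norm (\<xi> - 0))\<^sup>2)))"
    by (simp add: gauss_def power_mult_distrib)
  moreover have "partial_eq i (\<lambda>\<xi>. complex_of_real (exp (0 + (- t\<^sup>2 / 2) * (norm (\<xi> - 0))\<^sup>2))) \<xi>
      (complex_of_real (exp (0 + (- t\<^sup>2 / 2) * (norm (\<xi> - 0))\<^sup>2) * (2 * (- t\<^sup>2 / 2) * (\<xi> $ i - 0 $ i))))"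
    by (rule partial_eq_of_real_comp[OF partial_eq_norm_square DERIV_exp])
  ultimately show ?thesis by (simp add: gauss_def power_mult_distrib mult_ac)
qed

lemma (in symbol_base) FT_twist:
  assumes "symbol B s a" "0 < t" "t \<le> 1"
  shows "complex_of_real (x $ i - p $ i) * FT p (smoothed a t) x = FT p (smoothed (twist i a) t) x"
proof -
  let ?b' = "\<lambda>\<xi>. \<i> * smoothed (twist i a) t \<xi>"
  have "complex_of_real (x $ i - p $ i) * FT p (smoothed a t) x = FT p (\<lambda>\<xi>. - \<i> * ?b' \<xi>) x"
  proof (rule FT_coord)
    show "wt_bounded (smoothed a t)" by (rule wt_bounded_smoothed[OF assms])
    have "wt_bounded (smoothed (twist i a) t)" by (rule wt_bounded_smoothed[OF symbol_twist[OF assms(1)] assms(2,3)])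
    from wt_bounded_mult[OF this, of "\<lambda>_. \<i>" 1] show "wt_bounded ?b'"
      by (simp add: continuous_on_const mult.commute)
    show "partial_eq i (smoothed a t) \<xi> (?b' \<xi>)" for \<xi>
      using partial_eq_mult[OF symbol_partial(2)[OF assms(1), of i t \<xi>] partial_eq_gauss[of i t \<xi>]]
      unfolding smoothed_def twist_def by (simp add: algebra_simps)
  qed
  then show ?thesis by (simp add: mult.assoc[symmetric])
qed

lemma (in symbol_base) pairing_smoothed_partial:
  assumes "symbol B s a" "0 < t" "t \<le> 1" "wt_bounded f" "wt_bounded (partial i f)" "\<And>x. partial_eq i f x (partial i f x)"
  shows "pairing p (smoothed a t) (partial i f) =
    pairing p (smoothed (\<lambda>t \<xi>. \<i> * complex_of_real (\<xi> $ i) * a t \<xi>) t) f"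
proof -
  have "symbol B (s + 1) (\<lambda>t \<xi>. \<i> * complex_of_real (\<xi> $ i) * a t \<xi>)"
    by (rule symbol_mult_le[OF symbol_cmult[OF symbol.coord] assms(1)]) simp
  from wt_bounded_smoothed[OF this assms(2,3)]
  have "wt_bounded (\<lambda>\<xi>. \<i> * complex_of_real (\<xi> $ i) * smoothed a t \<xi>)"
    by (simp add: smoothed_def[abs_def] mult.assoc)
  from pairing_partial[OF wt_bounded_smoothed[OF assms(1-3)] this assms(4-6)]
  show ?thesis by (simp add: smoothed_def[abs_def] mult.assoc)
qed

section \<open>Principal symbols and ellipticity\<close>

lemma symbol_monomial:
  "symbol B (int (mi_abs \<alpha>)) (\<lambda>t \<xi>. \<Prod>i\<in>UNIV. (w * complex_of_real (\<xi> $ i)) ^ (\<alpha> $ i))"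
proof -
  have "symbol B (\<Sum>i\<in>UNIV. int (\<alpha> $ i) * 1) (\<lambda>t \<xi>. \<Prod>i\<in>UNIV. (w * complex_of_real (\<xi> $ i)) ^ (\<alpha> $ i))"
    by (intro symbol_prod symbol_power symbol_cmult symbol.coord) simp
  then show ?thesis by (simp add: mi_abs_def)
qed

text \<open>The factor (\<i> \<xi>)^\<alpha> that replaces D^\<alpha> when it is moved from the test
  function to the symbol; the sign of the transposition is already included.\<close>

definition imon :: "nat ^ 'n::finite \<Rightarrow> real ^ 'n \<Rightarrow> complex" where
  "imon \<alpha> \<xi> = (\<Prod>i\<in>UNIV. (\<i> * complex_of_real (\<xi> $ i)) ^ (\<alpha> $ i))"

lemma symbol_imon: "symbol B (int (mi_abs \<alpha>)) (\<lambda>t. imon \<alpha>)"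
  unfolding imon_def[abs_def] by (rule symbol_monomial)

lemma imon_eq: "imon \<alpha> \<xi> = \<i> ^ mi_abs \<alpha> * complex_of_real (mi_power \<xi> \<alpha>)"
  by (simp add: imon_def mi_power_def power_mult_distrib prod.distrib mi_abs_def power_sum)

definition princ :: "nat \<Rightarrow> (nat ^ 'n::finite \<Rightarrow> complex) \<Rightarrow> real ^ 'n \<Rightarrow> complex" where
  "princ m c \<xi> = (\<Sum>\<alpha> | mi_abs \<alpha> = m. c \<alpha> * imon \<alpha> \<xi>)"

lemma princ_eq: "princ m c \<xi> = \<i> ^ m * (\<Sum>\<alpha> | mi_abs \<alpha> = m. c \<alpha> * complex_of_real (mi_power \<xi> \<alpha>))"
  unfolding princ_def sum_distrib_left by (rule sum.cong) (simp_all add: imon_eq)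

lemma symbol_princ: "symbol B (int m) (\<lambda>t. princ m c)"
  unfolding princ_def[abs_def]
proof (rule symbol_sum)
  fix \<alpha> :: "nat ^ 'a" assume "\<alpha> \<in> {\<alpha>. mi_abs \<alpha> = m}"
  then show "symbol B (int m) (\<lambda>t \<xi>. c \<alpha> * imon \<alpha> \<xi>)"
    using symbol_cmult[OF symbol_imon[of B \<alpha>]] by simp
qed

lemma symbol_cnj_princ: "symbol B (int m) (\<lambda>t \<xi>. cnj (princ m c \<xi>))"
proof -
  have "cnj (princ m c \<xi>) = (\<Sum>\<alpha> | mi_abs \<alpha> = m. cnj (c \<alpha>) * (\<Prod>i\<in>UNIV. (- \<i> * complex_of_real (\<xi> $ i)) ^ (\<alpha> $ i)))" for \<xi>
    by (simp add: princ_def imon_def)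
  moreover have "symbol B (int m) (\<lambda>t \<xi>. \<Sum>\<alpha> | mi_abs \<alpha> = m. cnj (c \<alpha>) * (\<Prod>i\<in>UNIV. (- \<i> * complex_of_real (\<xi> $ i)) ^ (\<alpha> $ i)))"
  proof (rule symbol_sum)
    fix \<alpha> :: "nat ^ 'a" assume "\<alpha> \<in> {\<alpha>. mi_abs \<alpha> = m}"
    then show "symbol B (int m) (\<lambda>t \<xi>. cnj (c \<alpha>) * (\<Prod>i\<in>UNIV. (- \<i> * complex_of_real (\<xi> $ i)) ^ (\<alpha> $ i)))"
      using symbol_cmult[OF symbol_monomial[of B \<alpha> "- \<i>"]] by simp
  qed
  ultimately show ?thesis by simp
qed

text \<open>Differentiating a symbol constant in t yields a symbol that formally still depends on t,
  whereas the generators of a \<open>symbol_base\<close> need derivatives free of t. Setting t = 0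
  provides them.\<close>

lemma symbol_at_0: "symbol B s a \<Longrightarrow> symbol B s (\<lambda>t. a 0)"
proof (induction rule: symbol.induct)
  case square
  show ?case using symbol.zero by simp
qed (simp_all add: symbol.base symbol.zero symbol.const symbol.coord symbol.add symbol.mult symbol.weaken)

text \<open>The minimum over the compact unit sphere is positive, and homogeneity of degree m
  extends the bound. Continuity is read off the symbol calculus over the empty base, where symbols
  are polynomials.\<close>

lemma princ_lower_bound:
  fixes c :: "nat ^ 'n::finite \<Rightarrow> complex"
  assumes "\<And>\<xi> :: real ^ 'n. \<xi> \<noteq> 0 \<Longrightarrow> princ m c \<xi> \<noteq> 0"
  obtains \<kappa> where "\<kappa> > 0" "\<And>\<xi>. norm (princ m c \<xi>) \<ge> \<kappa> * norm \<xi> ^ m"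
proof -
  interpret E: symbol_base "{} :: (int \<times> (real ^ 'n \<Rightarrow> complex)) set" by standard simp_all
  have cont: "continuous_on UNIV (princ m c)"
    using E.symbol_continuous[OF symbol_princ, of m c] by simp
  have hom: "princ m c (s *\<^sub>R \<xi>) = complex_of_real (s ^ m) * princ m c \<xi>" for s \<xi>
  proof -
    have "imon \<alpha> (s *\<^sub>R \<xi>) = complex_of_real (s ^ mi_abs \<alpha>) * imon \<alpha> \<xi>" for \<alpha> :: "nat ^ 'n"
      by (simp add: imon_eq mi_power_def power_mult_distrib prod.distrib mi_abs_def power_sum)
    then show ?thesis
      unfolding princ_def sum_distrib_left by (intro sum.cong) auto
  qed
  have "sphere (0 :: real ^ 'n) 1 \<noteq> {}" by simp
  moreover have "continuous_on (sphere 0 1) (\<lambda>\<xi>. norm (princ m c \<xi>))"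
    by (intro continuous_on_norm continuous_on_subset[OF cont]) simp
  ultimately have "\<exists>\<xi>0\<in>sphere (0 :: real ^ 'n) 1. \<forall>\<xi>\<in>sphere 0 1. norm (princ m c \<xi>0) \<le> norm (princ m c \<xi>)"
    by (intro continuous_attains_inf compact_sphere)
  then obtain \<xi>0 where \<xi>0: "\<xi>0 \<in> sphere (0 :: real ^ 'n) 1"
    "\<And>\<xi>. \<xi> \<in> sphere 0 1 \<Longrightarrow> norm (princ m c \<xi>0) \<le> norm (princ m c \<xi>)" by blast
  show ?thesis
  proof (rule that)
    have "\<xi>0 \<noteq> 0" using \<xi>0(1) by auto
    then show "norm (princ m c \<xi>0) > 0" using assms[of \<xi>0] by simp
    show "norm (princ m c \<xi>) \<ge> norm (princ m c \<xi>0) * norm \<xi> ^ m" for \<xi>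
    proof (cases "\<xi> = 0")
      case True
      show ?thesis
      proof (cases "m = 0")
        case True
        \<comment> \<open>As 0^0 = 1, scaling by 0 shows that the principal symbol is constant when
          m = 0.\<close>
        have "princ m c \<xi> = princ m c \<xi>0" using hom[of 0 \<xi>] hom[of 0 \<xi>0] True by simp
        then show ?thesis using True by simp
      qed (use True in \<open>simp add: zero_power\<close>)
    next
      case False
      define \<eta> where "\<eta> = (1 / norm \<xi>) *\<^sub>R \<xi>"
      have "\<eta> \<in> sphere 0 1" "\<xi> = norm \<xi> *\<^sub>R \<eta>" using False by (simp_all add: \<eta>_def)
      then have "norm (princ m c \<xi>) = norm \<xi> ^ m * norm (princ m c \<eta>)"
        using hom[of "norm \<xi>" \<eta>] by (simp add: norm_mult norm_power)
      then show ?thesis using \<xi>0(2)[OF \<open>\<eta> \<in> sphere 0 1\<close>] by (simp add: mult.commute mult_left_mono)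
    qed
  qed
qed

text \<open>Adding \<open>1\<close> to \<open>|P|\<^sup>2\<close> avoids a cutoff near \<open>\<xi> = 0\<close>: up to lower order, \<open>cnj P\<close> times this base symbol
  inverts \<open>P\<close>.\<close>

definition ell_base :: "nat \<Rightarrow> (nat ^ 'n::finite \<Rightarrow> complex) \<Rightarrow> (int \<times> (real ^ 'n \<Rightarrow> complex)) set" where
  "ell_base m c = {(- 2 * int m, \<lambda>\<xi>. inverse (1 + princ m c \<xi> * cnj (princ m c \<xi>)))}"

text \<open>The denominator d = 1 + |P|^2 is a polynomial symbol of order 2m over the empty base.
  Ellipticity bounds 1/d by a multiple of (1 + |\<xi>|)^(-2m), and its derivative -d'/d^2 has order
  (2m - 1) - 4m = -2m - 1 over the base that contains 1/d.\<close>

lemma symbol_base_elliptic: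
  fixes c :: "nat ^ 'n::finite \<Rightarrow> complex"
  assumes ell: "\<And>\<xi> :: real ^ 'n. \<xi> \<noteq> 0 \<Longrightarrow> princ m c \<xi> \<noteq> 0"
  shows "symbol_base (ell_base m c)"
proof -
  interpret E: symbol_base "{} :: (int \<times> (real ^ 'n \<Rightarrow> complex)) set" by standard simp_all
  let ?P = "princ m c"
  let ?d = "\<lambda>\<xi>. 1 + ?P \<xi> * cnj (?P \<xi>)"
  have d_eq: "?d \<xi> = complex_of_real (1 + (norm (?P \<xi>))\<^sup>2)" for \<xi>
    by (simp only: of_real_add of_real_1 complex_norm_square)
  have d_pos: "1 + (norm (?P \<xi>))\<^sup>2 > 0" for \<xi> by (simp add: add_pos_nonneg)
  have d_nz: "?d \<xi> \<noteq> 0" for \<xi> unfolding d_eq of_real_eq_0_iff using d_pos[of \<xi>] by simp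
  have sym_d: "symbol {} (2 * int m) (\<lambda>t. ?d)"
  proof (rule symbol.add)
    show "symbol {} (2 * int m) (\<lambda>t (\<xi> :: real ^ 'n). 1)" by (rule symbol.weaken[OF symbol.const]) simp
    show "symbol {} (2 * int m) (\<lambda>t \<xi>. ?P \<xi> * cnj (?P \<xi>))"
      by (rule symbol_mult_le[OF symbol_princ symbol_cnj_princ]) simp
  qed
  have cont: "continuous_on UNIV ?d" using E.symbol_continuous[OF sym_d] .
  obtain \<kappa> where \<kappa>: "\<kappa> > 0" "\<And>\<xi>. norm (?P \<xi>) \<ge> \<kappa> * norm \<xi> ^ m"
    using princ_lower_bound[OF ell] by blast
  \<comment> \<open>One constant for both summands: \<mu> (1 + |\<xi>|^(2m)) is at most 1 + |P|^2.
    Together with (1 + |\<xi>|)^(2m) being at most 4^m (1 + |\<xi>|^(2m)) this gives the constant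
    4^m / \<mu>.\<close>
  define \<mu> where "\<mu> = min 1 (\<kappa>\<^sup>2)"
  have \<mu>: "\<mu> > 0" "\<mu> \<le> 1" "\<mu> \<le> \<kappa>\<^sup>2" using \<kappa>(1) by (simp_all add: \<mu>_def)
  have bound: "norm (inverse (?d \<xi>)) \<le> 4 ^ m / \<mu> * japanese \<xi> powi (- 2 * int m)" for \<xi>
  proof -
    let ?r = "norm \<xi>"
    have "japanese \<xi> ^ (2 * m) \<le> 4 ^ m * (1 + ?r ^ (2 * m))"
    proof (cases "?r \<le> 1")
      case True
      then have "japanese \<xi> ^ (2 * m) \<le> 2 ^ (2 * m)"
        by (intro power_mono) (simp_all add: japanese_def)
      also have "\<dots> \<le> 4 ^ m * (1 + ?r ^ (2 * m))" by (simp add: power_mult)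
      finally show ?thesis .
    next
      case False
      then have "japanese \<xi> ^ (2 * m) \<le> (2 * ?r) ^ (2 * m)"
        by (intro power_mono) (simp_all add: japanese_def)
      also have "\<dots> = 4 ^ m * ?r ^ (2 * m)" by (simp add: power_mult power_mult_distrib)
      also have "\<dots> \<le> 4 ^ m * (1 + ?r ^ (2 * m))" by simp
      finally show ?thesis .
    qed
    moreover have "\<mu> * (1 + ?r ^ (2 * m)) \<le> 1 + (norm (?P \<xi>))\<^sup>2"
    proof -
      have "(\<kappa> * ?r ^ m)\<^sup>2 \<le> (norm (?P \<xi>))\<^sup>2" using \<kappa> by (intro power_mono) simp_all
      then have "\<kappa>\<^sup>2 * ?r ^ (2 * m) \<le> (norm (?P \<xi>))\<^sup>2"
        by (simp add: power_mult_distrib power_mult[symmetric] mult.commute)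
      moreover have "\<mu> * ?r ^ (2 * m) \<le> \<kappa>\<^sup>2 * ?r ^ (2 * m)" using \<mu>(3) by (rule mult_right_mono) simp
      ultimately show ?thesis using \<mu>(2) by (simp add: distrib_left)
    qed
    then have "1 + ?r ^ (2 * m) \<le> (1 + (norm (?P \<xi>))\<^sup>2) / \<mu>"
      using \<mu>(1) by (simp only: pos_le_divide_eq mult.commute)
    then have "4 ^ m * (1 + ?r ^ (2 * m)) \<le> 4 ^ m * ((1 + (norm (?P \<xi>))\<^sup>2) / \<mu>)"
      by (rule mult_left_mono) simp
    then have "4 ^ m * (1 + ?r ^ (2 * m)) \<le> 4 ^ m / \<mu> * (1 + (norm (?P \<xi>))\<^sup>2)" by simp
    ultimately have "japanese \<xi> ^ (2 * m) \<le> 4 ^ m / \<mu> * (1 + (norm (?P \<xi>))\<^sup>2)" by (rule order_trans)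
    then have "inverse (1 + (norm (?P \<xi>))\<^sup>2) \<le> 4 ^ m / \<mu> * inverse (japanese \<xi> ^ (2 * m))"
      using d_pos[of \<xi>] japanese_pos[of \<xi>] by (intro le_inverse_mult) simp_all
    moreover have "norm (inverse (?d \<xi>)) = inverse (1 + (norm (?P \<xi>))\<^sup>2)"
      unfolding d_eq norm_inverse norm_of_real using d_pos[of \<xi>] by simp
    moreover have "japanese \<xi> powi (- 2 * int m) = inverse (japanese \<xi> ^ (2 * m))"
    proof -
      have "- 2 * int m = - int (2 * m)" by simp
      then show ?thesis by (simp only: power_int_minus power_int_of_nat)
    qed
    ultimately show ?thesis by (simp only:)
  qed
  have deriv: "\<exists>f'. symbol (ell_base m c) (- 2 * int m - 1) (\<lambda>t. f') \<and> (\<forall>\<xi>. partial_eq i (\<lambda>\<xi>. inverse (?d \<xi>)) \<xi> (f' \<xi>))" for i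
  proof -
    obtain a' where a': "symbol {} (2 * int m - 1) a'" "\<And>t \<xi>. partial_eq i ?d \<xi> (a' t \<xi>)"
      using E.symbol_deriv[OF sym_d] by blast
    have s: "symbol (ell_base m c) (2 * int m - 1) (\<lambda>t. a' 0)"
      using symbol_at_0[OF a'(1)] by (rule symbol_mono) simp
    have inv: "symbol (ell_base m c) (- 2 * int m) (\<lambda>t \<xi>. inverse (?d \<xi>))"
      by (rule symbol.base) (simp add: ell_base_def)
    have "symbol (ell_base m c) (- 2 * int m - 1) (\<lambda>t \<xi>. - 1 * (a' 0 \<xi> * (inverse (?d \<xi>) * inverse (?d \<xi>))))"
      by (rule symbol_cmult, rule symbol_mult_le[OF s symbol.mult[OF inv inv]]) simp
    moreover have "partial_eq i (\<lambda>\<xi>. inverse (?d \<xi>)) \<xi> (- 1 * (a' 0 \<xi> * (inverse (?d \<xi>) * inverse (?d \<xi>))))" for \<xi>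
      using partial_eq_inverse[OF a'(2)[of \<xi> 0] d_nz] by (simp add: mult.assoc)
    ultimately show ?thesis
      by (intro exI[of _ "\<lambda>\<xi>. - 1 * (a' 0 \<xi> * (inverse (?d \<xi>) * inverse (?d \<xi>)))"] conjI allI)
  qed
  show ?thesis
  proof
    fix s f assume "(s, f) \<in> ell_base m c"
    then have sf: "s = - 2 * int m" "f = (\<lambda>\<xi>. inverse (?d \<xi>))" by (simp_all add: ell_base_def)
    show "continuous_on UNIV f" unfolding sf using cont d_nz by (intro continuous_on_inverse) auto
    show "\<exists>K. \<forall>\<xi>. norm (f \<xi>) \<le> K * japanese \<xi> powi s" unfolding sf using bound by blast
    show "\<exists>f'. symbol (ell_base m c) (s - 1) (\<lambda>t. f') \<and> (\<forall>\<xi>. partial_eq i f \<xi> (f' \<xi>))" for i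
      unfolding sf by (rule deriv)
  qed
qed

section \<open>Polynomial coefficients and the construction of the parametrix\<close>

definition (in symbol_base) twists :: "nat ^ 'n \<Rightarrow> (real \<Rightarrow> real ^ 'n \<Rightarrow> complex) \<Rightarrow> real \<Rightarrow> real ^ 'n \<Rightarrow> complex" where
  "twists \<gamma> a = foldr (\<lambda>i. twist i ^^ (\<gamma> $ i)) axes a"

lemma (in symbol_base) symbol_twist_pow: "symbol B s a \<Longrightarrow> symbol B (s - int k) ((twist i ^^ k) a)"
proof (induction k)
  case (Suc k)
  from symbol_twist[OF Suc.IH[OF Suc.prems], of i] show ?case by (simp add: algebra_simps)
qed simp

lemma (in symbol_base) symbol_twists:
  assumes "symbol B s a"
  shows "symbol B (s - int (mi_abs \<gamma>)) (twists \<gamma> a)"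
proof -
  have "symbol B (s - int (sum_list (map (\<lambda>i. \<gamma> $ i) is))) (foldr (\<lambda>i. twist i ^^ (\<gamma> $ i)) is a)" for "is"
  proof (induction "is")
    case (Cons i "is")
    from symbol_twist_pow[OF Cons, of "\<gamma> $ i" i] show ?case by (simp add: algebra_simps)
  qed (use assms in simp)
  then show ?thesis by (simp add: twists_def mi_abs_axes)
qed

lemma (in symbol_base) twists_0: "twists 0 a = a"
proof -
  have "foldr (\<lambda>i. twist i ^^ ((0 :: nat ^ 'n) $ i)) is a = a" for "is" by (induction "is") simp_all
  then show ?thesis by (simp add: twists_def)
qed

lemma (in symbol_base) FT_twist_pow:
  assumes "symbol B s a" "0 < t" "t \<le> 1"
  shows "complex_of_real ((x $ i - p $ i) ^ k) * FT p (smoothed a t) x = FT p (smoothed ((twist i ^^ k) a) t) x"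
proof (induction k)
  case (Suc k)
  have "complex_of_real ((x $ i - p $ i) ^ Suc k) * FT p (smoothed a t) x =
      complex_of_real (x $ i - p $ i) * (complex_of_real ((x $ i - p $ i) ^ k) * FT p (smoothed a t) x)"
    by (simp only: power_Suc of_real_mult mult.assoc)
  also have "\<dots> = FT p (smoothed (twist i ((twist i ^^ k) a)) t) x"
    unfolding Suc.IH by (rule FT_twist[OF symbol_twist_pow[OF assms(1)] assms(2,3)])
  finally show ?case by simp
qed simp

lemma (in symbol_base) FT_twists:
  assumes "symbol B s a" "0 < t" "t \<le> 1"
  shows "mon p \<gamma> x * FT p (smoothed a t) x = FT p (smoothed (twists \<gamma> a) t) x"
proof -
  have "distinct is \<Longrightarrow> (\<exists>s. symbol B s (foldr (\<lambda>i. twist i ^^ (\<gamma> $ i)) is a)) \<and>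
      complex_of_real (\<Prod>i\<in>set is. (x $ i - p $ i) ^ (\<gamma> $ i)) * FT p (smoothed a t) x =
      FT p (smoothed (foldr (\<lambda>i. twist i ^^ (\<gamma> $ i)) is a) t) x" for "is"
  proof (induction "is")
    case (Cons i "is")
    then obtain s' where s': "symbol B s' (foldr (\<lambda>i. twist i ^^ (\<gamma> $ i)) is a)" by auto
    have "complex_of_real (\<Prod>i\<in>set (i # is). (x $ i - p $ i) ^ (\<gamma> $ i)) * FT p (smoothed a t) x =
        complex_of_real ((x $ i - p $ i) ^ (\<gamma> $ i)) * (complex_of_real (\<Prod>i\<in>set is. (x $ i - p $ i) ^ (\<gamma> $ i)) * FT p (smoothed a t) x)"
      using Cons.prems by (simp add: mult.assoc)
    also have "\<dots> = complex_of_real ((x $ i - p $ i) ^ (\<gamma> $ i)) * FT p (smoothed (foldr (\<lambda>i. twist i ^^ (\<gamma> $ i)) is a) t) x"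
      using Cons by simp
    also have "\<dots> = FT p (smoothed ((twist i ^^ (\<gamma> $ i)) (foldr (\<lambda>i. twist i ^^ (\<gamma> $ i)) is a)) t) x"
      by (rule FT_twist_pow[OF s' assms(2,3)])
    finally show ?case using symbol_twist_pow[OF s', of "\<gamma> $ i" i] by auto
  qed (use assms in auto)
  from this[OF distinct_axes] show ?thesis
    by (simp add: twists_def set_axes mon_def mi_power_def)
qed

text \<open>Additivity of \<open>partial\<close> requires differentiable arguments, so the induction
  carries along that both summands remain symbols.\<close>

lemma (in symbol_base) twists_add:
  assumes "symbol B r a" "symbol B s b"
  shows "twists \<gamma> (\<lambda>t \<xi>. a t \<xi> + b t \<xi>) = (\<lambda>t \<xi>. twists \<gamma> a t \<xi> + twists \<gamma> b t \<xi>)"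
proof -
  let ?R = "\<lambda>a b c. (\<exists>r. symbol B r a) \<and> (\<exists>s. symbol B s b) \<and> c = (\<lambda>t \<xi>. a t \<xi> + b t \<xi>)"
  have one: "?R (twist i a) (twist i b) (twist i c)" if R: "?R a b c" for a b c i
  proof -
    from R obtain r s where rs: "symbol B r a" "symbol B s b" and c: "c = (\<lambda>t \<xi>. a t \<xi> + b t \<xi>)" by blast
    have "partial i (c t) \<xi> = partial i (a t) \<xi> + partial i (b t) \<xi>" for t \<xi>
      unfolding c using rs by (intro partial_eq_imp_partial partial_eq_add symbol_partial(2))
    then have "twist i c = (\<lambda>t \<xi>. twist i a t \<xi> + twist i b t \<xi>)"
      by (intro ext) (simp add: twist_def c algebra_simps)
    then show ?thesis using symbol_twist rs by blast
  qed
  have pow: "?R ((twist i ^^ k) a) ((twist i ^^ k) b) ((twist i ^^ k) c)" if "?R a b c" for a b c i k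
  proof (induction k)
    case (Suc k)
    from one[OF Suc, of i] show ?case by simp
  qed (use that in simp)
  have "?R (foldr (\<lambda>i. twist i ^^ (\<gamma> $ i)) is a) (foldr (\<lambda>i. twist i ^^ (\<gamma> $ i)) is b)
      (foldr (\<lambda>i. twist i ^^ (\<gamma> $ i)) is (\<lambda>t \<xi>. a t \<xi> + b t \<xi>))" for "is"
  proof (induction "is")
    case (Cons i "is")
    from pow[OF Cons, of "\<gamma> $ i" i] show ?case by simp
  qed (use assms in auto)
  then show ?thesis by (simp add: twists_def)
qed

text \<open>With \<open>q \<alpha> \<gamma>\<close> the Taylor coefficients at \<open>p\<close> of the coefficients of \<open>L\<close>, truncated at degree \<open>M\<close>, this is the
  symbol of the transpose of \<open>L\<close> applied to the distribution with symbol \<open>a\<close>.\<close>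

definition (in symbol_base) op_symbol ::
  "nat \<Rightarrow> nat \<Rightarrow> (nat ^ 'n \<Rightarrow> nat ^ 'n \<Rightarrow> complex) \<Rightarrow> (real \<Rightarrow> real ^ 'n \<Rightarrow> complex) \<Rightarrow> real \<Rightarrow> real ^ 'n \<Rightarrow> complex" where
  "op_symbol m M q a t \<xi> =
    (\<Sum>(\<alpha>, \<gamma>)\<in>{\<alpha>. mi_abs \<alpha> \<le> m} \<times> {\<gamma>. mi_abs \<gamma> < M}. q \<alpha> \<gamma> * (imon \<alpha> \<xi> * twists \<gamma> a t \<xi>))"

lemma finite_mi_abs_less: "finite {\<gamma> :: nat ^ 'n::finite. mi_abs \<gamma> < M}"
  by (rule finite_subset[OF _ finite_mi_abs_le[of M]]) auto

text \<open>Each term other than |\<alpha>| = m, \<gamma> = 0 loses at least one order: through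
  |\<alpha>| < m, or because every factor x_i - p_i acts as a twist.\<close>

lemma (in symbol_base) op_symbol_principal:
  assumes "symbol B s a" "M > 0"
  shows "symbol B (s + int m - 1) (\<lambda>t \<xi>. op_symbol m M q a t \<xi> - princ m (\<lambda>\<alpha>. q \<alpha> 0) \<xi> * a t \<xi>)"
proof -
  let ?S = "{\<alpha> :: nat ^ 'n. mi_abs \<alpha> \<le> m} \<times> {\<gamma> :: nat ^ 'n. mi_abs \<gamma> < M}"
  let ?T = "{\<alpha> :: nat ^ 'n. mi_abs \<alpha> = m} \<times> {0 :: nat ^ 'n}"
  let ?f = "\<lambda>t \<xi> (\<alpha>, \<gamma>). q \<alpha> \<gamma> * (imon \<alpha> \<xi> * twists \<gamma> a t \<xi>)"
  have mi0: "mi_abs (0 :: nat ^ 'n) = 0" by (simp add: mi_abs_def)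
  have "?T \<subseteq> ?S" using assms(2) mi0 by auto
  moreover have "finite ?S" by (intro finite_cartesian_product finite_mi_abs_le finite_mi_abs_less)
  ultimately have "sum (?f t \<xi>) ?S = sum (?f t \<xi>) (?S - ?T) + sum (?f t \<xi>) ?T" for t \<xi>
    by (rule sum.subset_diff)
  moreover have "sum (?f t \<xi>) ?T = princ m (\<lambda>\<alpha>. q \<alpha> 0) \<xi> * a t \<xi>" for t \<xi>
    by (simp add: sum.cartesian_product[symmetric] princ_def sum_distrib_right twists_0 mult.assoc)
  ultimately have eq: "op_symbol m M q a t \<xi> - princ m (\<lambda>\<alpha>. q \<alpha> 0) \<xi> * a t \<xi> = sum (?f t \<xi>) (?S - ?T)" for t \<xi>
    by (simp add: op_symbol_def)
  show ?thesis
    unfolding eq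
  proof (rule symbol_sum)
    fix z assume z: "z \<in> ?S - ?T"
    obtain \<alpha> \<gamma> where [simp]: "z = (\<alpha>, \<gamma>)" by (cases z)
    have "mi_abs \<alpha> \<le> m" "mi_abs \<alpha> < m \<or> mi_abs \<gamma> > 0"
    proof -
      show "mi_abs \<alpha> \<le> m" using z by simp
      have "\<gamma> = 0" if "mi_abs \<gamma> = 0" using that by (simp add: mi_abs_def vec_eq_iff)
      then show "mi_abs \<alpha> < m \<or> mi_abs \<gamma> > 0" using z by auto
    qed
    then have "int (mi_abs \<alpha>) + (s - int (mi_abs \<gamma>)) \<le> s + int m - 1" by linarith
    from symbol_cmult[OF symbol_mult_le[OF symbol_imon symbol_twists[OF assms(1)] this], of "q \<alpha> \<gamma>"]
    show "symbol B (s + int m - 1) (\<lambda>t \<xi>. case z of (\<alpha>, \<gamma>) \<Rightarrow> q \<alpha> \<gamma> * (imon \<alpha> \<xi> * twists \<gamma> a t \<xi>))" by simp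
  qed
qed

lemma (in symbol_base) op_symbol_add:
  assumes "symbol B r a" "symbol B s b"
  shows "op_symbol m M q (\<lambda>t \<xi>. a t \<xi> + b t \<xi>) t \<xi> = op_symbol m M q a t \<xi> + op_symbol m M q b t \<xi>"
  unfolding op_symbol_def twists_add[OF assms] sum.distrib[symmetric]
  by (rule sum.cong) (auto simp: algebra_simps)

text \<open>The choice a = Q cnj P / (1 + |P|^2) gives P a - Q = -Q / (1 + |P|^2), of order d - 2m
  and hence at most d - 1. The non-principal part of the operator contributes another error of order
  d - 1.\<close>

lemma parametrix_step:
  fixes q :: "nat ^ 'n::finite \<Rightarrow> nat ^ 'n \<Rightarrow> complex"
  defines "c \<equiv> (\<lambda>\<alpha>. q \<alpha> 0)"
  assumes ell: "\<And>\<xi> :: real ^ 'n. \<xi> \<noteq> 0 \<Longrightarrow> princ m c \<xi> \<noteq> 0" and "m \<ge> 1" "M > 0"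
    and Q: "symbol (ell_base m c) d Q"
  shows "\<exists>a. symbol (ell_base m c) (d - int m) a \<and>
    symbol (ell_base m c) (d - 1) (\<lambda>t \<xi>. symbol_base.op_symbol m M q a t \<xi> - Q t \<xi>)"
proof -
  interpret symbol_base "ell_base m c" by (rule symbol_base_elliptic) (rule ell)
  let ?inv = "\<lambda>\<xi>. inverse (1 + princ m c \<xi> * cnj (princ m c \<xi>))"
  have inv: "symbol (ell_base m c) (- 2 * int m) (\<lambda>t. ?inv)"
    by (rule symbol.base) (simp add: ell_base_def)
  define a where "a = (\<lambda>t \<xi>. Q t \<xi> * (cnj (princ m c \<xi>) * ?inv \<xi>))"
  have a: "symbol (ell_base m c) (d - int m) a"
    unfolding a_def by (rule symbol_mult_le[OF Q symbol.mult[OF symbol_cnj_princ inv]]) simp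
  have "1 + princ m c \<xi> * cnj (princ m c \<xi>) \<noteq> 0" for \<xi>
  proof -
    have "1 + princ m c \<xi> * cnj (princ m c \<xi>) = complex_of_real (1 + (norm (princ m c \<xi>))\<^sup>2)"
      by (simp only: of_real_add of_real_1 complex_norm_square)
    moreover have "1 + (norm (princ m c \<xi>))\<^sup>2 \<noteq> 0" using zero_le_power2[of "norm (princ m c \<xi>)"] by argo
    ultimately show ?thesis by (simp only: of_real_eq_0_iff not_False_eq_True)
  qed
  then have eq: "princ m c \<xi> * a t \<xi> - Q t \<xi> = - 1 * (Q t \<xi> * ?inv \<xi>)" for t \<xi>
    by (simp add: a_def field_simps)
  have 1: "symbol (ell_base m c) (d - 1) (\<lambda>t \<xi>. op_symbol m M q a t \<xi> - princ m c \<xi> * a t \<xi>)"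
    using op_symbol_principal[OF a assms(4), of m q] by (simp add: c_def)
  have 2: "symbol (ell_base m c) (d - 1) (\<lambda>t \<xi>. - 1 * (Q t \<xi> * ?inv \<xi>))"
    by (rule symbol_cmult, rule symbol_mult_le[OF Q inv]) (use assms(3) in simp)
  have "op_symbol m M q a t \<xi> - Q t \<xi> = (op_symbol m M q a t \<xi> - princ m c \<xi> * a t \<xi>) + - 1 * (Q t \<xi> * ?inv \<xi>)" for t \<xi>
    unfolding eq[symmetric] by simp
  then have "symbol (ell_base m c) (d - 1) (\<lambda>t \<xi>. op_symbol m M q a t \<xi> - Q t \<xi>)"
    using symbol.add[OF 1 2] by (simp only:)
  with a show ?thesis by blast
qed

text \<open>Iterated correction: the step is applied to minus the current error, and the result is
  added to the approximate solution. By linearity of \<open>op_symbol\<close> the new error is that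
  of the step, one order lower.\<close>

lemma parametrix:
  fixes q :: "nat ^ 'n::finite \<Rightarrow> nat ^ 'n \<Rightarrow> complex"
  defines "c \<equiv> (\<lambda>\<alpha>. q \<alpha> 0)"
  assumes ell: "\<And>\<xi> :: real ^ 'n. \<xi> \<noteq> 0 \<Longrightarrow> princ m c \<xi> \<noteq> 0" and "m \<ge> 1" "M > 0"
    and Q: "symbol (ell_base m c) d Q"
  shows "\<exists>a. symbol (ell_base m c) (d - int m) a \<and>
    symbol (ell_base m c) (d - int N) (\<lambda>t \<xi>. symbol_base.op_symbol m M q a t \<xi> - Q t \<xi>)"
proof (induction N)
  case 0
  obtain a where a: "symbol (ell_base m c) (d - int m) a"
    "symbol (ell_base m c) (d - 1) (\<lambda>t \<xi>. symbol_base.op_symbol m M q a t \<xi> - Q t \<xi>)"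
    using parametrix_step[where q = q and m = m and M = M and d = d and Q = Q, OF _ assms(3,4)] ell Q unfolding c_def by blast
  from a(1) symbol.weaken[OF a(2), of "d - int 0"] show ?case by auto
next
  case (Suc N)
  interpret symbol_base "ell_base m c" by (rule symbol_base_elliptic) (rule ell)
  from Suc obtain a where a: "symbol (ell_base m c) (d - int m) a"
    "symbol (ell_base m c) (d - int N) (\<lambda>t \<xi>. op_symbol m M q a t \<xi> - Q t \<xi>)" by blast
  let ?Q = "\<lambda>t \<xi>. - 1 * (op_symbol m M q a t \<xi> - Q t \<xi>)"
  have "symbol (ell_base m c) (d - int N) ?Q" by (rule symbol_cmult[OF a(2)])
  then obtain b where b: "symbol (ell_base m c) (d - int N - int m) b"
    "symbol (ell_base m c) (d - int N - 1) (\<lambda>t \<xi>. op_symbol m M q b t \<xi> - ?Q t \<xi>)"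
    using parametrix_step[where q = q and m = m and M = M and d = "d - int N" and Q = ?Q, OF _ assms(3,4)] ell unfolding c_def by blast
  have b': "symbol (ell_base m c) (d - int m) b" by (rule symbol.weaken[OF b(1)]) simp
  have "op_symbol m M q (\<lambda>t \<xi>. a t \<xi> + b t \<xi>) t \<xi> - Q t \<xi> = op_symbol m M q b t \<xi> - ?Q t \<xi>" for t \<xi>
    unfolding op_symbol_add[OF a(1) b'] by simp
  moreover have "d - int (Suc N) = d - int N - 1" by simp
  ultimately show ?case using symbol.add[OF a(1) b'] b(2) by (intro exI[of _ "\<lambda>t \<xi>. a t \<xi> + b t \<xi>"] conjI) (simp_all only:)
qed

section \<open>The interior estimate\<close>

definition supported :: "real ^ 'n::finite \<Rightarrow> real \<Rightarrow> (real ^ 'n \<Rightarrow> complex) \<Rightarrow> bool" where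
  "supported p r f \<longleftrightarrow> (\<forall>x. norm (x - p) > r \<longrightarrow> f x = 0)"

lemma supported_partial: "supported p r f \<Longrightarrow> supported p r (partial i f)"
  unfolding supported_def
proof (intro allI impI)
  fix x assume f: "\<forall>x. norm (x - p) > r \<longrightarrow> f x = 0" and x: "norm (x - p) > r"
  have "open {x. norm (x - p) > r}" by (intro open_Collect_less continuous_intros)
  then have "partial i f x = partial i (\<lambda>x. 0) x"
    using f x by (intro partial_cong_open[of "{x. norm (x - p) > r}"]) auto
  then show "partial i f x = 0" using partial_eq_imp_partial[OF partial_eq_const] by simp
qed

lemma mi_deriv_0: "mi_deriv 0 f = f"
proof -
  have "foldr (\<lambda>i. partial i ^^ ((0 :: nat ^ 'a) $ i)) is f = f" for "is" by (induction "is") simp_all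
  then show ?thesis by (simp add: mi_deriv_def)
qed

lemma supported_mi_deriv: "supported p r f \<Longrightarrow> supported p r (mi_deriv \<alpha> f)"
  by (rule mi_deriv_rel[where R = "\<lambda>f g h. supported p r f"]) (simp_all add: supported_partial)

text \<open>Converts a bound on a ball into a bound by the weight, at the price of the constant (1 +
  |p| + r)^(2n).\<close>

lemma wt_ge_on_ball:
  fixes p :: "real ^ 'n::finite"
  assumes "norm (x - p) \<le> r"
  shows "1 \<le> (1 + norm p + r) ^ (2 * CARD('n)) * wt x"
proof -
  have "norm x \<le> norm p + r" using norm_triangle_sub[of x p] assms by argo
  then have "(1 + norm x) ^ (2 * CARD('n)) \<le> (1 + norm p + r) ^ (2 * CARD('n))"
    by (intro power_mono) simp_all
  moreover have "(1 + norm x) ^ (2 * CARD('n)) > 0" by (intro zero_less_power add_pos_nonneg) simp_all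
  ultimately show ?thesis by (simp add: wt_def field_simps)
qed

lemma supported_le_wt:
  fixes p :: "real ^ 'n::finite"
  assumes "supported p r f" "\<And>x. norm (f x) \<le> C"
  shows "norm (f x) \<le> C * (1 + norm p + r) ^ (2 * CARD('n)) * wt x"
proof (cases "norm (x - p) \<le> r")
  case True
  have "0 \<le> C" using order_trans[OF norm_ge_zero assms(2)] .
  from mult_left_mono[OF wt_ge_on_ball[OF True] this] assms(2)[of x] show ?thesis by (simp add: mult.assoc)
next
  case False
  have "0 \<le> C" using order_trans[OF norm_ge_zero assms(2)] .
  show ?thesis
  proof (cases "1 + norm p + r \<ge> 0")
    case True
    then show ?thesis using \<open>0 \<le> C\<close> False assms(1) wt_pos[of x] by (simp add: supported_def)
  next
    \<comment> \<open>The radius may be so negative that the base of the power is negative; the even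
      exponent keeps the right-hand side nonnegative.\<close>
    case neg: False
    then show ?thesis using \<open>0 \<le> C\<close> False assms(1) wt_pos[of x]
      by (simp add: supported_def power_mult zero_le_power)
  qed
qed

lemma smooth_supported_bounded:
  assumes "smooth_on UNIV f" "supported p r f"
  obtains C where "C \<ge> 0" "\<And>x. norm (f x) \<le> C"
proof -
  have "compact (f ` cball p r)"
    using continuous_on_subset[OF smooth_on_imp_continuous_on[OF assms(1)]]
    by (intro compact_continuous_image) auto
  then obtain C where C: "C > 0" "\<And>x. x \<in> cball p r \<Longrightarrow> norm (f x) \<le> C"
    using compact_imp_bounded bounded_pos by (metis imageI)
  have "norm (f x) \<le> C" for x
  proof (cases "x \<in> cball p r")
    case False
    then have "f x = 0" using assms(2) by (simp add: supported_def dist_norm norm_minus_commute)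
    then show ?thesis using C(1) by simp
  qed (use C in simp)
  with C(1) show ?thesis by (intro that[of C]) simp_all
qed

lemma wt_bounded_supported:
  assumes "smooth_on UNIV f" "supported p r f"
  shows "wt_bounded f"
proof -
  obtain C where "\<And>x. norm (f x) \<le> C" using smooth_supported_bounded[OF assms] by blast
  from supported_le_wt[OF assms(2) this] smooth_on_imp_continuous_on[OF assms(1)]
  show ?thesis by (intro wt_boundedI)
qed

lemma pairing_bound:
  fixes p :: "real ^ 'n::finite"
  assumes "wt_bounded b" "f \<in> borel_measurable borel" "\<And>x. norm (f x * FT p b x) \<le> C * wt x"
  shows "norm (pairing p b f) \<le> C * (LINT x|lborel. wt (x :: real ^ 'n))"
proof -
  have "integrable lborel (\<lambda>x. f x * FT p b x)"
    using assms(2) FT_measurable[OF assms(1)] by (intro integrable_wt_dominated[OF _ assms(3)]) simp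
  then have "norm (pairing p b f) \<le> (LINT x|lborel. C * wt (x :: real ^ 'n))"
    unfolding pairing_def by (rule Bochner_Integration.integral_norm_bound_integral) (simp_all add: integrable_wt assms(3))
  then show ?thesis by simp
qed

lemma integrable_pairing:
  fixes p :: "real ^ 'n::finite"
  assumes "wt_bounded b" "wt_bounded f"
  shows "integrable lborel (\<lambda>x. f x * FT p b x)"
proof -
  obtain K where K: "K \<ge> 0" "\<And>\<xi>. norm (b \<xi>) \<le> K * wt \<xi>" using wt_boundedE[OF assms(1)] by blast
  obtain L where L: "L \<ge> 0" "\<And>x. norm (f x) \<le> L * wt x" using wt_boundedE[OF assms(2)] by blast
  let ?W = "LINT x|lborel. wt (x :: real ^ 'n)"
  show ?thesis
  proof (rule integrable_wt_dominated)
    show "(\<lambda>x. f x * FT p b x) \<in> borel_measurable borel"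
      using wt_bounded_measurable[OF assms(2)] FT_measurable[OF assms(1)] by simp
    show "norm (f x * FT p b x) \<le> (L * (K * ?W)) * wt x" for x
    proof -
      have "norm (f x) * norm (FT p b x) \<le> (L * wt x) * (K * ?W)"
        using L wt_pos[of x] by (intro mult_mono FT_bound[OF assms(1) K(2)]) simp_all
      then show ?thesis by (simp add: norm_mult mult_ac)
    qed
  qed
qed

lemma pairing_lincomb:
  assumes "wt_bounded b" "\<And>j. j \<in> A \<Longrightarrow> wt_bounded (f j)"
  shows "pairing p b (\<lambda>x. \<Sum>j\<in>A. k j * f j x) = (\<Sum>j\<in>A. k j * pairing p b (f j))"
proof -
  have "pairing p b (\<lambda>x. \<Sum>j\<in>A. k j * f j x) = (LINT x|lborel. (\<Sum>j\<in>A. k j * (f j x * FT p b x)))"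
    unfolding pairing_def by (simp add: sum_distrib_right mult.assoc)
  also have "\<dots> = (\<Sum>j\<in>A. LINT x|lborel. k j * (f j x * FT p b x))"
    using integrable_pairing[OF assms(1) assms(2)] by (intro Bochner_Integration.integral_sum integrable_mult_right)
  also have "\<dots> = (\<Sum>j\<in>A. k j * pairing p b (f j))"
    unfolding pairing_def by (simp only: integral_mult_right_zero)
  finally show ?thesis .
qed

lemma pairing_freq_lincomb:
  assumes "\<And>j. j \<in> A \<Longrightarrow> wt_bounded (b j)" "wt_bounded f"
  shows "pairing p (\<lambda>\<xi>. \<Sum>j\<in>A. k j * b j \<xi>) f = (\<Sum>j\<in>A. k j * pairing p (b j) f)"
proof -
  have "FT p (\<lambda>\<xi>. \<Sum>j\<in>A. k j * b j \<xi>) x = (\<Sum>j\<in>A. k j * FT p (b j) x)" for x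
  proof -
    have "FT p (\<lambda>\<xi>. \<Sum>j\<in>A. k j * b j \<xi>) x = (LINT \<xi>|lborel. (\<Sum>j\<in>A. k j * (b j \<xi> * wave p \<xi> x)))"
      unfolding FT_def by (simp add: sum_distrib_right mult.assoc)
    also have "\<dots> = (\<Sum>j\<in>A. LINT \<xi>|lborel. k j * (b j \<xi> * wave p \<xi> x))"
      using wt_bounded_integrable[OF wt_bounded_wave[OF assms(1)]]
      by (intro Bochner_Integration.integral_sum integrable_mult_right)
    also have "\<dots> = (\<Sum>j\<in>A. k j * FT p (b j) x)" unfolding FT_def by (simp only: integral_mult_right_zero)
    finally show ?thesis .
  qed
  then have "pairing p (\<lambda>\<xi>. \<Sum>j\<in>A. k j * b j \<xi>) f = (LINT x|lborel. (\<Sum>j\<in>A. k j * (f x * FT p (b j) x)))"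
    unfolding pairing_def by (simp add: sum_distrib_left mult_ac)
  also have "\<dots> = (\<Sum>j\<in>A. LINT x|lborel. k j * (f x * FT p (b j) x))"
    using integrable_pairing[OF assms(1) assms(2)] by (intro Bochner_Integration.integral_sum integrable_mult_right)
  also have "\<dots> = (\<Sum>j\<in>A. k j * pairing p (b j) f)"
    unfolding pairing_def by (simp only: integral_mult_right_zero)
  finally show ?thesis .
qed

lemma (in symbol_base) pairing_partial_pow:
  assumes "symbol B s a" "0 < t" "t \<le> 1" "smooth_on UNIV f" "supported p r f"
  shows "pairing p' (smoothed a t) ((partial i ^^ k) f) =
    pairing p' (smoothed (\<lambda>t \<xi>. (\<i> * complex_of_real (\<xi> $ i)) ^ k * a t \<xi>) t) f"
  using assms(1,4,5)
proof (induction k arbitrary: s a f)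
  case (Suc k)
  have "smooth_on UNIV ((partial i ^^ k) f) \<and> supported p r ((partial i ^^ k) f)"
    using Suc.prems(2,3) by (induction k) (simp_all add: smooth_on_partial supported_partial)
  then have *: "smooth_on UNIV ((partial i ^^ k) f)" "supported p r ((partial i ^^ k) f)" by blast+
  have "pairing p' (smoothed a t) (partial i ((partial i ^^ k) f)) =
      pairing p' (smoothed (\<lambda>t \<xi>. \<i> * complex_of_real (\<xi> $ i) * a t \<xi>) t) ((partial i ^^ k) f)"
    using * by (intro pairing_smoothed_partial[OF Suc.prems(1) assms(2,3)])
      (auto intro: wt_bounded_supported[of _ p r] smooth_on_partial supported_partial smooth_on_partial_eq)
  also have "\<dots> = pairing p' (smoothed (\<lambda>t \<xi>. (\<i> * complex_of_real (\<xi> $ i)) ^ k * (\<i> * complex_of_real (\<xi> $ i) * a t \<xi>)) t) f"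
    by (rule Suc.IH[OF symbol.mult[OF symbol_cmult[OF symbol.coord] Suc.prems(1)] Suc.prems(2,3)])
  finally show ?case by (simp only: funpow.simps o_apply power_Suc2 mult.assoc)
qed simp

lemma (in symbol_base) pairing_mi_deriv:
  assumes "symbol B s a" "0 < t" "t \<le> 1" "smooth_on UNIV f" "supported p r f"
  shows "pairing p' (smoothed a t) (mi_deriv \<alpha> f) = pairing p' (smoothed (\<lambda>t \<xi>. imon \<alpha> \<xi> * a t \<xi>) t) f"
proof -
  have "distinct is \<Longrightarrow> symbol B s a \<Longrightarrow>
      pairing p' (smoothed a t) (foldr (\<lambda>i. partial i ^^ (\<alpha> $ i)) is f) =
      pairing p' (smoothed (\<lambda>t \<xi>. (\<Prod>i\<in>set is. (\<i> * complex_of_real (\<xi> $ i)) ^ (\<alpha> $ i)) * a t \<xi>) t) f" for "is" s a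
  proof (induction "is" arbitrary: s a)
    case (Cons i "is")
    let ?g = "foldr (\<lambda>i. partial i ^^ (\<alpha> $ i)) is f"
    have pow: "smooth_on UNIV ((partial j ^^ k) h) \<and> supported p r ((partial j ^^ k) h)"
      if "smooth_on UNIV h \<and> supported p r h" for j k h
      using that by (induction k) (simp_all add: smooth_on_partial supported_partial)
    have "smooth_on UNIV ?g \<and> supported p r ?g"
      using assms(4,5) by (induction "is") (simp_all add: pow)
    then have g: "smooth_on UNIV ?g" "supported p r ?g" by blast+
    have sym: "symbol B (int (\<alpha> $ i) * 1 + s) (\<lambda>t \<xi>. (\<i> * complex_of_real (\<xi> $ i)) ^ (\<alpha> $ i) * a t \<xi>)"
      by (rule symbol.mult[OF symbol_power[OF symbol_cmult[OF symbol.coord]] Cons.prems(2)])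
    have "pairing p' (smoothed a t) ((partial i ^^ (\<alpha> $ i)) ?g) =
        pairing p' (smoothed (\<lambda>t \<xi>. (\<i> * complex_of_real (\<xi> $ i)) ^ (\<alpha> $ i) * a t \<xi>) t) ?g"
      by (rule pairing_partial_pow[OF Cons.prems(2) assms(2,3) g])
    also have "\<dots> = pairing p' (smoothed (\<lambda>t \<xi>. (\<Prod>i\<in>set is. (\<i> * complex_of_real (\<xi> $ i)) ^ (\<alpha> $ i)) *
        ((\<i> * complex_of_real (\<xi> $ i)) ^ (\<alpha> $ i) * a t \<xi>)) t) f"
      using Cons.prems(1) by (intro Cons.IH[OF _ sym]) simp
    finally show ?case using Cons.prems(1) by (simp add: mult_ac)
  qed simp
  from this[OF distinct_axes assms(1)] show ?thesis
    by (simp add: mi_deriv_def set_axes imon_def)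
qed

lemma (in symbol_base) pairing_mon:
  assumes "symbol B s a" "0 < t" "t \<le> 1"
  shows "pairing p (smoothed a t) (\<lambda>x. mon p \<gamma> x * f x) = pairing p (smoothed (twists \<gamma> a) t) f"
  unfolding pairing_def FT_twists[OF assms, symmetric] by (simp add: mult_ac)

text \<open>The kernel of a symbol can be singular only at p, at a rate fixed by its order: M twists
  in one coordinate lower the order to -2n, where the transform is bounded uniformly in t.\<close>

lemma (in symbol_base) FT_decay:
  fixes p :: "real ^ 'n"
  assumes "symbol B s a" "s - int M \<le> - int (2 * CARD('n))"
  obtains K where "K \<ge> 0" "\<And>t x. 0 < t \<Longrightarrow> t \<le> 1 \<Longrightarrow> norm (x - p) ^ M * norm (FT p (smoothed a t) x) \<le> K"
proof -
  let ?W = "LINT x|lborel. wt (x :: real ^ 'n)"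
  have "\<exists>K\<ge>0. \<forall>t \<xi>. 0 < t \<longrightarrow> t \<le> 1 \<longrightarrow> norm (smoothed ((twist i ^^ M) a) t \<xi>) \<le> K * wt \<xi>" for i
    using smoothed_uniform_bound[OF symbol_twist_pow[OF assms(1)] assms(2)] by metis
  then obtain K where K: "\<And>i. K i \<ge> 0" "\<And>i t \<xi>. 0 < t \<Longrightarrow> t \<le> 1 \<Longrightarrow> norm (smoothed ((twist i ^^ M) a) t \<xi>) \<le> K i * wt \<xi>"
    by metis
  have W: "?W \<ge> 0" by (intro Bochner_Integration.integral_nonneg) (simp add: less_imp_le[OF wt_pos])
  show ?thesis
  proof (rule that[of "real CARD('n) ^ M * (\<Sum>i\<in>UNIV. K i * ?W)"])
    show "0 \<le> real CARD('n) ^ M * (\<Sum>i\<in>UNIV. K i * ?W)"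
      using K(1) W by (intro mult_nonneg_nonneg sum_nonneg) simp_all
    fix t :: real and x :: "real ^ 'n" assume t: "0 < t" "t \<le> 1"
    have i: "\<bar>x $ i - p $ i\<bar> ^ M * norm (FT p (smoothed a t) x) \<le> K i * ?W" for i
    proof -
      have "\<bar>x $ i - p $ i\<bar> ^ M * norm (FT p (smoothed a t) x) =
          norm (complex_of_real ((x $ i - p $ i) ^ M) * FT p (smoothed a t) x)"
        by (simp only: norm_mult norm_of_real power_abs)
      also have "\<dots> \<le> K i * ?W"
        unfolding FT_twist_pow[OF assms(1) t]
        by (rule FT_bound[OF wt_bounded_smoothed[OF symbol_twist_pow[OF assms(1)] t] K(2)[OF t]])
      finally show ?thesis .
    qed
    \<comment> \<open>The largest coordinate of x - p: the norm is at most n \<mu>, so the twist in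
      that single direction controls |x - p|^M.\<close>
    define \<mu> where "\<mu> = Max (range (\<lambda>i. \<bar>x $ i - p $ i\<bar>))"
    have le: "\<bar>x $ i - p $ i\<bar> \<le> \<mu>" for i unfolding \<mu>_def by (intro Max_ge) auto
    have "\<mu> \<in> range (\<lambda>i. \<bar>x $ i - p $ i\<bar>)" unfolding \<mu>_def by (intro Max_in) auto
    then obtain j where j: "\<mu> = \<bar>x $ j - p $ j\<bar>" by blast
    have "norm (x - p) \<le> (\<Sum>i\<in>UNIV. \<bar>(x - p) $ i\<bar>)" by (rule norm_le_l1_cart)
    also have "\<dots> \<le> (\<Sum>i::'n\<in>UNIV. \<mu>)" using le by (intro sum_mono) simp
    finally have "norm (x - p) ^ M \<le> (real CARD('n) * \<mu>) ^ M" by (intro power_mono) simp_all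
    then have "norm (x - p) ^ M * norm (FT p (smoothed a t) x) \<le> (real CARD('n) * \<mu>) ^ M * norm (FT p (smoothed a t) x)"
      by (rule mult_right_mono) simp
    also have "\<dots> = real CARD('n) ^ M * (\<mu> ^ M * norm (FT p (smoothed a t) x))"
      by (simp add: power_mult_distrib)
    also have "\<dots> \<le> real CARD('n) ^ M * (\<Sum>i\<in>UNIV. K i * ?W)"
    proof (rule mult_left_mono)
      have "\<mu> ^ M * norm (FT p (smoothed a t) x) \<le> K j * ?W" unfolding j by (rule i)
      also have "\<dots> \<le> (\<Sum>i\<in>UNIV. K i * ?W)" using K(1) W by (intro member_le_sum) simp_all
      finally show "\<mu> ^ M * norm (FT p (smoothed a t) x) \<le> (\<Sum>i\<in>UNIV. K i * ?W)" .
    qed simp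
    finally show "norm (x - p) ^ M * norm (FT p (smoothed a t) x) \<le> real CARD('n) ^ M * (\<Sum>i\<in>UNIV. K i * ?W)" .
  qed
qed

text \<open>Let G be the truncated operator applied to f. The parametrix gives <a, G> = <Q, f> + <R,
  f>, where Q is the symbol of the k-th derivative along j and R has order -2n. G is bounded by N |x
  - p|^M, which cancels the singularity of the kernel of a, so <a, G> and <R, f> are bounded by
  multiples of N uniformly in t. As t -> 0, <Q, f> tends to (2 \<pi>)^n times the derivative at
  p.\<close>

lemma interior_estimate:
  fixes p :: "real ^ 'n::finite" and A :: "nat ^ 'n \<Rightarrow> real ^ 'n \<Rightarrow> complex"
  assumes m: "m \<ge> 1"
    and ps: "\<And>\<alpha>. mi_abs \<alpha> \<le> m \<Longrightarrow> ps_conv r0 (c \<alpha>)" "\<And>\<alpha> x. mi_abs \<alpha> \<le> m \<Longrightarrow> x \<in> cube p r0 \<Longrightarrow> A \<alpha> x = ps p (c \<alpha>) x"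
    and ell: "\<And>\<xi> :: real ^ 'n. \<xi> \<noteq> 0 \<Longrightarrow> (\<Sum>\<alpha> | mi_abs \<alpha> = m. c \<alpha> 0 * complex_of_real (mi_power \<xi> \<alpha>)) \<noteq> 0"
    and r: "0 < r" "r < r0"
  obtains K where "\<And>f N. smooth_on UNIV f \<Longrightarrow> supported p r f \<Longrightarrow>
    (\<And>x. norm (x - p) < r / 2 \<Longrightarrow> diff_op m A f x = 0) \<Longrightarrow>
    (\<And>\<alpha> x. mi_abs \<alpha> \<le> m \<Longrightarrow> norm (mi_deriv \<alpha> f x) \<le> N) \<Longrightarrow> norm ((partial j ^^ k) f p) \<le> K * N"
proof -
  define e where "e = (\<lambda>\<alpha>. c \<alpha> 0)"
  let ?n = "CARD('n)"
  let ?W = "LINT x|lborel. wt (x :: real ^ 'n)"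
  let ?\<A> = "{\<alpha> :: nat ^ 'n. mi_abs \<alpha> \<le> m}"
  \<comment> \<open>The order k - m of the parametrix drops to -2n or below after M twists, as
    \<open>FT_decay\<close> requires. The final + 1 ensures M > 0, so that the constant Taylor terms
    are retained.\<close>
  define M where "M = nat (int k - int m + int (2 * ?n)) + 1"
  let ?\<G> = "{\<gamma> :: nat ^ 'n. mi_abs \<gamma> < M}"
  have princ_nz: "princ m e \<xi> \<noteq> 0" if "\<xi> \<noteq> 0" for \<xi> :: "real ^ 'n"
    using ell[OF that] by (simp add: princ_eq e_def)
  interpret symbol_base "ell_base m e" by (rule symbol_base_elliptic) (rule princ_nz)
  define Q where "Q = (\<lambda>(t::real) (\<xi> :: real ^ 'n). (\<i> * complex_of_real (\<xi> $ j)) ^ k)"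
  have Q: "symbol (ell_base m e) (int k) Q"
    using symbol_power[OF symbol_cmult[OF symbol.coord, of "ell_base m e" \<i> j], of k] by (simp add: Q_def)
  \<comment> \<open>N = k + 2n corrections bring the error from order k to order -2n, where smoothed
    symbols are dominated by the weight uniformly in t.\<close>
  obtain a where a: "symbol (ell_base m e) (int k - int m) a"
    and R: "symbol (ell_base m e) (int k - int (k + 2 * ?n)) (\<lambda>t \<xi>. op_symbol m M c a t \<xi> - Q t \<xi>)"
    using parametrix[where q = c and m = m and M = M and N = "k + 2 * ?n" and d = "int k" and Q = Q] princ_nz m Q
    unfolding e_def M_def by auto
  define R where "R = (\<lambda>t \<xi>. op_symbol m M c a t \<xi> - Q t \<xi>)"
  have M: "int k - int m - int M \<le> - int (2 * ?n)" unfolding M_def by linarith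
  obtain K1 where K1: "K1 \<ge> 0" "\<And>t x. 0 < t \<Longrightarrow> t \<le> 1 \<Longrightarrow> norm (x - p) ^ M * norm (FT p (smoothed a t) x) \<le> K1"
    using FT_decay[OF a M, of p] by blast
  have R_le: "int k - int (k + 2 * ?n) \<le> - int (2 * ?n)" by simp
  obtain K2 where K2: "K2 \<ge> 0" "\<And>t \<xi>. 0 < t \<Longrightarrow> t \<le> 1 \<Longrightarrow> norm (smoothed R t \<xi>) \<le> K2 * wt \<xi>"
    using smoothed_uniform_bound[OF R[folded R_def] R_le] by blast
  have rem: "\<exists>K. K \<ge> 0 \<and> (\<forall>x. norm (x - p) \<le> r \<longrightarrow>
      norm (ps p (c \<alpha>) x - (\<Sum>\<gamma> | mi_abs \<gamma> < L. c \<alpha> \<gamma> * mon p \<gamma> x)) \<le> K * norm (x - p) ^ L)"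
    if "\<alpha> \<in> ?\<A>" for \<alpha> L
  proof -
    have pc: "ps_conv r0 (c \<alpha>)" using ps(1) that by simp
    show ?thesis
    proof (rule ps_remainder[OF pc r, of p L])
      fix K :: real
      assume K: "0 \<le> K" "\<And>x. norm (x - p) \<le> r \<Longrightarrow>
        norm (ps p (c \<alpha>) x - (\<Sum>\<gamma> | mi_abs \<gamma> < L. c \<alpha> \<gamma> * mon p \<gamma> x)) \<le> K * norm (x - p) ^ L"
      show ?thesis by (rule exI[of _ K]) (use K in simp)
    qed
  qed
  have "\<forall>\<alpha>\<in>?\<A>. \<exists>K. K \<ge> 0 \<and> (\<forall>x. norm (x - p) \<le> r \<longrightarrow>
      norm (ps p (c \<alpha>) x - (\<Sum>\<gamma>\<in>?\<G>. c \<alpha> \<gamma> * mon p \<gamma> x)) \<le> K * norm (x - p) ^ M)"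
    using rem[of _ M] by blast
  from bchoice[OF this] obtain K3 where K3': "\<forall>\<alpha>\<in>?\<A>. K3 \<alpha> \<ge> 0 \<and> (\<forall>x. norm (x - p) \<le> r \<longrightarrow>
      norm (ps p (c \<alpha>) x - (\<Sum>\<gamma>\<in>?\<G>. c \<alpha> \<gamma> * mon p \<gamma> x)) \<le> K3 \<alpha> * norm (x - p) ^ M)" ..
  have K3: "\<And>\<alpha>. \<alpha> \<in> ?\<A> \<Longrightarrow> K3 \<alpha> \<ge> 0" "\<And>\<alpha> x. \<alpha> \<in> ?\<A> \<Longrightarrow> norm (x - p) \<le> r \<Longrightarrow>
      norm (ps p (c \<alpha>) x - (\<Sum>\<gamma>\<in>?\<G>. c \<alpha> \<gamma> * mon p \<gamma> x)) \<le> K3 \<alpha> * norm (x - p) ^ M"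
    using K3' by blast+
  \<comment> \<open>For L = 0 the Taylor polynomial is empty, and the remainder estimate becomes a
    bound on the coefficient itself.\<close>
  have "\<forall>\<alpha>\<in>?\<A>. \<exists>K. K \<ge> 0 \<and> (\<forall>x. norm (x - p) \<le> r \<longrightarrow> norm (ps p (c \<alpha>) x) \<le> K)"
    using rem[of _ 0] by simp
  from bchoice[OF this] obtain K4 where K4': "\<forall>\<alpha>\<in>?\<A>. K4 \<alpha> \<ge> 0 \<and> (\<forall>x. norm (x - p) \<le> r \<longrightarrow> norm (ps p (c \<alpha>) x) \<le> K4 \<alpha>)" ..
  have K4: "\<And>\<alpha>. \<alpha> \<in> ?\<A> \<Longrightarrow> K4 \<alpha> \<ge> 0" "\<And>\<alpha> x. \<alpha> \<in> ?\<A> \<Longrightarrow> norm (x - p) \<le> r \<Longrightarrow> norm (ps p (c \<alpha>) x) \<le> K4 \<alpha>"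
    using K4' by blast+
  \<comment> \<open>The first summand treats |x - p| at least r/2, where L f need not vanish but 1
    is at most (2 |x - p| / r)^M. The second is the Taylor remainder of the coefficients.\<close>
  define K5 where "K5 = (\<Sum>\<alpha>\<in>?\<A>. K4 \<alpha>) * (2 / r) ^ M + (\<Sum>\<alpha>\<in>?\<A>. K3 \<alpha>)"
  define W' where "W' = (1 + norm p + r) ^ (2 * ?n)"
  have K5: "K5 \<ge> 0" unfolding K5_def using K3(1) K4(1) r by (intro add_nonneg_nonneg mult_nonneg_nonneg sum_nonneg) simp_all
  have W': "W' \<ge> 0" unfolding W'_def using r by simp
  define K where "K = (K5 * K1 * W' * ?W + W' * (K2 * ?W) * ?W) / (2 * pi) ^ ?n"
  show ?thesis
  proof (rule that[of K])
    fix f :: "real ^ 'n \<Rightarrow> complex" and N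
    assume f: "smooth_on UNIV f" "supported p r f" and L: "\<And>x. norm (x - p) < r / 2 \<Longrightarrow> diff_op m A f x = 0"
      and N: "\<And>\<alpha> x. mi_abs \<alpha> \<le> m \<Longrightarrow> norm (mi_deriv \<alpha> f x) \<le> N"
    let ?D = "\<lambda>\<alpha>. mi_deriv \<alpha> f"
    have D: "smooth_on UNIV (?D \<alpha>)" "supported p r (?D \<alpha>)" for \<alpha>
      using f by (auto intro: smooth_on_mi_deriv supported_mi_deriv)
    have N0: "N \<ge> 0" using order_trans[OF norm_ge_zero N[of 0 p]] by (simp add: mi_abs_def)
    \<comment> \<open>L with its coefficients truncated at degree M, applied to f.\<close>
    define G where "G = (\<lambda>x. \<Sum>(\<alpha>, \<gamma>)\<in>?\<A> \<times> ?\<G>. c \<alpha> \<gamma> * (mon p \<gamma> x * ?D \<alpha> x))"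
    have tm: "smooth_on UNIV (\<lambda>x. mon p \<gamma> x * ?D \<alpha> x)" "supported p r (\<lambda>x. mon p \<gamma> x * ?D \<alpha> x)" for \<alpha> \<gamma>
      using D by (auto intro!: smooth_on_mult smooth_on_mon simp: supported_def)
    have G_smooth: "smooth_on UNIV G"
      unfolding G_def by (intro smooth_on_sum open_UNIV) (auto intro!: smooth_on_mult smooth_on_const tm)
    \<comment> \<open>G differs from L f by Taylor remainders, of size |x - p|^M; L f vanishes for
      |x - p| < r/2, and beyond this radius |x - p|^M is bounded below.\<close>
    have G_le: "norm (G x) \<le> K5 * N * norm (x - p) ^ M" for x
    proof (cases "norm (x - p) \<le> r")
      case True
      then have x: "x \<in> cube p r0" using r(2) ball_subset_cube[of p r0] by (auto simp: dist_norm norm_minus_commute)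
      have "G x = (\<Sum>\<alpha>\<in>?\<A>. (\<Sum>\<gamma>\<in>?\<G>. c \<alpha> \<gamma> * mon p \<gamma> x) * ?D \<alpha> x)"
        unfolding G_def by (simp add: sum.cartesian_product[symmetric] sum_distrib_right mult.assoc)
      also have "\<dots> = diff_op m A f x - (\<Sum>\<alpha>\<in>?\<A>. (ps p (c \<alpha>) x - (\<Sum>\<gamma>\<in>?\<G>. c \<alpha> \<gamma> * mon p \<gamma> x)) * ?D \<alpha> x)"
        unfolding diff_op_def sum_subtractf[symmetric] using ps(2)[OF _ x] by (intro sum.cong) (simp_all add: algebra_simps)
      finally have "norm (G x) \<le> norm (diff_op m A f x) +
          norm (\<Sum>\<alpha>\<in>?\<A>. (ps p (c \<alpha>) x - (\<Sum>\<gamma>\<in>?\<G>. c \<alpha> \<gamma> * mon p \<gamma> x)) * ?D \<alpha> x)"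
        by (simp add: norm_triangle_ineq4)
      moreover have "norm (\<Sum>\<alpha>\<in>?\<A>. (ps p (c \<alpha>) x - (\<Sum>\<gamma>\<in>?\<G>. c \<alpha> \<gamma> * mon p \<gamma> x)) * ?D \<alpha> x) \<le>
          (\<Sum>\<alpha>\<in>?\<A>. K3 \<alpha> * norm (x - p) ^ M * N)"
        using K3 N N0 True by (intro sum_norm_le) (auto simp: norm_mult intro!: mult_mono)
      moreover have "norm (diff_op m A f x) \<le> (\<Sum>\<alpha>\<in>?\<A>. K4 \<alpha>) * N * ((2 / r) ^ M * norm (x - p) ^ M)"
      proof (cases "norm (x - p) < r / 2")
        case True
        then have "norm (diff_op m A f x) = 0" using L by simp
        moreover have "0 \<le> (\<Sum>\<alpha>\<in>?\<A>. K4 \<alpha>) * N * ((2 / r) ^ M * norm (x - p) ^ M)"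
          using K4(1) N0 r(1) by (intro mult_nonneg_nonneg sum_nonneg zero_le_power) simp_all
        ultimately show ?thesis by (simp only:)
      next
        case False
        then have "1 \<le> (2 / r * norm (x - p)) ^ M" using r by (intro one_le_power) (simp add: field_simps)
        then have 1: "1 \<le> (2 / r) ^ M * norm (x - p) ^ M" by (simp only: power_mult_distrib)
        have "norm (diff_op m A f x) \<le> (\<Sum>\<alpha>\<in>?\<A>. K4 \<alpha> * N)"
          unfolding diff_op_def using K4 N N0 \<open>norm (x - p) \<le> r\<close> ps(2)[OF _ x]
          by (intro sum_norm_le) (auto simp: norm_mult intro!: mult_mono)
        also have "\<dots> = (\<Sum>\<alpha>\<in>?\<A>. K4 \<alpha>) * N" by (simp add: sum_distrib_right)
        also have "\<dots> \<le> (\<Sum>\<alpha>\<in>?\<A>. K4 \<alpha>) * N * ((2 / r) ^ M * norm (x - p) ^ M)"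
        proof -
          have "0 \<le> (\<Sum>\<alpha>\<in>?\<A>. K4 \<alpha>) * N" using K4(1) N0 by (intro mult_nonneg_nonneg sum_nonneg) simp_all
          from mult_left_mono[OF 1 this] show ?thesis by simp
        qed
        finally show ?thesis .
      qed
      ultimately have "norm (G x) \<le> (\<Sum>\<alpha>\<in>?\<A>. K4 \<alpha>) * N * ((2 / r) ^ M * norm (x - p) ^ M) + (\<Sum>\<alpha>\<in>?\<A>. K3 \<alpha> * norm (x - p) ^ M * N)"
        by argo
      also have "\<dots> = K5 * N * norm (x - p) ^ M"
        unfolding K5_def sum_distrib_right[symmetric] by (simp add: algebra_simps)
      finally show ?thesis .
    next
      case False
      then have "?D \<alpha> x = 0" for \<alpha> using D(2)[of \<alpha>] by (simp add: supported_def)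
      then have "G x = 0" unfolding G_def by (simp add: case_prod_unfold)
      then show ?thesis using K5 N0 by simp
    qed
    have G_supp: "supported p r G"
      unfolding G_def supported_def using D(2) by (auto simp: supported_def case_prod_unfold intro!: sum.neutral)
    have est: "norm (pairing p (smoothed Q t) f) \<le> (K5 * K1 * W' * ?W + W' * (K2 * ?W) * ?W) * N"
      if t: "0 < t" "t \<le> 1" for t
    proof -
      note wa = wt_bounded_smoothed[OF a t]
      have wf: "wt_bounded f" by (rule wt_bounded_supported[OF f])
      have wR: "wt_bounded (smoothed R t)" unfolding R_def by (rule wt_bounded_smoothed[OF R t])
      \<comment> \<open>The truncated operator is transposed term by term: factors (x - p)^\<gamma>
        become twists of a, derivatives D^\<alpha> become factors \<open>imon\<close>.\<close>
      have "pairing p (smoothed a t) G = (\<Sum>z\<in>?\<A> \<times> ?\<G>. c (fst z) (snd z) * pairing p (smoothed a t) (\<lambda>x. mon p (snd z) x * ?D (fst z) x))"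
        unfolding G_def case_prod_unfold
        by (rule pairing_lincomb[OF wa wt_bounded_supported[OF tm]])
      also have "\<dots> = (\<Sum>z\<in>?\<A> \<times> ?\<G>. c (fst z) (snd z) * pairing p (smoothed (\<lambda>t \<xi>. imon (fst z) \<xi> * twists (snd z) a t \<xi>) t) f)"
        by (simp only: pairing_mon[OF a t] pairing_mi_deriv[OF symbol_twists[OF a] t f])
      also have "\<dots> = pairing p (\<lambda>\<xi>. \<Sum>z\<in>?\<A> \<times> ?\<G>. c (fst z) (snd z) * smoothed (\<lambda>t \<xi>. imon (fst z) \<xi> * twists (snd z) a t \<xi>) t \<xi>) f"
        by (rule pairing_freq_lincomb[OF wt_bounded_smoothed[OF symbol.mult[OF symbol_imon symbol_twists[OF a]] t] wf, symmetric])
      \<comment> \<open>Q + R is written as a sum over a two-element index set so that the linearity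
        lemma for finite sums splits the pairing.\<close>
      also have "(\<lambda>\<xi>. \<Sum>z\<in>?\<A> \<times> ?\<G>. c (fst z) (snd z) * smoothed (\<lambda>t \<xi>. imon (fst z) \<xi> * twists (snd z) a t \<xi>) t \<xi>) =
          (\<lambda>\<xi>. \<Sum>z\<in>{0::nat, 1}. 1 * (if z = 0 then smoothed Q t else smoothed R t) \<xi>)"
      proof
        fix \<xi>
        have "(\<Sum>z\<in>?\<A> \<times> ?\<G>. c (fst z) (snd z) * smoothed (\<lambda>t \<xi>. imon (fst z) \<xi> * twists (snd z) a t \<xi>) t \<xi>) =
            op_symbol m M c a t \<xi> * complex_of_real (gauss t \<xi>)"
          unfolding smoothed_def op_symbol_def case_prod_unfold sum_distrib_right
          by (rule sum.cong) (simp_all only: mult.assoc)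
        also have "\<dots> = (Q t \<xi> + R t \<xi>) * complex_of_real (gauss t \<xi>)" by (simp add: R_def)
        finally show "(\<Sum>z\<in>?\<A> \<times> ?\<G>. c (fst z) (snd z) * smoothed (\<lambda>t \<xi>. imon (fst z) \<xi> * twists (snd z) a t \<xi>) t \<xi>) =
            (\<Sum>z\<in>{0::nat, 1}. 1 * (if z = 0 then smoothed Q t else smoothed R t) \<xi>)"
          by (simp add: smoothed_def distrib_right)
      qed
      also have "pairing p \<dots> f = pairing p (smoothed Q t) f + pairing p (smoothed R t) f"
        using wt_bounded_smoothed[OF Q t] wR by (subst pairing_freq_lincomb[OF _ wf]) auto
      finally have eq: "pairing p (smoothed Q t) f = pairing p (smoothed a t) G - pairing p (smoothed R t) f" by simp
      have "norm (pairing p (smoothed a t) G) \<le> (K5 * K1 * N) * W' * ?W"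
      proof (rule pairing_bound[OF wa])
        show "G \<in> borel_measurable borel" by (rule wt_bounded_measurable[OF wt_bounded_supported[OF G_smooth G_supp]])
        have "norm (G x * FT p (smoothed a t) x) \<le> K5 * K1 * N" for x
        proof -
          have "norm (G x) * norm (FT p (smoothed a t) x) \<le> (K5 * N * norm (x - p) ^ M) * norm (FT p (smoothed a t) x)"
            by (rule mult_right_mono[OF G_le]) simp
          also have "\<dots> = K5 * N * (norm (x - p) ^ M * norm (FT p (smoothed a t) x))" by simp
          also have "\<dots> \<le> K5 * N * K1" using K5 N0 by (intro mult_left_mono K1(2)[OF t]) simp
          finally show ?thesis by (simp add: norm_mult mult_ac)
        qed
        moreover have "supported p r (\<lambda>x. G x * FT p (smoothed a t) x)" using G_supp by (simp add: supported_def)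
        ultimately show "norm (G x * FT p (smoothed a t) x) \<le> (K5 * K1 * N) * W' * wt x" for x
          unfolding W'_def by (intro supported_le_wt)
      qed
      moreover have "norm (pairing p (smoothed R t) f) \<le> (N * (K2 * ?W)) * W' * ?W"
      proof (rule pairing_bound[OF wR wt_bounded_measurable[OF wf]])
        have "norm (f x * FT p (smoothed R t) x) \<le> N * (K2 * ?W)" for x
        proof -
          have "norm (f x) \<le> N" using N[of 0 x] by (simp add: mi_abs_def mi_deriv_0)
          then show ?thesis unfolding norm_mult using N0 by (intro mult_mono FT_bound[OF wR K2(2)[OF t]]) simp_all
        qed
        moreover have "supported p r (\<lambda>x. f x * FT p (smoothed R t) x)" using f(2) by (simp add: supported_def)
        ultimately show "norm (f x * FT p (smoothed R t) x) \<le> (N * (K2 * ?W)) * W' * wt x" for x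
          unfolding W'_def by (intro supported_le_wt)
      qed
      ultimately have "norm (pairing p (smoothed Q t) f) \<le> (K5 * K1 * N) * W' * ?W + (N * (K2 * ?W)) * W' * ?W"
        unfolding eq by (intro order_trans[OF norm_triangle_ineq4] add_mono)
      then show ?thesis by (simp add: algebra_simps)
    qed
    let ?g = "(partial j ^^ k) f"
    have g: "smooth_on UNIV ?g \<and> supported p r ?g"
      using f by (induction k) (simp_all add: smooth_on_partial supported_partial)
    define t where "t l = inverse (real (Suc l))" for l
    have t: "0 < t l" "t l \<le> 1" for l by (simp_all add: t_def inverse_le_1_iff)
    \<comment> \<open>Smoothing the constant symbol 1 gives the Gaussians approximating the point
      mass at p. Moving k derivatives from f to this symbol turns it into Q.\<close>
    have one: "symbol (ell_base m e) 0 (\<lambda>t \<xi>. 1)" by (rule symbol.const)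
    have smoothed_1: "smoothed (\<lambda>t \<xi>. 1) s = (\<lambda>\<xi>. complex_of_real (gauss s \<xi>))" for s
      by (simp add: smoothed_def[abs_def])
    have "(\<lambda>l. pairing p (\<lambda>\<xi>. complex_of_real (gauss (t l) \<xi>)) ?g) \<longlonglongrightarrow> complex_of_real ((2 * pi) ^ ?n) * ?g p"
    proof (rule pairing_gauss_tendsto)
      show "wt_bounded ?g" using g by (intro wt_bounded_supported[of _ p r]) blast+
      show "t \<longlonglongrightarrow> 0" using LIMSEQ_inverse_real_of_nat by (simp add: t_def[abs_def])
      show "wt_bounded (\<lambda>\<xi> :: real ^ 'n. complex_of_real (gauss (t l) \<xi>))" for l
        using wt_bounded_smoothed[OF one t] by (simp add: smoothed_1)
    qed (rule t)
    moreover have "pairing p (\<lambda>\<xi>. complex_of_real (gauss (t l) \<xi>)) ?g = pairing p (smoothed Q (t l)) f" for l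
      using pairing_partial_pow[OF one t f] by (simp add: smoothed_1 Q_def)
    ultimately have "(\<lambda>l. norm (pairing p (smoothed Q (t l)) f)) \<longlonglongrightarrow> norm (complex_of_real ((2 * pi) ^ ?n) * ?g p)"
      by (simp only: tendsto_norm)
    then have "norm (complex_of_real ((2 * pi) ^ ?n) * ?g p) \<le> (K5 * K1 * W' * ?W + W' * (K2 * ?W) * ?W) * N"
      by (rule LIMSEQ_le_const2) (use est t in blast)
    moreover have "norm (complex_of_real ((2 * pi) ^ ?n) * ?g p) = (2 * pi) ^ ?n * norm (?g p)"
      by (simp only: norm_mult norm_of_real) simp
    ultimately have "(2 * pi) ^ ?n * norm (?g p) \<le> (K5 * K1 * W' * ?W + W' * (K2 * ?W) * ?W) * N" by (simp only:)
    then show "norm (?g p) \<le> K * N"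
      unfolding K_def by (simp add: pos_le_divide_eq mult.commute)
  qed
qed

section \<open>Borel's lemma\<close>

primrec deriv_bound :: "nat \<Rightarrow> real \<Rightarrow> (real ^ 'n::finite \<Rightarrow> complex) \<Rightarrow> bool" where
  "deriv_bound 0 C f \<longleftrightarrow> (\<forall>x. norm (f x) \<le> C)"
| "deriv_bound (Suc k) C f \<longleftrightarrow> (\<forall>x. norm (f x) \<le> C) \<and> (\<forall>i. deriv_bound k C (partial i f))"

lemma deriv_bound_le: "deriv_bound k C f \<Longrightarrow> norm (f x) \<le> C"
  by (cases k) simp_all

lemma deriv_bound_mono: "deriv_bound k C f \<Longrightarrow> C \<le> D \<Longrightarrow> deriv_bound k D f"
proof (induction k arbitrary: f)
  case (Suc k)
  have "norm (f x) \<le> D" for x using order_trans[OF deriv_bound_le[OF Suc.prems(1)] Suc.prems(2)] .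
  moreover have "deriv_bound k D (partial i f)" for i using Suc.prems by (intro Suc.IH) simp_all
  ultimately show ?case by simp
qed (auto intro: order_trans)

lemma deriv_bound_order: "deriv_bound k C f \<Longrightarrow> j \<le> k \<Longrightarrow> deriv_bound j C f"
proof (induction k arbitrary: j f)
  case (Suc k)
  show ?case
  proof (cases j)
    case 0
    then show ?thesis using deriv_bound_le[OF Suc.prems(1)] by simp
  next
    case (Suc l)
    have "deriv_bound l C (partial i f)" for i
      using Suc.prems Suc by (intro Suc.IH[of "partial i f" l]) simp_all
    then show ?thesis using deriv_bound_le[OF Suc.prems(1)] Suc by simp
  qed
qed simp

lemma deriv_bound_exists:
  fixes f :: "real ^ 'n::finite \<Rightarrow> complex"
  shows "smooth_on UNIV f \<Longrightarrow> supported p r f \<Longrightarrow> \<exists>C\<ge>0. deriv_bound k C f"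
proof (induction k arbitrary: f)
  case 0
  then obtain C where "C \<ge> 0" "\<And>x. norm (f x) \<le> C" using smooth_supported_bounded[OF 0] by blast
  then show ?case by auto
next
  case (Suc k)
  obtain C where C: "C \<ge> 0" "\<And>x. norm (f x) \<le> C" using smooth_supported_bounded[OF Suc.prems] by blast
  have "\<forall>i. \<exists>C\<ge>0. deriv_bound k C (partial i f)"
    using Suc.prems by (intro allI Suc.IH smooth_on_partial supported_partial)
  then obtain D where D: "\<And>i. D i \<ge> 0" "\<And>i. deriv_bound k (D i) (partial i f)" by metis
  have le: "D i \<le> C + (\<Sum>i\<in>UNIV. D i)" for i
    using member_le_sum[of i UNIV D] D(1) C(1) by (simp add: add_increasing)
  have "deriv_bound k (C + (\<Sum>i\<in>UNIV. D i)) (partial i f)" for i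
    by (rule deriv_bound_mono[OF D(2) le])
  moreover have "norm (f x) \<le> C + (\<Sum>i\<in>UNIV. D i)" for x
    using C(2)[of x] D(1) by (simp add: add_increasing2 sum_nonneg)
  moreover have "0 \<le> C + (\<Sum>i\<in>UNIV. D i)" using C(1) D(1) by (simp add: sum_nonneg)
  ultimately show ?case by auto
qed

lemma deriv_bound_cmult:
  "smooth_on UNIV f \<Longrightarrow> deriv_bound k C f \<Longrightarrow> deriv_bound k (norm c * C) (\<lambda>x. c * f x)"
proof (induction k arbitrary: f)
  case (Suc k)
  have "partial i (\<lambda>x. c * f x) = (\<lambda>x. c * partial i f x)" for i
    using partial_cmult[OF Suc.prems(1)] by blast
  moreover have "deriv_bound k (norm c * C) (\<lambda>x. c * partial i f x)" for i
    using Suc.prems by (intro Suc.IH smooth_on_partial) simp_all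
  ultimately show ?case using deriv_bound_le[OF Suc.prems(2)] by (simp add: norm_mult mult_left_mono)
qed (simp add: norm_mult mult_left_mono)

text \<open>Shrinks the support of g towards p by the factor e; each derivative then gains a factor
  1/e.\<close>

definition dilate :: "real ^ 'n::finite \<Rightarrow> real \<Rightarrow> (real ^ 'n \<Rightarrow> complex) \<Rightarrow> real ^ 'n \<Rightarrow> complex" where
  "dilate p e g x = g (p + (1 / e) *\<^sub>R (x - p))"

lemma partial_eq_dilate:
  assumes "smooth_on UNIV g"
  shows "partial_eq i (dilate p e g) x (complex_of_real (1 / e) * dilate p e (partial i g) x)"
proof -
  let ?y = "p + (1 / e) *\<^sub>R (x - p)"
  have lin: "((\<lambda>t. (1 / e) * t) has_vector_derivative 1 / e) (at 0)"
    unfolding has_real_derivative_iff_has_vector_derivative[symmetric] by (rule DERIV_cmult_Id)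
  have "((\<lambda>t. g (?y + t *\<^sub>R axis i 1)) has_vector_derivative partial i g ?y) (at ((1 / e) * 0))"
    using smooth_on_partial_eq[OF assms, of ?y i] by (simp add: partial_eq_def)
  from vector_diff_chain_at[OF lin this]
  have "((\<lambda>t. g (?y + t *\<^sub>R axis i 1)) \<circ> (\<lambda>t. (1 / e) * t) has_vector_derivative (1 / e) *\<^sub>R partial i g ?y) (at 0)"
    .
  moreover have "(\<lambda>t. g (?y + t *\<^sub>R axis i 1)) \<circ> (\<lambda>t. (1 / e) * t) = (\<lambda>t. dilate p e g (x + t *\<^sub>R axis i 1))"
    by (simp add: fun_eq_iff dilate_def algebra_simps)
  ultimately show ?thesis by (simp add: partial_eq_def dilate_def scaleR_conv_of_real)
qed

text \<open>Scalar multiples are included in the family because every derivative produces a factor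
  1/e.\<close>

lemma smooth_on_dilate:
  fixes g :: "real ^ 'n::finite \<Rightarrow> complex"
  assumes "smooth_on UNIV g"
  shows "smooth_on UNIV (dilate p e g)"
proof (rule smooth_on_coinduct[OF open_UNIV, where F = "{h. \<exists>c g. smooth_on UNIV g \<and> h = (\<lambda>x. c * dilate p e g x)}"])
  show "dilate p e g \<in> {h. \<exists>c g. smooth_on UNIV g \<and> h = (\<lambda>x. c * dilate p e g x)}"
    using assms by (intro CollectI exI[of _ 1] exI[of _ g]) simp
next
  fix f assume "f \<in> {h. \<exists>c g. smooth_on UNIV g \<and> h = (\<lambda>x. c * dilate p e g x)}"
  then obtain c and g :: "real ^ 'n \<Rightarrow> complex" where g: "smooth_on UNIV g" "f = (\<lambda>x. c * dilate p e g x)" by blast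
  have "continuous_on UNIV (\<lambda>x. g (p + (1 / e) *\<^sub>R (x - p)))"
    by (rule continuous_on_compose2[OF smooth_on_imp_continuous_on[OF g(1)]]) (auto intro!: continuous_intros)
  then show "continuous_on UNIV f" unfolding g(2) dilate_def by (rule continuous_on_mult_left)
next
  fix f i assume "f \<in> {h. \<exists>c g. smooth_on UNIV g \<and> h = (\<lambda>x. c * dilate p e g x)}"
  then obtain c and g :: "real ^ 'n \<Rightarrow> complex" where g: "smooth_on UNIV g" "f = (\<lambda>x. c * dilate p e g x)" by blast
  have "partial_eq i f x (c * complex_of_real (1 / e) * dilate p e (partial i g) x)" for x
    using partial_eq_mult[OF partial_eq_const[of i c x] partial_eq_dilate[OF g(1), of i p e x]] by (simp add: g(2))
  moreover have "(\<lambda>x. c * complex_of_real (1 / e) * dilate p e (partial i g) x) \<in>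
      {h. \<exists>c g. smooth_on UNIV g \<and> h = (\<lambda>x. c * dilate p e g x)}"
    using smooth_on_partial[OF g(1), of i] by blast
  ultimately show "\<exists>f'\<in>{h. \<exists>c g. smooth_on UNIV g \<and> h = (\<lambda>x. c * dilate p e g x)}. \<forall>x\<in>UNIV. partial_eq i f x (f' x)"
    by (intro bexI[of _ "\<lambda>x. c * complex_of_real (1 / e) * dilate p e (partial i g) x"] ballI)
qed

text \<open>Derivatives of order l gain e^(-l), and e at most 1 makes the highest power e^(-k)
  dominate.\<close>

lemma deriv_bound_dilate:
  assumes "0 < e" "e \<le> 1"
  shows "smooth_on UNIV g \<Longrightarrow> deriv_bound k C g \<Longrightarrow> deriv_bound k (C / e ^ k) (dilate p e g)"
proof (induction k arbitrary: g)
  case 0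
  then show ?case by (simp add: dilate_def)
next
  case (Suc k)
  have C: "C \<ge> 0" using order_trans[OF norm_ge_zero deriv_bound_le[OF Suc.prems(2)]] .
  have "partial i (dilate p e g) = (\<lambda>x. complex_of_real (1 / e) * dilate p e (partial i g) x)" for i
    using partial_eq_imp_partial[OF partial_eq_dilate[OF Suc.prems(1)]] by blast
  moreover have "deriv_bound k (norm (complex_of_real (1 / e)) * (C / e ^ k)) (\<lambda>x. complex_of_real (1 / e) * dilate p e (partial i g) x)" for i
    using Suc.prems by (intro deriv_bound_cmult smooth_on_dilate smooth_on_partial Suc.IH) simp_all
  moreover have "norm (complex_of_real (1 / e)) * (C / e ^ k) = C / e ^ Suc k"
    using assms by (simp add: norm_divide)
  moreover have "norm (dilate p e g x) \<le> C / e ^ Suc k" for x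
  proof -
    have "C * e ^ Suc k \<le> C * 1" using C assms by (intro mult_left_mono power_le_one) simp_all
    then have "C \<le> C / e ^ Suc k" using assms by (simp only: pos_le_divide_eq zero_less_power)
    then show ?thesis using deriv_bound_le[OF Suc.prems(2), of "p + (1 / e) *\<^sub>R (x - p)"]
      unfolding dilate_def by (rule order_trans[rotated])
  qed
  ultimately show ?case by (simp only: deriv_bound.simps simp_thms)
qed

text \<open>The summable bounds may depend on k, which is what makes the class closed under partial
  derivatives.\<close>

definition smooth_series :: "(nat \<Rightarrow> real ^ 'n::finite \<Rightarrow> complex) \<Rightarrow> bool" where
  "smooth_series f \<longleftrightarrow> (\<forall>j. smooth_on UNIV (f j)) \<and> (\<forall>k. \<exists>B. summable B \<and> (\<forall>j. deriv_bound k (B j) (f j)))"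

lemma smooth_series_partial:
  assumes "smooth_series f"
  shows "smooth_series (\<lambda>j. partial i (f j))"
  unfolding smooth_series_def
proof (intro conjI allI)
  show "smooth_on UNIV (partial i (f j))" for j using assms by (simp add: smooth_series_def smooth_on_partial)
  fix k
  from assms obtain B where "summable B" "\<And>j. deriv_bound (Suc k) (B j) (f j)"
    unfolding smooth_series_def by blast
  then show "\<exists>B. summable B \<and> (\<forall>j. deriv_bound k (B j) (partial i (f j)))" by auto
qed

lemma partial_eq_smooth_series:
  assumes "smooth_series f"
  shows "partial_eq i (\<lambda>x. \<Sum>j. f j x) x (\<Sum>j. partial i (f j) x)"
proof -
  from assms have "\<exists>B. summable B \<and> (\<forall>j. deriv_bound 1 (B j) (f j))" unfolding smooth_series_def by blast
  then obtain B where B: "summable B" "\<And>j. deriv_bound (Suc 0) (B j) (f j)" by auto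
  show ?thesis
  proof (rule partial_eq_suminf[OF open_UNIV UNIV_I _ _ B(1) _ B(1)])
    show "partial_eq i (f n) y (partial i (f n) y)" for n y
      using assms by (intro smooth_on_partial_eq[of UNIV]) (simp_all add: smooth_series_def)
    show "norm (f n y) \<le> B n" "norm (partial i (f n) y) \<le> B n" for n y
      using B(2)[of n] by simp_all
  qed
qed

lemma continuous_on_smooth_series:
  assumes "smooth_series f"
  shows "continuous_on UNIV (\<lambda>x. \<Sum>j. f j x)"
proof -
  from assms obtain B where B: "summable B" "\<And>j. deriv_bound 0 (B j) (f j)" unfolding smooth_series_def by blast
  show ?thesis
    using assms B by (intro continuous_on_suminf[of UNIV f B]) (auto simp: smooth_series_def intro: smooth_on_imp_continuous_on)
qed

lemma smooth_on_smooth_series: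
  assumes "smooth_series f"
  shows "smooth_on UNIV (\<lambda>x. \<Sum>j. f j x)"
proof (rule smooth_on_coinduct[OF open_UNIV, where F = "(\<lambda>f x. \<Sum>j. f j x) ` {f. smooth_series f}"])
  show "(\<lambda>x. \<Sum>j. f j x) \<in> (\<lambda>f x. \<Sum>j. f j x) ` {f. smooth_series f}" using assms by blast
  show "continuous_on UNIV h" if "h \<in> (\<lambda>f x. \<Sum>j. f j x) ` {f. smooth_series f}" for h
    using that continuous_on_smooth_series by auto
  show "\<exists>f'\<in>(\<lambda>f x. \<Sum>j. f j x) ` {f. smooth_series f}. \<forall>x\<in>UNIV. partial_eq i h x (f' x)"
    if h: "h \<in> (\<lambda>f x. \<Sum>j. f j x) ` {f. smooth_series f}" for h i
  proof -
    from h obtain f where f: "smooth_series f" "h = (\<lambda>x. \<Sum>j. f j x)" by blast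
    show ?thesis
      by (rule bexI[of _ "\<lambda>x. \<Sum>j. partial i (f j) x"])
        (use f partial_eq_smooth_series[OF f(1)] smooth_series_partial[OF f(1), of i] in auto)
  qed
qed

lemma vanishes_to_smooth_series:
  "smooth_series f \<Longrightarrow> (\<And>j. vanishes_to k p (f j)) \<Longrightarrow> vanishes_to k p (\<lambda>x. \<Sum>j. f j x)"
proof (induction k arbitrary: f)
  case (Suc k)
  have "partial i (\<lambda>x. \<Sum>j. f j x) = (\<lambda>x. \<Sum>j. partial i (f j) x)" for i
    using partial_eq_imp_partial[OF partial_eq_smooth_series[OF Suc.prems(1)]] by blast
  moreover have "vanishes_to k p (\<lambda>x. \<Sum>j. partial i (f j) x)" for i
    using Suc.prems by (intro Suc.IH smooth_series_partial) simp_all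
  ultimately show ?case using Suc.prems(2) by simp
qed simp

lemma vanishes_to_mon: "k \<le> mi_abs \<delta> \<Longrightarrow> vanishes_to k p (\<lambda>x. c * mon p \<delta> x)"
proof (induction k arbitrary: c \<delta>)
  case (Suc k)
  have "partial i (\<lambda>x. c * mon p \<delta> x) = (\<lambda>x. c * of_nat (\<delta> $ i) * mon p (\<delta> - axis i 1) x)" for i
  proof
    fix x
    show "partial i (\<lambda>x. c * mon p \<delta> x) x = c * of_nat (\<delta> $ i) * mon p (\<delta> - axis i 1) x"
      using partial_eq_imp_partial[OF partial_eq_mult[OF partial_eq_const[of i c x] partial_eq_mon[of i p \<delta> x]]]
      by (simp add: mult.assoc)
  qed
  moreover have "vanishes_to k p (\<lambda>x. c * of_nat (\<delta> $ i) * mon p (\<delta> - axis i 1) x)" for i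
  proof (cases "\<delta> $ i = 0")
    case True
    then show ?thesis using vanishes_to_zero[of k p] by simp
  next
    case False
    then have "\<delta> = (\<delta> - axis i 1) + axis i 1" by (simp add: vec_eq_iff axis_def)
    then have "mi_abs \<delta> = mi_abs (\<delta> - axis i 1) + 1" by (metis mi_abs_add mi_abs_axis)
    then show ?thesis using Suc.prems by (intro Suc.IH) simp
  qed
  moreover have "mon p \<delta> p = 0"
  proof -
    have "\<exists>i. \<delta> $ i \<noteq> 0"
    proof (rule ccontr)
      assume "\<not> (\<exists>i. \<delta> $ i \<noteq> 0)"
      then have "mi_abs \<delta> = 0" by (simp add: mi_abs_def)
      then show False using Suc.prems by simp
    qed
    then show ?thesis by (auto simp: mon_def mi_power_def)
  qed
  ultimately show ?case by simp
qed simp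

definition homog :: "real ^ 'n::finite \<Rightarrow> (nat ^ 'n \<Rightarrow> complex) \<Rightarrow> nat \<Rightarrow> real ^ 'n \<Rightarrow> complex" where
  "homog p V j x = (\<Sum>\<delta> | mi_abs \<delta> = j. V \<delta> * mon p \<delta> x)"

lemma smooth_on_homog: "open U \<Longrightarrow> smooth_on U (homog p V j)"
  unfolding homog_def by (intro smooth_on_sum smooth_on_mult smooth_on_const smooth_on_mon)

lemma vanishes_to_homog: "vanishes_to j p (homog p V j)"
  unfolding homog_def
  by (rule vanishes_to_sum[OF open_UNIV UNIV_I])
    (auto intro!: vanishes_to_mon smooth_on_mult smooth_on_const smooth_on_mon)

lemma homog_dilate:
  assumes "e > 0"
  shows "complex_of_real (e ^ j) * dilate p e (homog p V j) x = homog p V j x"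
proof -
  have "mon p \<delta> (p + (1 / e) *\<^sub>R (x - p)) = complex_of_real ((1 / e) ^ mi_abs \<delta>) * mon p \<delta> x" for \<delta>
    by (simp add: mon_def mi_power_def power_mult_distrib power_divide prod_dividef mi_abs_def power_sum[symmetric])
  then show ?thesis
    unfolding dilate_def homog_def sum_distrib_left using assms
    by (intro sum.cong) (auto simp: power_divide)
qed

text \<open>The homogeneous part of degree j is multiplied by a cutoff at scale \<open>e j\<close>.
  By homogeneity this is \<open>e j ^ j\<close> times a dilation of a fixed function
  \<open>G j\<close>, so derivatives of order below j are as small as desired when
  \<open>e j\<close> is small. Near p the cutoff is 1 and the Taylor coefficients are
  unchanged.\<close>

theorem borel_multivariate:
  fixes p :: "real ^ 'n::finite" and V :: "nat ^ 'n \<Rightarrow> complex"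
  obtains v where "smooth_on UNIV v" "\<And>J. vanishes_to (Suc J) p (\<lambda>x. v x - (\<Sum>j\<le>J. homog p V j x))"
proof -
  obtain h where h: "smooth_on UNIV h" "\<And>x. norm (x - p) \<le> 1 / 2 \<Longrightarrow> h x = 1" "\<And>x. norm (x - p) \<ge> 1 \<Longrightarrow> h x = 0"
    using exists_cutoff[of 1 p] by auto
  define G where "G j = (\<lambda>x. homog p V j x * h x)" for j
  have G: "smooth_on UNIV (G j)" "supported p 1 (G j)" for j
    unfolding G_def using h by (auto intro!: smooth_on_mult smooth_on_homog simp: supported_def)
  have "\<forall>j. \<exists>C\<ge>0. deriv_bound j C (G j)" using deriv_bound_exists[OF G] by blast
  then obtain C where C: "\<And>j. C j \<ge> 0" "\<And>j. deriv_bound j (C j) (G j)" by metis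
  \<comment> \<open>Chosen so that \<open>e j\<close> is at most 1 and \<open>C j * e j\<close> at
    most 2^(-j).\<close>
  define e where "e j = 1 / (2 ^ j * (1 + C j))" for j
  have e: "0 < e j" "e j \<le> 1" "C j * e j \<le> (1 / 2) ^ j" for j
  proof -
    have pos: "1 + C j > 0" using C(1)[of j] by simp
    have "(1::real) * 1 \<le> 2 ^ j * (1 + C j)" using C(1)[of j] by (intro mult_mono) simp_all
    then show "0 < e j" "e j \<le> 1" using pos by (simp_all add: e_def)
    have "C j / (1 + C j) \<le> 1" using pos by simp
    then have "C j / (1 + C j) * (1 / 2) ^ j \<le> 1 * (1 / 2) ^ j" by (rule mult_right_mono) simp
    then show "C j * e j \<le> (1 / 2) ^ j" by (simp add: e_def power_divide mult.commute)
  qed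
  define f where "f j = (\<lambda>x. complex_of_real (e j ^ j) * dilate p (e j) (G j) x)" for j
  have f_smooth: "smooth_on UNIV (f j)" for j
    unfolding f_def by (intro smooth_on_mult smooth_on_const smooth_on_dilate G open_UNIV)
  have f_supp: "supported p 1 (f j)" for j
    unfolding supported_def
  proof (intro allI impI)
    fix x assume "norm (x - p) > 1"
    moreover have "norm ((1 / e j) *\<^sub>R (x - p)) \<ge> norm (x - p)"
    proof -
      have "1 * norm (x - p) \<le> (1 / e j) * norm (x - p)" using e[of j] by (intro mult_right_mono) simp_all
      then show ?thesis using e(1)[of j] by simp
    qed
    ultimately have "norm (p + (1 / e j) *\<^sub>R (x - p) - p) > 1" unfolding add_diff_cancel_left' by argo
    then have "G j (p + (1 / e j) *\<^sub>R (x - p)) = 0" using G(2)[of j] unfolding supported_def by blast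
    then show "f j x = 0" by (simp add: f_def dilate_def)
  qed
  \<comment> \<open>Order j - 1 is the limit: the factor \<open>e j ^ j\<close> exceeds the loss
    \<open>e j ^ (j - 1)\<close> by exactly one power of \<open>e j\<close>, which defeats
    \<open>C j\<close>.\<close>
  have f_small: "deriv_bound (j - 1) ((1 / 2) ^ j) (f j)" if "j \<ge> 1" for j
  proof -
    have "deriv_bound (j - 1) (C j / e j ^ (j - 1)) (dilate p (e j) (G j))"
      by (intro deriv_bound_dilate e G deriv_bound_order[OF C(2)]) simp
    from deriv_bound_cmult[OF smooth_on_dilate[OF G(1)] this, of "complex_of_real (e j ^ j)"]
    have "deriv_bound (j - 1) (norm (complex_of_real (e j ^ j)) * (C j / e j ^ (j - 1))) (f j)" by (simp add: f_def)
    moreover have "norm (complex_of_real (e j ^ j)) * (C j / e j ^ (j - 1)) = C j * e j"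
    proof -
      have "e j ^ j = e j * e j ^ (j - 1)" using that by (cases j) simp_all
      then show ?thesis unfolding norm_of_real using e(1)[of j] by simp
    qed
    ultimately show ?thesis using e(3)[of j] by (auto intro: deriv_bound_mono)
  qed
  have series: "smooth_series f"
    unfolding smooth_series_def
  proof (intro conjI allI f_smooth)
    fix k
    have "\<forall>j. \<exists>D\<ge>0. deriv_bound k D (f j)" using deriv_bound_exists[OF f_smooth f_supp] by blast
    then obtain D where D: "\<And>j. D j \<ge> 0" "\<And>j. deriv_bound k (D j) (f j)" by metis
    \<comment> \<open>For the finitely many j up to k, compact support provides some bound; all
      later terms are covered by the geometric series.\<close>
    let ?B = "\<lambda>j. (if j \<le> k then D j else 0) + (1 / 2) ^ j :: real"
    have "summable ?B"
      by (intro summable_add summable_finite[of "{..k}"] summable_geometric) auto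
    moreover have "deriv_bound k (?B j) (f j)" for j
    proof (cases "j \<le> k")
      case True
      then show ?thesis by (intro deriv_bound_mono[OF D(2)]) simp
    next
      case False
      then have "deriv_bound k ((1 / 2) ^ j) (f j)" by (intro deriv_bound_order[OF f_small]) simp_all
      then show ?thesis using False by simp
    qed
    ultimately show "\<exists>B. summable B \<and> (\<forall>j. deriv_bound k (B j) (f j))" by blast
  qed
  have near: "f j x = homog p V j x" if "x \<in> ball p (e j / 2)" for j x
  proof -
    have "norm (x - p) < e j / 2" using that by (simp add: dist_norm norm_minus_commute)
    then have "norm ((1 / e j) *\<^sub>R (x - p)) \<le> 1 / 2"
      unfolding norm_scaleR using e(1)[of j] by (simp add: field_simps)
    then have "h (p + (1 / e j) *\<^sub>R (x - p)) = 1" by (intro h(2)) simp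
    then have "f j x = complex_of_real (e j ^ j) * dilate p (e j) (homog p V j) x"
      by (simp add: f_def dilate_def G_def)
    then show ?thesis using homog_dilate[OF e(1)] by simp
  qed
  have center: "p \<in> ball p (e j / 2)" for j using e(1) by simp
  have f_vanish: "vanishes_to j p (f j)" for j
    by (rule vanishes_to_cong[OF open_ball center[of j] vanishes_to_homog]) (rule near[symmetric])
  have diff_vanish: "vanishes_to k p (\<lambda>x. f j x - homog p V j x)" for j k
    by (rule vanishes_to_cong[OF open_ball center[of j] vanishes_to_zero]) (simp add: near)
  have summ: "summable (\<lambda>j. f j x)" for x
  proof -
    from series obtain B where B: "summable B" "\<And>j. deriv_bound 0 (B j) (f j)" unfolding smooth_series_def by blast
    show ?thesis by (rule summable_comparison_test'[OF B(1)]) (rule deriv_bound_le[OF B(2)])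
  qed
  show ?thesis
  proof (rule that)
    show "smooth_on UNIV (\<lambda>x. \<Sum>j. f j x)" by (rule smooth_on_smooth_series[OF series])
    fix J
    have tail: "smooth_series (\<lambda>j. f (j + Suc J))"
      unfolding smooth_series_def
    proof (intro conjI allI f_smooth)
      fix k
      from series obtain B where B: "summable B" "\<And>j. deriv_bound k (B j) (f j)" unfolding smooth_series_def by blast
      then show "\<exists>B. summable B \<and> (\<forall>j. deriv_bound k (B j) (f (j + Suc J)))"
        using summable_ignore_initial_segment[OF B(1), of "Suc J"] by (intro exI[of _ "\<lambda>j. B (j + Suc J)"]) simp
    qed
    \<comment> \<open>The difference of v and its partial sum is the tail, whose terms vanish to
      order J + 1 or more, plus differences \<open>f j - homog p V j\<close> that are zero near
      p.\<close>
    have "vanishes_to (Suc J) p (\<lambda>x. (\<Sum>j. f (j + Suc J) x) + (\<Sum>j\<le>J. f j x - homog p V j x))"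
    proof (rule vanishes_to_add[OF open_UNIV UNIV_I])
      show "vanishes_to (Suc J) p (\<lambda>x. \<Sum>j. f (j + Suc J) x)"
        by (rule vanishes_to_smooth_series[OF tail]) (rule vanishes_to_le[OF f_vanish], simp)
      show "vanishes_to (Suc J) p (\<lambda>x. \<Sum>j\<le>J. f j x - homog p V j x)"
        by (rule vanishes_to_sum[OF open_UNIV UNIV_I smooth_on_diff[OF open_UNIV f_smooth smooth_on_homog[OF open_UNIV]] diff_vanish])
      show "smooth_on UNIV (\<lambda>x. \<Sum>j. f (j + Suc J) x)" by (rule smooth_on_smooth_series[OF tail])
      show "smooth_on UNIV (\<lambda>x. \<Sum>j\<le>J. f j x - homog p V j x)"
        by (intro smooth_on_sum smooth_on_diff f_smooth smooth_on_homog open_UNIV)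
    qed
    moreover have "(\<Sum>j. f (j + Suc J) x) + (\<Sum>j\<le>J. f j x - homog p V j x) = (\<Sum>j. f j x) - (\<Sum>j\<le>J. homog p V j x)" for x
      using suminf_split_initial_segment[OF summ[of x], of "Suc J"] by (simp add: sum_subtractf lessThan_Suc_atMost)
    ultimately show "vanishes_to (Suc J) p (\<lambda>x. (\<Sum>j. f j x) - (\<Sum>j\<le>J. homog p V j x))" by simp
  qed
qed

section \<open>Formal solutions\<close>

text \<open>The factor by which the k-th derivative multiplies s^n. Truncated subtraction makes it 0
  when n < k.\<close>

definition ffact :: "nat \<Rightarrow> nat \<Rightarrow> nat" where
  "ffact n k = (\<Prod>l<k. n - l)"

lemma ffact_eq_0_iff: "ffact n k = 0 \<longleftrightarrow> n < k"
  by (auto simp: ffact_def)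

definition mi_ffact :: "nat ^ 'n::finite \<Rightarrow> nat ^ 'n \<Rightarrow> nat" where
  "mi_ffact \<alpha> \<delta> = (\<Prod>i\<in>UNIV. ffact (\<delta> $ i) (\<alpha> $ i))"

lemma mi_ffact_eq_0_iff: "mi_ffact \<alpha> \<delta> = 0 \<longleftrightarrow> \<not> \<alpha> \<le> \<delta>"
  by (simp add: mi_ffact_def ffact_eq_0_iff less_eq_vec_def not_le)

lemma partial_pow_mon:
  "(partial i ^^ k) (\<lambda>x. c * mon p \<delta> x) = (\<lambda>x. c * of_nat (ffact (\<delta> $ i) k) * mon p (\<delta> - axis i k) x)"
proof (induction k)
  case 0
  have "\<delta> - axis i 0 = \<delta>" by (simp add: vec_eq_iff axis_def)
  then show ?case by (simp add: ffact_def)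
next
  case (Suc k)
  have sub: "\<delta> - axis i k - axis i 1 = \<delta> - axis i (Suc k)" by (simp add: vec_eq_iff axis_def)
  have ith: "(\<delta> - axis i k) $ i = \<delta> $ i - k" by simp
  have "partial i (\<lambda>x. c * of_nat (ffact (\<delta> $ i) k) * mon p (\<delta> - axis i k) x) x =
      c * of_nat (ffact (\<delta> $ i) k) * (of_nat (\<delta> $ i - k) * mon p (\<delta> - axis i (Suc k)) x)" for x
    using partial_eq_imp_partial[OF partial_eq_mult[OF partial_eq_const[of i "c * of_nat (ffact (\<delta> $ i) k)" x] partial_eq_mon[of i p "\<delta> - axis i k" x]]]
    unfolding sub ith by simp
  then show ?case by (simp add: Suc.IH fun_eq_iff ffact_def mult.assoc)
qed

text \<open>When \<alpha> is not below \<delta>, the truncated exponent \<delta> - \<alpha> is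
  meaningless, but the factor \<open>mi_ffact \<alpha> \<delta>\<close> is then 0.\<close>

lemma mi_deriv_mon: "mi_deriv \<alpha> (\<lambda>x. c * mon p \<delta> x) = (\<lambda>x. c * of_nat (mi_ffact \<alpha> \<delta>) * mon p (\<delta> - \<alpha>) x)"
proof -
  have "distinct is \<Longrightarrow> foldr (\<lambda>i. partial i ^^ (\<alpha> $ i)) is (\<lambda>x. c * mon p \<delta> x) =
      (\<lambda>x. c * of_nat (\<Prod>i\<in>set is. ffact (\<delta> $ i) (\<alpha> $ i)) * mon p (\<delta> - vec_lambda (\<lambda>j. if j \<in> set is then \<alpha> $ j else 0)) x)" for "is"
  proof (induction "is")
    case Nil
    have "\<delta> - vec_lambda (\<lambda>j. 0) = \<delta>" by (simp add: vec_eq_iff)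
    then show ?case by simp
  next
    case (Cons i "is")
    let ?r = "\<lambda>is. vec_lambda (\<lambda>j. if j \<in> set is then \<alpha> $ j else 0)"
    have sub: "\<delta> - ?r is - axis i (\<alpha> $ i) = \<delta> - ?r (i # is)" using Cons.prems by (auto simp: vec_eq_iff axis_def)
    have ith: "(\<delta> - ?r is) $ i = \<delta> $ i" using Cons.prems by simp
    have "foldr (\<lambda>i. partial i ^^ (\<alpha> $ i)) (i # is) (\<lambda>x. c * mon p \<delta> x) =
        (partial i ^^ (\<alpha> $ i)) (\<lambda>x. c * of_nat (\<Prod>i\<in>set is. ffact (\<delta> $ i) (\<alpha> $ i)) * mon p (\<delta> - ?r is) x)"
      using Cons.IH Cons.prems by simp
    also have "\<dots> = (\<lambda>x. c * of_nat (\<Prod>i\<in>set is. ffact (\<delta> $ i) (\<alpha> $ i)) * of_nat (ffact (\<delta> $ i) (\<alpha> $ i)) *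
        mon p (\<delta> - ?r (i # is)) x)"
      unfolding partial_pow_mon ith sub ..
    also have "\<dots> = (\<lambda>x. c * of_nat (\<Prod>i\<in>set (i # is). ffact (\<delta> $ i) (\<alpha> $ i)) * mon p (\<delta> - ?r (i # is)) x)"
      using Cons.prems by (auto simp: fun_eq_iff mult_ac)
    finally show ?case .
  qed
  from this[OF distinct_axes] show ?thesis by (simp add: mi_deriv_def set_axes mi_ffact_def)
qed

lemma mi_abs_mono: "\<alpha> \<le> \<beta> \<Longrightarrow> mi_abs \<alpha> \<le> mi_abs \<beta>"
  by (simp add: mi_abs_def less_eq_vec_def sum_mono)

lemma mi_le_add_diff: "\<alpha> \<le> \<delta> \<Longrightarrow> \<delta> = \<alpha> + (\<delta> - \<alpha> :: nat ^ 'n::finite)"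
  by (simp add: vec_eq_iff less_eq_vec_def)

lemma mi_eq_of_le:
  assumes "\<alpha> \<le> \<beta>" "mi_abs \<alpha> = mi_abs \<beta>"
  shows "\<alpha> = (\<beta> :: nat ^ 'n::finite)"
proof -
  have "mi_abs (\<beta> - \<alpha>) = 0" using mi_abs_add[of \<alpha> "\<beta> - \<alpha>"] mi_le_add_diff[OF assms(1)] assms(2) by simp
  then have "\<beta> - \<alpha> = 0" by (simp add: mi_abs_def vec_eq_iff)
  then show ?thesis using mi_le_add_diff[OF assms(1)] by simp
qed

lemma mi_eq_axis:
  assumes "\<alpha> $ e \<ge> m" "mi_abs \<alpha> \<le> m"
  shows "\<alpha> = axis e m"
proof -
  have "axis e m \<le> \<alpha>" using assms(1) by (simp add: less_eq_vec_def axis_def)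
  moreover from mi_abs_mono[OF this] have "mi_abs (axis e m) = mi_abs \<alpha>" using assms(2) by (simp add: mi_abs_axis)
  ultimately show ?thesis by (metis mi_eq_of_le)
qed

text \<open>The coefficient of \<open>(x - p)\<^sup>\<beta>\<close> in \<open>L (x - p)\<^sup>\<delta>\<close>, where \<open>c \<alpha>\<close> is the power series of \<open>a\<^sub>\<alpha>\<close>. For fixed \<open>\<beta>\<close> and in
  the lexicographic order of \<open>(|\<delta>|, \<delta>\<^sub>e)\<close> the largest \<open>\<delta>\<close> with non-zero coefficient is \<open>\<beta> + m e\<close>, so the equations
  determine the coefficients with \<open>\<delta>\<^sub>e \<ge> m\<close> and leave the others free.\<close>

definition op_coeff :: "nat \<Rightarrow> (nat ^ 'n::finite \<Rightarrow> nat ^ 'n \<Rightarrow> complex) \<Rightarrow> nat ^ 'n \<Rightarrow> nat ^ 'n \<Rightarrow> complex" where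
  "op_coeff m c \<delta> \<beta> = (\<Sum>\<alpha> | mi_abs \<alpha> \<le> m. of_nat (mi_ffact \<alpha> \<delta>) * ps_shift (\<delta> - \<alpha>) (c \<alpha>) \<beta>)"

lemma op_coeff_nonzero:
  assumes "op_coeff m c \<delta> \<beta> \<noteq> 0"
  obtains \<alpha> where "mi_abs \<alpha> \<le> m" "\<alpha> \<le> \<delta>" "\<delta> - \<alpha> \<le> \<beta>"
proof -
  from assms obtain \<alpha> where "mi_abs \<alpha> \<le> m" "of_nat (mi_ffact \<alpha> \<delta>) * ps_shift (\<delta> - \<alpha>) (c \<alpha>) \<beta> \<noteq> 0"
    unfolding op_coeff_def by (metis (mono_tags, lifting) mem_Collect_eq sum.neutral)
  then have "mi_abs \<alpha> \<le> m" "\<alpha> \<le> \<delta>" "\<delta> - \<alpha> \<le> \<beta>"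
    using mi_ffact_eq_0_iff[of \<alpha> \<delta>] by (auto simp: ps_shift_def split: if_splits)
  then show ?thesis by (rule that)
qed

lemma op_coeff_nonzero_le:
  assumes "op_coeff m c \<delta> \<beta> \<noteq> 0"
  shows "mi_abs \<delta> \<le> mi_abs \<beta> + m"
proof -
  obtain \<alpha> where \<alpha>: "mi_abs \<alpha> \<le> m" "\<alpha> \<le> \<delta>" "\<delta> - \<alpha> \<le> \<beta>" using op_coeff_nonzero[OF assms] .
  have "mi_abs \<delta> = mi_abs \<alpha> + mi_abs (\<delta> - \<alpha>)" using mi_le_add_diff[OF \<alpha>(2)] mi_abs_add by metis
  then show ?thesis using mi_abs_mono[OF \<alpha>(3)] \<alpha>(1) by simp
qed

text \<open>A contributing \<alpha> must lower the e-component of \<beta> + m e to at most that of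
  \<beta>. This needs m derivatives along e, and |\<alpha>| at most m leaves no others.\<close>

lemma op_coeff_lead: "op_coeff m c (\<beta> + axis e m) \<beta> = of_nat (mi_ffact (axis e m) (\<beta> + axis e m)) * c (axis e m) 0"
proof -
  let ?f = "\<lambda>\<alpha>. of_nat (mi_ffact \<alpha> (\<beta> + axis e m)) * ps_shift (\<beta> + axis e m - \<alpha>) (c \<alpha>) \<beta>"
  have "?f \<alpha> = 0" if "mi_abs \<alpha> \<le> m" "\<alpha> \<noteq> axis e m" for \<alpha>
  proof (rule ccontr)
    assume "?f \<alpha> \<noteq> 0"
    then have "\<beta> + axis e m - \<alpha> \<le> \<beta>" by (auto simp: ps_shift_def split: if_splits)
    then have "(\<beta> + axis e m - \<alpha>) $ e \<le> \<beta> $ e" unfolding less_eq_vec_def by blast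
    then have "\<alpha> $ e \<ge> m" by simp
    from mi_eq_axis[OF this that(1)] that(2) show False by simp
  qed
  then have "op_coeff m c (\<beta> + axis e m) \<beta> = (\<Sum>\<alpha>\<in>{axis e m}. ?f \<alpha>)"
    unfolding op_coeff_def by (intro sum.mono_neutral_right finite_mi_abs_le) (auto simp: mi_abs_axis)
  moreover have "\<beta> + axis e m - axis e m = \<beta>" "\<beta> - \<beta> = 0" by (simp_all add: vec_eq_iff)
  ultimately show ?thesis by (simp add: ps_shift_def)
qed

text \<open>Equality |\<delta>| = |\<beta>| + m forces \<delta> = \<alpha> + \<beta> with |\<alpha>|
  = m. If moreover \<delta> has e-component at least \<beta>_e + m, then all of \<alpha> lies along
  e, the excluded case.\<close>

lemma op_coeff_triangular:
  assumes "op_coeff m c \<delta> \<beta> \<noteq> 0" "\<delta> \<noteq> \<beta> + axis e m"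
  shows "mi_abs \<delta> < mi_abs \<beta> + m \<or> mi_abs \<delta> = mi_abs \<beta> + m \<and> \<delta> $ e < \<beta> $ e + m"
proof (rule ccontr)
  assume "\<not> ?thesis"
  then have eq: "mi_abs \<delta> = mi_abs \<beta> + m" and ge: "\<delta> $ e \<ge> \<beta> $ e + m"
    using op_coeff_nonzero_le[OF assms(1)] by auto
  obtain \<alpha> where \<alpha>: "mi_abs \<alpha> \<le> m" "\<alpha> \<le> \<delta>" "\<delta> - \<alpha> \<le> \<beta>" using op_coeff_nonzero[OF assms(1)] .
  have "mi_abs \<delta> = mi_abs \<alpha> + mi_abs (\<delta> - \<alpha>)" using mi_le_add_diff[OF \<alpha>(2)] mi_abs_add by metis
  then have "mi_abs (\<delta> - \<alpha>) = mi_abs \<beta>" using eq \<alpha>(1) mi_abs_mono[OF \<alpha>(3)] by simp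
  then have "\<delta> - \<alpha> = \<beta>" using \<alpha>(3) by (metis mi_eq_of_le)
  then have \<delta>: "\<delta> = \<alpha> + \<beta>" using mi_le_add_diff[OF \<alpha>(2)] by simp
  then have "\<alpha> $ e \<ge> m" using ge by simp
  from mi_eq_axis[OF this \<alpha>(1)] \<delta> assms(2) show False by (simp add: add.commute)
qed

text \<open>Triangularity permits well-founded recursion: the equation for \<beta> is solved for the
  coefficient at \<beta> + m e, in terms of smaller indices.\<close>

lemma formal_solution:
  fixes c :: "nat ^ 'n::finite \<Rightarrow> nat ^ 'n \<Rightarrow> complex"
  assumes lead: "c (axis e m) 0 \<noteq> 0" and "m \<ge> 1" "e \<noteq> i"
  obtains V where "\<And>k. V (axis i k) = T k"
    "\<And>\<beta> J. mi_abs \<beta> + m \<le> J \<Longrightarrow> (\<Sum>\<delta> | mi_abs \<delta> \<le> J. V \<delta> * op_coeff m c \<delta> \<beta>) = 0"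
proof -
  define r where "r = inv_image (less_than <*lex*> less_than) (\<lambda>\<delta> :: nat ^ 'n. (mi_abs \<delta>, \<delta> $ e))"
  have wf: "wf r" unfolding r_def by (intro wf_inv_image wf_lex_prod wf_less_than)
  \<comment> \<open>Indices with e-component below m are free: T on the axis i and 0 elsewhere. Any
    other \<delta> is determined by the equation of index \<delta> - m e, whose leading coefficient
    is invertible.\<close>
  define H where "H f \<delta> = (if \<delta> $ e < m then (if \<delta> = axis i (mi_abs \<delta>) then T (mi_abs \<delta>) else 0)
      else - (\<Sum>\<eta>\<in>{\<eta>. mi_abs \<eta> \<le> mi_abs \<delta>} - {\<delta>}. f \<eta> * op_coeff m c \<eta> (\<delta> - axis e m)) / op_coeff m c \<delta> (\<delta> - axis e m))"
    for f :: "nat ^ 'n \<Rightarrow> complex" and \<delta>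
  define V where "V = wfrec r H"
  have V: "V \<delta> = H (cut V r \<delta>) \<delta>" for \<delta> unfolding V_def by (rule wfrec[OF wf])
  show ?thesis
  proof (rule that[of V])
    show "V (axis i k) = T k" for k
    proof -
      \<comment> \<open>This is where e \<noteq> i enters: the axis i consists of free
        indices.\<close>
      have "axis i k $ e = 0" using assms(3) by (simp add: axis_def)
      then have "axis i k $ e < m" using assms(2) by simp
      then show ?thesis by (subst V) (simp only: H_def mi_abs_axis if_True refl)
    qed
    fix \<beta> :: "nat ^ 'n" and J assume J: "mi_abs \<beta> + m \<le> J"
    define \<delta> where "\<delta> = \<beta> + axis e m"
    have \<delta>: "mi_abs \<delta> = mi_abs \<beta> + m" "\<not> \<delta> $ e < m" "\<delta> - axis e m = \<beta>"
      by (simp_all add: \<delta>_def mi_abs_add mi_abs_axis vec_eq_iff)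
    have "axis e m \<le> \<delta>" by (simp add: \<delta>_def less_eq_vec_def)
    then have nz: "op_coeff m c \<delta> \<beta> \<noteq> 0"
      unfolding \<delta>_def op_coeff_lead using lead mi_ffact_eq_0_iff[of "axis e m" "\<beta> + axis e m"] by simp
    \<comment> \<open>The recursion sees V only below \<delta>, while the sum in H runs over a
      larger finite set; the additional coefficients are 0.\<close>
    have "cut V r \<delta> \<eta> * op_coeff m c \<eta> \<beta> = V \<eta> * op_coeff m c \<eta> \<beta>" if "\<eta> \<noteq> \<delta>" for \<eta>
    proof (cases "op_coeff m c \<eta> \<beta> = 0")
      case False
      then have "(\<eta>, \<delta>) \<in> r"
        using op_coeff_triangular[OF False, of e] that by (auto simp: r_def \<delta>_def mi_abs_add mi_abs_axis)
      then show ?thesis by (simp add: cut_apply)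
    qed simp
    then have "(\<Sum>\<eta>\<in>{\<eta>. mi_abs \<eta> \<le> mi_abs \<delta>} - {\<delta>}. cut V r \<delta> \<eta> * op_coeff m c \<eta> \<beta>) =
        (\<Sum>\<eta>\<in>{\<eta>. mi_abs \<eta> \<le> mi_abs \<delta>} - {\<delta>}. V \<eta> * op_coeff m c \<eta> \<beta>)"
      by (intro sum.cong refl) blast
    moreover have "V \<delta> = - (\<Sum>\<eta>\<in>{\<eta>. mi_abs \<eta> \<le> mi_abs \<delta>} - {\<delta>}. cut V r \<delta> \<eta> * op_coeff m c \<eta> \<beta>) / op_coeff m c \<delta> \<beta>"
      by (subst V) (simp only: H_def \<delta>(2,3) if_False)
    ultimately have "V \<delta> = - (\<Sum>\<eta>\<in>{\<eta>. mi_abs \<eta> \<le> mi_abs \<delta>} - {\<delta>}. V \<eta> * op_coeff m c \<eta> \<beta>) / op_coeff m c \<delta> \<beta>"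
      by (simp only:)
    then have "V \<delta> * op_coeff m c \<delta> \<beta> + (\<Sum>\<eta>\<in>{\<eta>. mi_abs \<eta> \<le> mi_abs \<delta>} - {\<delta>}. V \<eta> * op_coeff m c \<eta> \<beta>) = 0"
      using nz by (simp only: nonzero_eq_divide_eq) simp
    then have "(\<Sum>\<eta> | mi_abs \<eta> \<le> mi_abs \<delta>. V \<eta> * op_coeff m c \<eta> \<beta>) = 0"
      by (subst sum.remove[OF finite_mi_abs_le, of \<delta>]) blast+
    \<comment> \<open>Indices of degree above |\<beta>| + m do not reach the coefficient of \<beta>,
      so every larger J gives the same sum.\<close>
    moreover have "(\<Sum>\<eta> | mi_abs \<eta> \<le> J. V \<eta> * op_coeff m c \<eta> \<beta>) = (\<Sum>\<eta> | mi_abs \<eta> \<le> mi_abs \<delta>. V \<eta> * op_coeff m c \<eta> \<beta>)"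
    proof (rule sum.mono_neutral_right[OF finite_mi_abs_le])
      show "\<forall>\<eta>\<in>{\<eta>. mi_abs \<eta> \<le> J} - {\<eta>. mi_abs \<eta> \<le> mi_abs \<delta>}. V \<eta> * op_coeff m c \<eta> \<beta> = 0"
      proof
        fix \<eta> :: "nat ^ 'n" assume "\<eta> \<in> {\<eta>. mi_abs \<eta> \<le> J} - {\<eta>. mi_abs \<eta> \<le> mi_abs \<delta>}"
        then have "\<not> mi_abs \<eta> \<le> mi_abs \<beta> + m" unfolding \<delta>(1) by blast
        then have "op_coeff m c \<eta> \<beta> = 0" using op_coeff_nonzero_le[of m c \<eta> \<beta>] by blast
        then show "V \<eta> * op_coeff m c \<eta> \<beta> = 0" by simp
      qed
    qed (use J \<delta>(1) in auto)
    ultimately show "(\<Sum>\<delta> | mi_abs \<delta> \<le> J. V \<delta> * op_coeff m c \<delta> \<beta>) = 0" by simp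
  qed
qed

section \<open>Taylor polynomials of a formal solution\<close>

definition taylor_poly :: "real ^ 'n::finite \<Rightarrow> (nat ^ 'n \<Rightarrow> complex) \<Rightarrow> nat \<Rightarrow> real ^ 'n \<Rightarrow> complex" where
  "taylor_poly p V J x = (\<Sum>\<delta> | mi_abs \<delta> \<le> J. V \<delta> * mon p \<delta> x)"

lemma taylor_poly_eq_homog: "taylor_poly p V J x = (\<Sum>j\<le>J. homog p V j x)"
proof -
  have "{\<delta> :: nat ^ 'a. mi_abs \<delta> \<le> J} = (\<Union>j\<in>{..J}. {\<delta>. mi_abs \<delta> = j})" by auto
  moreover have "finite {\<delta> :: nat ^ 'a. mi_abs \<delta> = j}" for j
    by (rule finite_subset[OF _ finite_mi_abs_le[of j]]) auto
  ultimately show ?thesis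
    unfolding taylor_poly_def homog_def by (simp only:) (rule sum.UNION_disjoint, auto)
qed

lemma smooth_on_taylor_poly: "open U \<Longrightarrow> smooth_on U (taylor_poly p V J)"
  unfolding taylor_poly_def by (intro smooth_on_sum smooth_on_mult smooth_on_const smooth_on_mon)

lemma mi_deriv_taylor_poly:
  "mi_deriv \<alpha> (taylor_poly p V J) x = (\<Sum>\<delta> | mi_abs \<delta> \<le> J. V \<delta> * of_nat (mi_ffact \<alpha> \<delta>) * mon p (\<delta> - \<alpha>) x)"
  unfolding taylor_poly_def
  by (subst mi_deriv_sum[OF open_UNIV _ UNIV_I finite_mi_abs_le])
    (simp_all add: mi_deriv_mon smooth_on_mult smooth_on_const smooth_on_mon)

lemma mon_center: "mon p \<eta> p = (if \<eta> = 0 then 1 else 0)"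
  by (auto simp: mon_def mi_power_def vec_eq_iff)

lemma mi_deriv_axis_taylor_poly:
  "mi_deriv (axis i k) (taylor_poly p V k) p = V (axis i k) * of_nat (mi_ffact (axis i k) (axis i k))"
proof -
  let ?f = "\<lambda>\<delta>. V \<delta> * of_nat (mi_ffact (axis i k) \<delta>) * mon p (\<delta> - axis i k) p"
  have "?f \<delta> = 0" if "mi_abs \<delta> \<le> k" "\<delta> \<noteq> axis i k" for \<delta>
  proof (rule ccontr)
    assume "?f \<delta> \<noteq> 0"
    then have "axis i k \<le> \<delta>" using mi_ffact_eq_0_iff[of "axis i k" \<delta>] by auto
    then have "axis i k $ i \<le> \<delta> $ i" unfolding less_eq_vec_def by blast
    then have "\<delta> $ i \<ge> k" by simp
    from mi_eq_axis[OF this that(1)] that(2) show False by simp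
  qed
  then have "mi_deriv (axis i k) (taylor_poly p V k) p = (\<Sum>\<delta>\<in>{axis i k}. ?f \<delta>)"
    unfolding mi_deriv_taylor_poly by (intro sum.mono_neutral_right finite_mi_abs_le) (auto simp: mi_abs_axis)
  moreover have "axis i k - axis i k = (0 :: nat ^ 'a)" by (simp add: vec_eq_iff)
  ultimately show ?thesis by (simp add: mon_center)
qed

text \<open>A monomial times an analytic coefficient is a shifted power series, so the image of a
  polynomial is a finite combination of shifts whose coefficients collect into
  \<open>op_coeff\<close>.\<close>

lemma diff_op_taylor_poly:
  assumes "\<And>\<alpha>. mi_abs \<alpha> \<le> m \<Longrightarrow> ps_conv r0 (c \<alpha>)" "\<And>\<alpha> x. mi_abs \<alpha> \<le> m \<Longrightarrow> x \<in> cube p r0 \<Longrightarrow> A \<alpha> x = ps p (c \<alpha>) x"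
  shows "ps_conv r0 (\<lambda>\<beta>. \<Sum>\<delta> | mi_abs \<delta> \<le> J. V \<delta> * op_coeff m c \<delta> \<beta>)"
    and "x \<in> cube p r0 \<Longrightarrow> diff_op m A (taylor_poly p V J) x = ps p (\<lambda>\<beta>. \<Sum>\<delta> | mi_abs \<delta> \<le> J. V \<delta> * op_coeff m c \<delta> \<beta>) x"
proof -
  let ?I = "{\<alpha> :: nat ^ 'a. mi_abs \<alpha> \<le> m} \<times> {\<delta> :: nat ^ 'a. mi_abs \<delta> \<le> J}"
  let ?k = "\<lambda>z. V (snd z) * of_nat (mi_ffact (fst z) (snd z))"
  let ?c = "\<lambda>z. ps_shift (snd z - fst z) (c (fst z))"
  have fin: "finite ?I" by (intro finite_cartesian_product finite_mi_abs_le)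
  have conv: "ps_conv r0 (?c z)" if "z \<in> ?I" for z using assms(1) that by (auto intro: ps_conv_shift)
  have eq: "(\<Sum>\<delta> | mi_abs \<delta> \<le> J. V \<delta> * op_coeff m c \<delta> \<beta>) = (\<Sum>z\<in>?I. ?k z * ?c z \<beta>)" for \<beta>
    unfolding op_coeff_def sum_distrib_left
    by (subst sum.swap) (simp add: sum.cartesian_product case_prod_unfold mult.assoc)
  show "ps_conv r0 (\<lambda>\<beta>. \<Sum>\<delta> | mi_abs \<delta> \<le> J. V \<delta> * op_coeff m c \<delta> \<beta>)"
    unfolding eq by (rule ps_lincomb(1)[OF fin conv])
  assume x: "x \<in> cube p r0"
  have "diff_op m A (taylor_poly p V J) x = (\<Sum>z\<in>?I. ?k z * ps p (?c z) x)"
  proof -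
    have "diff_op m A (taylor_poly p V J) x = (\<Sum>\<alpha> | mi_abs \<alpha> \<le> m. \<Sum>\<delta> | mi_abs \<delta> \<le> J.
        V \<delta> * of_nat (mi_ffact \<alpha> \<delta>) * (A \<alpha> x * mon p (\<delta> - \<alpha>) x))"
      unfolding diff_op_def mi_deriv_taylor_poly sum_distrib_left by (intro sum.cong) (simp_all add: mult_ac)
    also have "\<dots> = (\<Sum>\<alpha> | mi_abs \<alpha> \<le> m. \<Sum>\<delta> | mi_abs \<delta> \<le> J.
        V \<delta> * of_nat (mi_ffact \<alpha> \<delta>) * ps p (ps_shift (\<delta> - \<alpha>) (c \<alpha>)) x)"
    proof (intro sum.cong refl)
      fix \<alpha> \<delta> :: "nat ^ 'a" assume "\<alpha> \<in> {\<alpha>. mi_abs \<alpha> \<le> m}"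
      then have \<alpha>: "mi_abs \<alpha> \<le> m" by simp
      show "V \<delta> * of_nat (mi_ffact \<alpha> \<delta>) * (A \<alpha> x * mon p (\<delta> - \<alpha>) x) =
          V \<delta> * of_nat (mi_ffact \<alpha> \<delta>) * ps p (ps_shift (\<delta> - \<alpha>) (c \<alpha>)) x"
        unfolding assms(2)[OF \<alpha> x] ps_shift_eq[OF assms(1)[OF \<alpha>] x] by (simp add: mult_ac)
    qed
    finally show ?thesis by (simp add: sum.cartesian_product case_prod_unfold)
  qed
  then show "diff_op m A (taylor_poly p V J) x = ps p (\<lambda>\<beta>. \<Sum>\<delta> | mi_abs \<delta> \<le> J. V \<delta> * op_coeff m c \<delta> \<beta>) x"
    unfolding eq by (subst ps_lincomb(2)[OF fin conv x]) simp_all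
qed

section \<open>Unsolvability among flat germs\<close>

lemma real_analytic_coefficients:
  fixes p :: "real ^ 'n::finite"
  assumes "\<And>\<alpha> :: nat ^ 'n. mi_abs \<alpha> \<le> m \<Longrightarrow> real_analytic_on (a \<alpha>) \<Omega>" "p \<in> \<Omega>"
  obtains c r where "r > 0" "\<And>\<alpha>. mi_abs \<alpha> \<le> m \<Longrightarrow> ps_conv r (c \<alpha>)"
    "\<And>\<alpha> x. mi_abs \<alpha> \<le> m \<Longrightarrow> x \<in> cube p r \<Longrightarrow> a \<alpha> x = ps p (c \<alpha>) x"
proof -
  let ?A = "{\<alpha> :: nat ^ 'n. mi_abs \<alpha> \<le> m}"
  \<comment> \<open>Series and radius are bundled in a pair so that a single choice over the finite
    index set yields both; the least radius then serves all \<alpha>.\<close>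
  have "\<exists>cr. snd cr > 0 \<and> ps_conv (snd cr) (fst cr) \<and> (\<forall>x\<in>cube p (snd cr). a \<alpha> x = ps p (fst cr) x)"
    if "\<alpha> \<in> ?A" for \<alpha>
  proof (rule real_analytic_on_ps[OF assms(1) assms(2)])
    show "mi_abs \<alpha> \<le> m" using that by simp
    fix c r assume *: "r > (0::real)" "ps_conv r c" "\<And>x. x \<in> cube p r \<Longrightarrow> a \<alpha> x = ps p c x"
    show ?thesis by (rule exI[of _ "(c, r)"]) (use * in simp)
  qed
  then have "\<forall>\<alpha>\<in>?A. \<exists>cr. snd cr > 0 \<and> ps_conv (snd cr) (fst cr) \<and> (\<forall>x\<in>cube p (snd cr). a \<alpha> x = ps p (fst cr) x)"
    by blast
  from bchoice[OF this] obtain F where F: "\<forall>\<alpha>\<in>?A. snd (F \<alpha>) > 0 \<and> ps_conv (snd (F \<alpha>)) (fst (F \<alpha>)) \<and>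
      (\<forall>x\<in>cube p (snd (F \<alpha>)). a \<alpha> x = ps p (fst (F \<alpha>)) x)" ..
  define r where "r = Min ((\<lambda>\<alpha>. snd (F \<alpha>)) ` ?A)"
  have fin: "finite ((\<lambda>\<alpha>. snd (F \<alpha>)) ` ?A)" by (intro finite_imageI finite_mi_abs_le)
  have "(0 :: nat ^ 'n) \<in> ?A" by (simp add: mi_abs_def)
  then have "r \<in> (\<lambda>\<alpha>. snd (F \<alpha>)) ` ?A" unfolding r_def using fin by (intro Min_in) blast+
  then obtain \<alpha>0 where "\<alpha>0 \<in> ?A" "r = snd (F \<alpha>0)" by blast
  then have "r > 0" using bspec[OF F] by simp
  have le: "r \<le> snd (F \<alpha>)" if "\<alpha> \<in> ?A" for \<alpha> unfolding r_def using fin that by (intro Min_le) blast+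
  show ?thesis
  proof (rule that[of r "\<lambda>\<alpha>. fst (F \<alpha>)"])
    show "r > 0" by fact
    fix \<alpha> :: "nat ^ 'n" assume "mi_abs \<alpha> \<le> m"
    then have \<alpha>: "\<alpha> \<in> ?A" by simp
    note F\<alpha> = bspec[OF F \<alpha>]
    show "ps_conv r (fst (F \<alpha>))" by (rule ps_conv_mono[OF conjunct1[OF conjunct2[OF F\<alpha>]] le[OF \<alpha>]])
    fix x assume "x \<in> cube p r"
    then have "x \<in> cube p (snd (F \<alpha>))" using cube_mono[OF le[OF \<alpha>], of p] by (rule rev_subsetD)
    then show "a \<alpha> x = ps p (fst (F \<alpha>)) x" by (rule bspec[OF conjunct2[OF conjunct2[OF F\<alpha>]]])
  qed
qed

lemma mi_power_axis: "mi_power (axis e 1) (axis e m) = 1"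
  by (auto simp: mi_power_def axis_def intro!: prod.neutral)

lemma mi_power_axis_neq:
  assumes "mi_abs \<alpha> = m" "\<alpha> \<noteq> axis e m"
  shows "mi_power (axis e 1) \<alpha> = 0"
proof -
  have "\<exists>j. j \<noteq> e \<and> \<alpha> $ j \<noteq> 0"
  proof (rule ccontr)
    assume "\<not> ?thesis"
    then have 0: "\<alpha> $ j = 0" if "j \<noteq> e" for j using that by blast
    have "mi_abs \<alpha> = (\<Sum>j\<in>{e}. \<alpha> $ j)" unfolding mi_abs_def by (rule sum.mono_neutral_right) (auto simp: 0)
    then have "\<alpha> = axis e m" using 0 assms(1) by (auto simp: vec_eq_iff axis_def)
    then show False using assms(2) by simp
  qed
  then show ?thesis by (auto simp: mi_power_def axis_def)
qed

lemma diff_op_diff: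
  assumes "open U" "smooth_on U f" "smooth_on U g" "x \<in> U"
  shows "diff_op m a (\<lambda>x. f x - g x) x = diff_op m a f x - diff_op m a g x"
  unfolding diff_op_def sum_subtractf[symmetric] mi_deriv_diff[OF assms] by (simp add: right_diff_distrib)

lemma smooth_on_diff_op:
  assumes "open U" "\<And>\<alpha>. mi_abs \<alpha> \<le> m \<Longrightarrow> smooth_on U (a \<alpha>)" "smooth_on U f"
  shows "smooth_on U (diff_op m a f)"
  unfolding diff_op_def
  using assms by (intro smooth_on_sum smooth_on_mult smooth_on_mi_deriv) simp_all

lemma vanishes_to_diff_op:
  assumes "open U" "p \<in> U" "\<And>\<alpha>. mi_abs \<alpha> \<le> m \<Longrightarrow> smooth_on U (a \<alpha>)" "smooth_on U f" "vanishes_to (k + m) p f"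
  shows "vanishes_to k p (diff_op m a f)"
  unfolding diff_op_def
proof (rule vanishes_to_sum[OF assms(1,2)])
  fix \<alpha> :: "nat ^ 'a" assume \<alpha>: "\<alpha> \<in> {\<alpha>. mi_abs \<alpha> \<le> m}"
  show "smooth_on U (\<lambda>x. a \<alpha> x * mi_deriv \<alpha> f x)"
    using \<alpha> assms by (intro smooth_on_mult smooth_on_mi_deriv) simp_all
  show "vanishes_to k p (\<lambda>x. a \<alpha> x * mi_deriv \<alpha> f x)"
    using \<alpha> assms
    by (intro vanishes_to_mult[OF assms(1,2)] smooth_on_mi_deriv vanishes_to_mi_deriv vanishes_to_le[OF assms(5)]) simp_all
qed

text \<open>For each k, v is split into a Taylor polynomial and a remainder. The polynomial has an
  image without terms of degree below k by the formal equations, and the remainder vanishes to an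
  order high enough to survive m derivatives.\<close>

lemma flat_formal_solution:
  fixes p :: "real ^ 'n::finite" and T :: "nat \<Rightarrow> complex"
  assumes "r > 0" "\<And>\<alpha>. mi_abs \<alpha> \<le> m \<Longrightarrow> ps_conv r (c \<alpha>)"
    "\<And>\<alpha> x. mi_abs \<alpha> \<le> m \<Longrightarrow> x \<in> cube p r \<Longrightarrow> a \<alpha> x = ps p (c \<alpha>) x"
    and lead: "c (axis e m) 0 \<noteq> 0" and "m \<ge> 1" "e \<noteq> i"
  obtains v where "smooth_on UNIV v" "flat_at p (diff_op m a v)"
    "\<And>k. norm (T k) \<le> norm ((partial i ^^ k) v p)"
proof -
  obtain V where V: "\<And>k. V (axis i k) = T k"
    "\<And>\<beta> J. mi_abs \<beta> + m \<le> J \<Longrightarrow> (\<Sum>\<delta> | mi_abs \<delta> \<le> J. V \<delta> * op_coeff m c \<delta> \<beta>) = 0"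
  proof (rule formal_solution[where c = c and e = e and m = m and i = i and T = T, OF lead assms(5,6)])
    fix V assume "\<And>k. V (axis i k) = T k"
      "\<And>\<beta> J. mi_abs \<beta> + m \<le> J \<Longrightarrow> (\<Sum>\<delta> | mi_abs \<delta> \<le> J. V \<delta> * op_coeff m c \<delta> \<beta>) = 0"
    then show thesis by (rule that)
  qed
  obtain v where v: "smooth_on UNIV v" "\<And>J. vanishes_to (Suc J) p (\<lambda>x. v x - (\<Sum>j\<le>J. homog p V j x))"
  proof (rule borel_multivariate[of p V])
    fix v assume "smooth_on UNIV v" "\<And>J. vanishes_to (Suc J) p (\<lambda>x. v x - (\<Sum>j\<le>J. homog p V j x))"
    then show thesis by (rule that)
  qed
  let ?P = "taylor_poly p V"
  have w: "vanishes_to (Suc J) p (\<lambda>x. v x - ?P J x)" for J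
    using v(2)[of J] unfolding taylor_poly_eq_homog .
  note cube = open_cube[of p r] center_in_cube[OF assms(1), of p]
  have smooth_a: "smooth_on (cube p r) (a \<alpha>)" if "mi_abs \<alpha> \<le> m" for \<alpha>
    by (rule smooth_on_cong[OF cube(1) smooth_on_ps[OF assms(2)[OF that]]]) (simp add: assms(3)[OF that])
  have sv: "smooth_on (cube p r) v" using smooth_on_subset[OF v(1)] by simp
  have sP: "smooth_on (cube p r) (?P J)" for J by (rule smooth_on_taylor_poly[OF cube(1)])
  have sw: "smooth_on (cube p r) (\<lambda>x. v x - ?P J x)" for J
    using cube(1) sv sP by (rule smooth_on_diff)
  show ?thesis
  proof (rule that[OF v(1)])
    show "flat_at p (diff_op m a v)"
    proof (rule flat_atI)
      fix k
      \<comment> \<open>Degree k + m is what the equations for all |\<beta>| < k involve, and it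
        leaves order k after L is applied to the remainder.\<close>
      let ?J = "k + m" and ?c = "\<lambda>\<beta>. \<Sum>\<delta> | mi_abs \<delta> \<le> k + m. V \<delta> * op_coeff m c \<delta> \<beta>"
      have 1: "vanishes_to k p (diff_op m a (\<lambda>x. v x - ?P ?J x))"
        by (rule vanishes_to_diff_op[OF cube smooth_a sw vanishes_to_SucD[OF w]])
      have "vanishes_to k p (ps p ?c)"
        by (rule vanishes_to_ps[OF assms(1) diff_op_taylor_poly(1)[OF assms(2,3)]]) (simp_all add: V(2))
      then have 2: "vanishes_to k p (diff_op m a (?P ?J))"
        by (rule vanishes_to_cong[OF cube]) (simp add: diff_op_taylor_poly(2)[OF assms(2,3)])
      have "vanishes_to k p (\<lambda>x. diff_op m a (\<lambda>x. v x - ?P ?J x) x + diff_op m a (?P ?J) x)"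
        by (rule vanishes_to_add[OF cube smooth_on_diff_op[OF cube(1) smooth_a sw] smooth_on_diff_op[OF cube(1) smooth_a sP] 1 2])
      then show "vanishes_to k p (diff_op m a v)"
        by (rule vanishes_to_cong[OF cube]) (simp add: diff_op_diff[OF cube(1) sv sP])
    qed
    fix k
    have "vanishes_to (1 + mi_abs (axis i k)) p (\<lambda>x. v x - ?P k x)" using w[of k] by (simp add: mi_abs_axis)
    from vanishes_to_mi_deriv[OF this] have "mi_deriv (axis i k) (\<lambda>x. v x - ?P k x) p = 0" by simp
    then have "mi_deriv (axis i k) v p = mi_deriv (axis i k) (?P k) p"
      using mi_deriv_diff[OF cube(1) sv sP cube(2), of "axis i k" k] by simp
    then have "(partial i ^^ k) v p = T k * of_nat (mi_ffact (axis i k) (axis i k))"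
      unfolding mi_deriv_axis_taylor_poly V(1) unfolding mi_deriv_axis .
    \<comment> \<open>The pure derivative of order k equals T k times a positive integer factor (k
      factorial); a lower bound is all that is required.\<close>
    moreover have "1 \<le> mi_ffact (axis i k) (axis i k :: nat ^ 'n)"
      using mi_ffact_eq_0_iff[of "axis i k" "axis i k :: nat ^ 'n"] by simp
    then have "norm (T k) * 1 \<le> norm (T k) * real (mi_ffact (axis i k) (axis i k :: nat ^ 'n))"
      by (intro mult_left_mono) simp_all
    ultimately show "norm (T k) \<le> norm ((partial i ^^ k) v p)" by (simp add: norm_mult)
  qed
qed

theorem mainTheorem1:
  fixes p :: "real ^ 'n::finite"
    and \<Omega> :: "(real ^ 'n) set"
    and m :: nat
    and a :: "nat ^ 'n \<Rightarrow> real ^ 'n \<Rightarrow> complex"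
  assumes "CARD('n) \<ge> 2"
    and "open \<Omega>" and "p \<in> \<Omega>"
    and "m \<ge> 1"
    and "\<And>\<alpha>. mi_abs \<alpha> \<le> m \<Longrightarrow> real_analytic_on (a \<alpha>) \<Omega>"
    and "elliptic_on \<Omega> m a"
  shows "\<exists>g \<in> flat_smooth_germs p. \<not> (\<exists>u \<in> flat_smooth_germs p. germ_op p (diff_op m a) u = g)"
proof -
  have "\<exists>e i :: 'n. e \<noteq> i"
  proof (rule ccontr)
    assume "\<not> ?thesis"
    then have "(UNIV :: 'n set) \<subseteq> {undefined}" by blast
    then have "CARD('n) \<le> card {undefined :: 'n}" by (intro card_mono) simp_all
    then show False using assms(1) by simp
  qed
  then obtain e i :: 'n where ei: "e \<noteq> i" by blast
  obtain c r where r: "r > 0" "\<And>\<alpha>. mi_abs \<alpha> \<le> m \<Longrightarrow> ps_conv r (c \<alpha>)"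
    "\<And>\<alpha> x. mi_abs \<alpha> \<le> m \<Longrightarrow> x \<in> cube p r \<Longrightarrow> a \<alpha> x = ps p (c \<alpha>) x"
  proof (rule real_analytic_coefficients[where m = m and a = a, OF assms(5) assms(3)])
    fix c r
    assume "r > (0::real)" "\<And>\<alpha>. mi_abs \<alpha> \<le> m \<Longrightarrow> ps_conv r (c \<alpha>)"
      "\<And>\<alpha> x. mi_abs \<alpha> \<le> m \<Longrightarrow> x \<in> cube p r \<Longrightarrow> a \<alpha> x = ps p (c \<alpha>) x"
    then show thesis by (rule that)
  qed
  note cube = open_cube[of p r] center_in_cube[OF r(1), of p]
  have ell: "(\<Sum>\<alpha> | mi_abs \<alpha> = m. c \<alpha> 0 * complex_of_real (mi_power \<xi> \<alpha>)) \<noteq> 0" if "\<xi> \<noteq> 0" for \<xi> :: "real ^ 'n"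
  proof -
    have "c \<alpha> 0 = a \<alpha> p" if "mi_abs \<alpha> = m" for \<alpha> using r(3)[of \<alpha> p] cube(2) that by (simp add: ps_at_center)
    then have "(\<Sum>\<alpha> | mi_abs \<alpha> = m. c \<alpha> 0 * complex_of_real (mi_power \<xi> \<alpha>)) =
        (\<Sum>\<alpha> | mi_abs \<alpha> = m. a \<alpha> p * complex_of_real (mi_power \<xi> \<alpha>))" by (intro sum.cong) simp_all
    then show ?thesis using assms(3,6) that by (simp add: elliptic_on_def)
  qed
  have lead: "c (axis e m) 0 \<noteq> 0"
  proof -
    \<comment> \<open>At the unit vector \<xi> along e every monomial of degree m except \<xi>_e^m
      vanishes, so ellipticity speaks of this one coefficient.\<close>
    have "(\<Sum>\<alpha> | mi_abs \<alpha> = m. c \<alpha> 0 * complex_of_real (mi_power (axis e 1) \<alpha>)) =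
        (\<Sum>\<alpha>\<in>{axis e m}. c \<alpha> 0 * complex_of_real (mi_power (axis e 1) \<alpha>))"
      by (intro sum.mono_neutral_right finite_subset[OF _ finite_mi_abs_le[of m]])
        (auto simp: mi_abs_axis mi_power_axis_neq)
    then show ?thesis using ell[of "axis e 1"] by (auto simp: mi_power_axis[simplified])
  qed
  \<comment> \<open>A sequence of radii tending to 0; the shift by 2 keeps every term strictly below
    r.\<close>
  define \<rho> where "\<rho> j = r / real (j + 2)" for j
  have \<rho>: "0 < \<rho> j" "\<rho> j < r" for j
    using r(1) by (simp_all add: \<rho>_def pos_divide_less_eq)
  \<comment> \<open>The estimate as a predicate of its constant, so that \<open>K j k\<close> can be
    chosen for all j and k before v and independently of any function f.\<close>
  define good where "good j k K \<longleftrightarrow> (\<forall>f N. smooth_on UNIV f \<longrightarrow> supported p (\<rho> j) f \<longrightarrow>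
      (\<forall>x. norm (x - p) < \<rho> j / 2 \<longrightarrow> diff_op m a f x = 0) \<longrightarrow>
      (\<forall>\<alpha> x. mi_abs \<alpha> \<le> m \<longrightarrow> norm (mi_deriv \<alpha> f x) \<le> N) \<longrightarrow> norm ((partial i ^^ k) f p) \<le> K * N)" for j k K
  have "\<exists>K. good j k K" for j k
  proof (rule interior_estimate[OF assms(4) r(2,3) ell \<rho>])
    fix K
    assume K: "\<And>f N. smooth_on UNIV f \<Longrightarrow> supported p (\<rho> j) f \<Longrightarrow>
      (\<And>x. norm (x - p) < \<rho> j / 2 \<Longrightarrow> diff_op m a f x = 0) \<Longrightarrow>
      (\<And>\<alpha> x. mi_abs \<alpha> \<le> m \<Longrightarrow> norm (mi_deriv \<alpha> f x) \<le> N) \<Longrightarrow> norm ((partial i ^^ k) f p) \<le> K * N"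
    show ?thesis unfolding good_def by (intro exI[of _ K] allI impI K) simp_all
  qed
  then obtain K where K: "\<And>j k. good j k (K j k)" by metis
  \<comment> \<open>Diagonalisation: once k is at least j, the sum contains \<open>K j k\<close>,
    and the factor k outgrows any N.\<close>
  define T where "T k = real k * (1 + (\<Sum>j\<le>k. \<bar>K j k\<bar>))" for k
  obtain v where v: "smooth_on UNIV v" "flat_at p (diff_op m a v)"
    "\<And>k. norm (complex_of_real (T k)) \<le> norm ((partial i ^^ k) v p)"
  proof (rule flat_formal_solution[where m = m and a = a and c = c and p = p and T = "\<lambda>k. complex_of_real (T k)",
        OF r lead assms(4) ei])
    fix v assume "smooth_on UNIV v" "flat_at p (diff_op m a v)"
      "\<And>k. norm (complex_of_real (T k)) \<le> norm ((partial i ^^ k) v p)"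
    then show thesis by (rule that)
  qed
  have smooth_a: "smooth_on (cube p r) (a \<alpha>)" if "mi_abs \<alpha> \<le> m" for \<alpha>
    by (rule smooth_on_cong[OF cube(1) smooth_on_ps[OF r(2)[OF that]]]) (simp add: r(3)[OF that])
  have "smooth_at p (diff_op m a v)"
    unfolding smooth_at_iff
    by (intro exI[of _ "cube p r"] conjI cube smooth_on_diff_op[OF cube(1) smooth_a] smooth_on_subset[OF v(1)] subset_UNIV)
  with v(2) have "germ_at p (diff_op m a v) \<in> flat_smooth_germs p" by (auto simp: flat_smooth_germs_def)
  moreover have "germ_op p (diff_op m a) u \<noteq> germ_at p (diff_op m a v)" if "u \<in> flat_smooth_germs p" for u
  proof
    assume eq: "germ_op p (diff_op m a) u = germ_at p (diff_op m a v)"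
    from that obtain g where g: "smooth_at p g" "flat_at p g" "u = germ_at p g" by (auto simp: flat_smooth_germs_def)
    have "\<forall>\<^sub>F x in nhds p. diff_op m a g x = diff_op m a v x"
      using eq unfolding g(3) germ_op_diff_op germ_at_eq_iff .
    then obtain U1 where U1: "open U1" "p \<in> U1" "\<And>x. x \<in> U1 \<Longrightarrow> diff_op m a g x = diff_op m a v x"
      unfolding eventually_nhds by blast
    obtain U2 where U2: "open U2" "p \<in> U2" "smooth_on U2 g" using g(1) unfolding smooth_at_iff by (elim exE conjE)
    have "open (U1 \<inter> U2)" "p \<in> U1 \<inter> U2" using U1 U2 by auto
    then obtain d where d: "d > 0" "cball p d \<subseteq> U1 \<inter> U2" by (meson open_contains_cball)
    \<comment> \<open>The radius is taken from the fixed sequence and small enough for both the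
      equation and the smoothness of g on the closed ball.\<close>
    obtain j where j: "\<rho> j \<le> d"
    proof -
      obtain j where "r / d < real j" using reals_Archimedean2 by blast
      then have "r \<le> d * real (j + 2)" using d(1) by (simp add: field_simps)
      then show ?thesis by (intro that[of j]) (simp add: \<rho>_def pos_divide_le_eq)
    qed
    obtain h where h: "smooth_on UNIV h" "\<And>x. norm (x - p) \<le> \<rho> j / 2 \<Longrightarrow> h x = 1" "\<And>x. norm (x - p) \<ge> \<rho> j \<Longrightarrow> h x = 0"
    proof (rule exists_cutoff[OF \<rho>(1)[of j], of p])
      fix h assume "smooth_on UNIV h" "\<And>x. norm (x - p) \<le> \<rho> j / 2 \<Longrightarrow> h x = 1" "\<And>x. norm (x - p) \<ge> \<rho> j \<Longrightarrow> h x = 0"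
      then show thesis by (rule that)
    qed
    have sub: "cball p (\<rho> j) \<subseteq> U1 \<inter> U2" using d(2) j by auto
    have sv: "smooth_on U2 v" using smooth_on_subset[OF v(1)] by simp
    \<comment> \<open>Near p this is v - g, which solves the homogeneous equation; the cutoff makes
      it a global function supported where g is smooth.\<close>
    define f where "f = (\<lambda>x. h x * (v x - g x))"
    have f: "smooth_on UNIV f"
    proof (rule smooth_on_extend_by_zero[OF U2(1)])
      show "smooth_on U2 f"
        unfolding f_def using smooth_on_subset[OF h(1)] by (intro smooth_on_mult smooth_on_diff U2 sv) simp
      show "f x = 0" if "x \<notin> cball p (\<rho> j)" for x
        using that h(3)[of x] by (simp add: f_def dist_norm norm_minus_commute)
      show "closed (cball p (\<rho> j))" by (rule closed_cball)
      show "cball p (\<rho> j) \<subseteq> U2" using sub by blast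
    qed
    have supp: "supported p (\<rho> j) f" unfolding supported_def f_def using h(3) by simp
    have near: "mi_deriv \<alpha> f x = mi_deriv \<alpha> v x - mi_deriv \<alpha> g x" if "norm (x - p) < \<rho> j / 2" for \<alpha> x
    proof -
      have x: "x \<in> ball p (\<rho> j / 2)" using that by (simp add: dist_norm norm_minus_commute)
      have "mi_deriv \<alpha> f x = mi_deriv \<alpha> (\<lambda>x. v x - g x) x"
        by (rule mi_deriv_cong_open[OF open_ball x]) (simp add: f_def h(2) dist_norm norm_minus_commute)
      moreover have "x \<in> U2" using x sub \<rho>(1)[of j] by auto
      ultimately show ?thesis using mi_deriv_diff[OF U2(1) sv U2(3)] by simp
    qed
    have L0: "diff_op m a f x = 0" if x: "norm (x - p) < \<rho> j / 2" for x
    proof -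
      have "x \<in> cball p (\<rho> j)" using x \<rho>(1)[of j] by (simp add: dist_norm norm_minus_commute)
      then have "diff_op m a g x = diff_op m a v x" using sub U1(3) by blast
      moreover have "diff_op m a f x = diff_op m a v x - diff_op m a g x"
        unfolding diff_op_def near[OF x] by (simp add: right_diff_distrib sum_subtractf)
      ultimately show ?thesis by simp
    qed
    have "\<exists>C. C \<ge> 0 \<and> (\<forall>x. norm (mi_deriv \<alpha> f x) \<le> C)" for \<alpha>
    proof (rule smooth_supported_bounded[OF smooth_on_mi_deriv[OF f, of \<alpha>] supported_mi_deriv[OF supp, of \<alpha>]])
      fix C assume "C \<ge> 0" "\<And>x. norm (mi_deriv \<alpha> f x) \<le> C"
      then show ?thesis by (intro exI[of _ C]) simp
    qed
    then have "\<forall>\<alpha>. \<exists>C. C \<ge> 0 \<and> (\<forall>x. norm (mi_deriv \<alpha> f x) \<le> C)" ..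
    from choice[OF this] obtain C where "\<forall>\<alpha>. C \<alpha> \<ge> 0 \<and> (\<forall>x. norm (mi_deriv \<alpha> f x) \<le> C \<alpha>)" ..
    then have C: "C \<alpha> \<ge> 0" "norm (mi_deriv \<alpha> f x) \<le> C \<alpha>" for \<alpha> x by simp_all
    define N where "N = (\<Sum>\<alpha> :: nat ^ 'n | mi_abs \<alpha> \<le> m. C \<alpha>)"
    have N: "norm (mi_deriv \<alpha> f x) \<le> N" if "mi_abs \<alpha> \<le> m" for \<alpha> x
    proof -
      have "C \<alpha> \<le> N" unfolding N_def using that C(1) by (intro member_le_sum finite_mi_abs_le) simp_all
      then show ?thesis using C(2)[of \<alpha> x] by simp
    qed
    have N0: "N \<ge> 0" unfolding N_def using C(1) by (intro sum_nonneg) simp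
    obtain k0 where "N < real k0" using reals_Archimedean2 by blast
    \<comment> \<open>Both conditions on k are independent: N < k defeats the size of f, and j at
      most k puts \<open>K j k\<close> into the sum defining \<open>T k\<close>.\<close>
    define k where "k = max k0 j"
    have k: "N < real k" "j \<le> k" using \<open>N < real k0\<close> by (auto simp: k_def)
    \<comment> \<open>Flatness of g leaves the derivatives of v at p unchanged, so those of f
      inherit the prescribed growth.\<close>
    have "mi_deriv (axis i k) f p = mi_deriv (axis i k) v p"
      using near[of p "axis i k"] \<rho>(1)[of j] g(2) by (simp add: flat_at_def)
    then have "(partial i ^^ k) f p = (partial i ^^ k) v p" unfolding mi_deriv_axis .
    moreover have "norm ((partial i ^^ k) f p) \<le> K j k * N"
      using K[of j k, unfolded good_def, rule_format, OF f supp L0 N] .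
    ultimately have "\<bar>T k\<bar> \<le> K j k * N" using v(3)[of k] unfolding norm_of_real by simp
    also have "\<dots> \<le> \<bar>K j k\<bar> * N" using N0 by (intro mult_right_mono) simp_all
    also have "\<dots> \<le> \<bar>K j k\<bar> * real k" using k(1) by (intro mult_left_mono) simp_all
    also have "\<dots> < real k * (1 + \<bar>K j k\<bar>)" using k(1) N0 by (simp add: algebra_simps)
    also have "\<dots> \<le> T k"
    proof -
      have "\<bar>K j k\<bar> \<le> (\<Sum>j\<le>k. \<bar>K j k\<bar>)" using k(2) by (intro member_le_sum) simp_all
      then show ?thesis unfolding T_def by (intro mult_left_mono) simp_all
    qed
    finally show False by simp
  qed
  ultimately show ?thesis by blast
qed

end
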